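(* Let $(\mathbb X,\mathbb A,q,c)$ be an MDP with $\mathbb X=\mathbb X_W\times\mathbb X_Y$ such that for each $y\in\mathbb X_Y$ the stochastic kernel $q(\cdot|\cdot,y,\cdot)$ on $\mathbb X=\mathbb X_W\times\mathbb X_Y$ given $\mathbb X_W\times\mathbb A$ is semi-uniform Feller, and the nonnegative function $c:\mathbb X\times\mathbb A\to\overline{\mathbb R}$ is $\mathbb{MK}(\mathbb X_W\times\mathbb A,\mathbb X_Y)$-inf-compact. Let $\alpha\ge0$. Then: (i) the functions $v_{t,\alpha}$, $t=0,1,\ldots$, and $v_\alpha$ belong to $LW(\mathbb X)$, and $v_{t,\alpha}(x)\uparrow v_\alpha(x)$ as $t\to+\infty$ for all $x\in\mathbb X$; (ii) $v_{t+1,\alpha}(x)=\min_{a\in\mathbb A}\eta^\alpha_{v_{t,\alpha}}(x,a)$, $x\in\mathbb X$, $t=0,1,\ldots$, where $v_{0,\alpha}(x)=0$ for all $x\in\mathbb X$, and the nonempty sets $A_{t,\alpha}(x):=\{a\in\mathbb A:v_{t+1,\alpha}(x)=\eta^\alpha_{v_{t,\alpha}}(x,a)\}$, $x\in\mathbb X$, $t=0,1,\ldots$, satisfy: (a) the graph $\mathrm{Gr}(A_{t,\alpha})=\{(x,a):x\in\mathbb X,\,a\in A_{t,\alpha}(x)\}$ is a Borel subset of $\mathbb X\times\mathbb A$, and (b) if $v_{t+1,\alpha}(x)=+\infty$, then $A_{t,\alpha}(x)=\mathbb A$, and if $v_{t+1,\alpha}(x)<+\infty$, then $A_{t,\alpha}(x)$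 is compact; (iii) for any $T=1,2,\ldots$ there exists a Markov optimal $T$-horizon policy $(\phi_0,\ldots,\phi_{T-1})$, and if for a $T$-horizon Markov policy $(\phi_0,\ldots,\phi_{T-1})$ the inclusions $\phi_{T-1-t}(x)\in A_{t,\alpha}(x)$, $x\in\mathbb X$, $t=0,\ldots,T-1$, hold, then this policy is $T$-horizon optimal; (iv) $v_\alpha(x)=\min_{a\in\mathbb A}\eta^\alpha_{v_\alpha}(x,a)$, $x\in\mathbb X$, and the nonempty sets $A_\alpha(x):=\{a\in\mathbb A:v_\alpha(x)=\eta^\alpha_{v_\alpha}(x,a)\}$, $x\in\mathbb X$, satisfy: (a) the graph $\mathrm{Gr}(A_\alpha)=\{(x,a):x\in\mathbb X,\,a\in A_\alpha(x)\}$ is a Borel subset of $\mathbb X\times\mathbb A$, and (b) if $v_\alpha(x)=+\infty$, then $A_\alpha(x)=\mathbb A$, and if $v_\alpha(x)<+\infty$, then $A_\alpha(x)$ is compact; (v) for the infinite horizon $T=\infty$ there exists a stationary discount-optimal policy $\phi_\alpha$, and a stationary policy $\phi_\alpha$ is optimal if and only if $\phi_\alpha(x)\in A_\alpha(x)$ for all $x\in\mathbb X$.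
   Context: For a metric space $S$, $\mathcal B(S)$ is its Borel $\sigma$-field. A stochastic kernel $\Psi$ on $S_1$ given $S_2$ is a map $\mathcal B(S_1)\times S_2\to[0,1]$ that is a probability measure in the first argument and Borel measurable in the second. For a kernel on $S_1\times S_2$ write $\Psi(A,B|s_3):=\Psi(A\times B|s_3)$. A stochastic kernel $\Psi$ on $S_1\times S_2$ given $S_3$ (Borel subsets of Polish spaces) is semi-uniform Feller if, whenever $s_3^{(n)}\to s_3$ in $S_3$, for each bounded continuous $f:S_1\to\mathbb R$, $$\lim_{n\to\infty}\sup_{B\in\mathcal B(S_2)}\Big|\int_{S_1}f(s_1)\Psi(ds_1,B|s_3^{(n)})-\int_{S_1}f(s_1)\Psi(ds_1,B|s_3)\Big|=0.$$ $\overline{\mathbb R}=[-\infty,+\infty]$. A function $u:S_1\times S_2\to\overline{\mathbb R}$ is $\mathbb K$-inf-compact if for every nonempty compact $K\subset S_1$ and $\lambda\in\mathbb R$ the set $\{(s_1,s_2)\in K\times S_2:u(s_1,s_2)\le\lambda\}$ is compact. A Borel measurable $u:S_1\times S_2\times S_3\to\overline{\mathbb R}$ is $\mathbb{MK}(S_1\times S_3,S_2)$-inf-compact if for each $s_2\in S_2$ the function $(s_1,s_3)\mapsto u(s_1,s_2,s_3)$ is $\mathbb K$-inf-compact on $S_1\times S_3$ (here $c(w,y,a)$ with $S_1=\mathbb X_W$, $S_2=\mathbb X_Y$, $S_3=\mathbb A$). A discrete-time MDP $(\mathbb X,\mathbb A,q,c)$ has state space $\mathbb X=\mathbb X_W\times\mathbb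 X_Y$, nonempty action space $\mathbb A$ (all actions available at every state), transition probability $q$, a stochastic kernel on $\mathbb X$ given $\mathbb X\times\mathbb A$, and one-step cost $c$; $\mathbb X_W,\mathbb X_Y,\mathbb A$ are Borel subsets of Polish spaces. A policy is a sequence $\pi=\{\pi_t\}$ of stochastic kernels on $\mathbb A$ given $\mathbb X\times(\mathbb A\times\mathbb X)^t$; with an initial state $x$ it defines a probability measure on $(\mathbb X\times\mathbb A)^\infty$ with expectation $\mathbb E_x^\pi$. For $\alpha\ge0$, $v^\pi_{T,\alpha}(x):=\mathbb E^\pi_x\sum_{t=0}^{T-1}\alpha^tc(x_t,a_t)$, $v^\pi_{0,\alpha}:=0$, and $v^\pi_\alpha$ is the case $T=\infty$; $v_{T,\alpha}:=\inf_\pi v^\pi_{T,\alpha}$, $v_\alpha:=\inf_\pi v^\pi_\alpha$. A policy is $T$-horizon optimal (discount-optimal) if $v^\pi_{T,\alpha}=v_{T,\alpha}$ (respectively $v^\pi_\alpha=v_\alpha$) on $\mathbb X$. A Markov policy is given by Borel maps $\phi_t:\mathbb X\to\mathbb A$ with $a_t=\phi_t(x_t)$; it is stationary if $\phi_t=\phi$ for all $t$. $LW(\mathbb X)$ is the class of nonnegative Borel measurable $\varphi:\mathbb X\to\overline{\mathbb R}$ with $w\mapsto\varphi(w,y)$ lower semi-continuous on $\mathbb X_W$ for each $y\in\mathbb X_Y$. For $u\in LW(\mathbb X)$, $\eta^\alpha_u(x,a):=c(x,a)+\alpha\int_{\mathbb X}u(\tilde x)q(d\tilde x|x,a)$. Conventions: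 $0^0=1$, $0\cdot\infty=0$. *)

theory Defs
  imports "HOL-Probability.Probability"
begin

text \<open>A Borel subset of a Polish space is a set \<open>S \<in> sets borel\<close> over a type of class
  \<^class>\<open>polish_space\<close>. A stochastic kernel on \<open>N\<close> given \<open>M\<close> is an element of
  \<open>M \<rightarrow>\<^sub>M prob_algebra N\<close>.\<close>

abbreviation borel_on :: "'a::topological_space set \<Rightarrow> 'a measure" where
  "borel_on S \<equiv> restrict_space borel S"


subsection \<open>Semi-uniform Feller kernels\<close>

text \<open>The measure \<open>A \<mapsto> \<mu> (A \<times> B)\<close> on \<open>S\<^sub>1\<close>, written \<open>\<Psi>(ds\<^sub>1, B | s\<^sub>3)\<close> when \<open>\<mu> = \<Psi>(\<cdot> | s\<^sub>3)\<close>.\<close>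

definition slice ::
  "'s1::topological_space set \<Rightarrow> ('s1 \<times> 's2::topological_space) measure \<Rightarrow> 's2 set \<Rightarrow> 's1 measure"
where
  "slice S1 \<mu> B = measure_of S1 (sets (borel_on S1)) (\<lambda>A. emeasure \<mu> (A \<times> B))"

text \<open>The supremum is over the reals; it is a genuine one because for bounded \<open>f\<close> and
  probability measures \<open>\<Psi> s\<close> the terms are bounded.\<close>

definition semi_uniform_feller ::
  "'s1::topological_space set \<Rightarrow> 's2::topological_space set \<Rightarrow> 's3::topological_space set
    \<Rightarrow> ('s3 \<Rightarrow> ('s1 \<times> 's2) measure) \<Rightarrow> bool"
where
  "semi_uniform_feller S1 S2 S3 \<Psi> \<longleftrightarrow>
    (\<forall>s l. (\<forall>n. s n \<in> S3) \<longrightarrow> l \<in> S3 \<longrightarrow> s \<longlonglongrightarrow> l \<longrightarrow>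
      (\<forall>f::'s1 \<Rightarrow> real. continuous_on S1 f \<longrightarrow> bounded (f ` S1) \<longrightarrow>
        (\<lambda>n. SUP B \<in> sets (borel_on S2).
            \<bar>(\<integral>z. f z \<partial>slice S1 (\<Psi> (s n)) B) - (\<integral>z. f z \<partial>slice S1 (\<Psi> l) B)\<bar>)
          \<longlonglongrightarrow> 0))"


subsection \<open>Inf-compactness and lower semi-continuity\<close>

definition K_inf_compact ::
  "'s1::topological_space set \<Rightarrow> 's2::topological_space set \<Rightarrow> ('s1 \<times> 's2 \<Rightarrow> ereal) \<Rightarrow> bool"
where
  "K_inf_compact S1 S2 u \<longleftrightarrow>
    (\<forall>K (r::real). K \<noteq> {} \<longrightarrow> compact K \<longrightarrow> K \<subseteq> S1 \<longrightarrow> compact {p \<in> K \<times> S2. u p \<le> ereal r})"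

definition MK_inf_compact ::
  "'s1::topological_space set \<Rightarrow> 's2::topological_space set \<Rightarrow> 's3::topological_space set
    \<Rightarrow> ('s1 \<times> 's2 \<times> 's3 \<Rightarrow> ereal) \<Rightarrow> bool"
where
  "MK_inf_compact S1 S2 S3 u \<longleftrightarrow>
    u \<in> borel_measurable (borel_on (S1 \<times> S2 \<times> S3)) \<and>
    (\<forall>s2\<in>S2. K_inf_compact S1 S3 (\<lambda>(s1, s3). u (s1, s2, s3)))"

definition lsc_on :: "'s::topological_space set \<Rightarrow> ('s \<Rightarrow> ereal) \<Rightarrow> bool" where
  "lsc_on S f \<longleftrightarrow> (\<forall>s\<in>S. f s \<le> Liminf (at s within S) f)"

definition LW ::
  "'w::topological_space set \<Rightarrow> 'y::topological_space set \<Rightarrow> ('w \<times> 'y \<Rightarrow> ereal) set"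
where
  "LW XW XY = {\<phi>. \<phi> \<in> borel_measurable (borel_on (XW \<times> XY)) \<and>
    (\<forall>x \<in> XW \<times> XY. 0 \<le> \<phi> x) \<and> (\<forall>y\<in>XY. lsc_on XW (\<lambda>w. \<phi> (w, y)))}"


subsection \<open>Policies and strategic measures\<close>

text \<open>The histories \<open>x\<^sub>0, a\<^sub>0, \<dots>, x\<^sub>t\<^sub>-\<^sub>1, a\<^sub>t\<^sub>-\<^sub>1, x\<^sub>t\<close> are bracketed as \<open>(X \<times> A)\<^sup>t \<times> X\<close> instead of
  \<open>X \<times> (A \<times> X)\<^sup>t\<close>: a history is a pair of the family \<open>(x\<^sub>i, a\<^sub>i)\<close>, \<open>i < t\<close>, and the current
  state. All state and action spaces are second countable, so the product sigma-algebras used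
  for histories and trajectories are the Borel ones.\<close>

abbreviation sa_space :: "'x::topological_space set \<Rightarrow> 'a::topological_space set \<Rightarrow> ('x \<times> 'a) measure"
where
  "sa_space X A \<equiv> borel_on X \<Otimes>\<^sub>M borel_on A"

type_synonym ('x, 'a) history = "(nat \<Rightarrow> 'x \<times> 'a) \<times> 'x"
type_synonym ('x, 'a) policy = "nat \<Rightarrow> ('x, 'a) history \<Rightarrow> 'a measure"

definition policies ::
  "'x::topological_space set \<Rightarrow> 'a::topological_space set \<Rightarrow> ('x, 'a) policy set"
where
  "policies X A = {\<pi>. \<forall>t.
    \<pi> t \<in> (PiM {0..<t} (\<lambda>_. sa_space X A) \<Otimes>\<^sub>M borel_on X) \<rightarrow>\<^sub>M prob_algebra (borel_on A)}"

text \<open>The conditional law of \<open>(x\<^sub>t, a\<^sub>t)\<close> given \<open>h = (x\<^sub>i, a\<^sub>i)\<^bsub>i<t\<^esub>\<close>, for initial state \<open>x\<close>.\<close>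

definition step_kernel ::
  "'x::topological_space set \<Rightarrow> 'a::topological_space set \<Rightarrow> ('x \<times> 'a \<Rightarrow> 'x measure)
    \<Rightarrow> ('x, 'a) policy \<Rightarrow> 'x \<Rightarrow> nat \<Rightarrow> (nat \<Rightarrow> 'x \<times> 'a) \<Rightarrow> ('x \<times> 'a) measure"
where
  "step_kernel X A q \<pi> x t h =
    Giry_Monad.bind (case t of 0 \<Rightarrow> return (borel_on X) x | Suc s \<Rightarrow> q (h s))
      (\<lambda>x'. Giry_Monad.bind (\<pi> t (h, x')) (\<lambda>a. return (sa_space X A) (x', a)))"

text \<open>The measure on \<open>(X \<times> A)\<^sup>\<infinity>\<close> given by the Ionescu-Tulcea theorem; the term on the right is
  what \<open>PF.lim\<close> stands for inside the locale \<^locale>\<open>Ionescu_Tulcea\<close>.\<close>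

definition strategic_measure ::
  "'x::topological_space set \<Rightarrow> 'a::topological_space set \<Rightarrow> ('x \<times> 'a \<Rightarrow> 'x measure)
    \<Rightarrow> ('x, 'a) policy \<Rightarrow> 'x \<Rightarrow> (nat \<Rightarrow> 'x \<times> 'a) measure"
where
  "strategic_measure X A q \<pi> x =
    projective_family.lim UNIV
      (Ionescu_Tulcea.CI (step_kernel X A q \<pi> x) (\<lambda>_. sa_space X A)) (\<lambda>_. sa_space X A)"


subsection \<open>Values\<close>

text \<open>Integral of a nonnegative extended real function; negative values are cut off at \<open>0\<close>,
  which plays no role for the nonnegative functions it is applied to.\<close>

definition ext_integral :: "'b measure \<Rightarrow> ('b \<Rightarrow> ereal) \<Rightarrow> ereal" where
  "ext_integral M f = enn2ereal (\<integral>\<^sup>+ z. e2ennreal (f z) \<partial>M)"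

definition policy_value ::
  "'x::topological_space set \<Rightarrow> 'a::topological_space set \<Rightarrow> ('x \<times> 'a \<Rightarrow> 'x measure)
    \<Rightarrow> ('x \<times> 'a \<Rightarrow> ereal) \<Rightarrow> real \<Rightarrow> nat \<Rightarrow> ('x, 'a) policy \<Rightarrow> 'x \<Rightarrow> ereal"
where
  "policy_value X A q c \<alpha> T \<pi> x =
    ext_integral (strategic_measure X A q \<pi> x) (\<lambda>\<omega>. \<Sum>t<T. ereal (\<alpha> ^ t) * c (\<omega> t))"

definition policy_value_inf ::
  "'x::topological_space set \<Rightarrow> 'a::topological_space set \<Rightarrow> ('x \<times> 'a \<Rightarrow> 'x measure)
    \<Rightarrow> ('x \<times> 'a \<Rightarrow> ereal) \<Rightarrow> real \<Rightarrow> ('x, 'a) policy \<Rightarrow> 'x \<Rightarrow> ereal"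
where
  "policy_value_inf X A q c \<alpha> \<pi> x =
    ext_integral (strategic_measure X A q \<pi> x) (\<lambda>\<omega>. \<Sum>t. ereal (\<alpha> ^ t) * c (\<omega> t))"

definition opt_value ::
  "'x::topological_space set \<Rightarrow> 'a::topological_space set \<Rightarrow> ('x \<times> 'a \<Rightarrow> 'x measure)
    \<Rightarrow> ('x \<times> 'a \<Rightarrow> ereal) \<Rightarrow> real \<Rightarrow> nat \<Rightarrow> 'x \<Rightarrow> ereal"
where
  "opt_value X A q c \<alpha> T x = (INF \<pi>\<in>policies X A. policy_value X A q c \<alpha> T \<pi> x)"

definition opt_value_inf ::
  "'x::topological_space set \<Rightarrow> 'a::topological_space set \<Rightarrow> ('x \<times> 'a \<Rightarrow> 'x measure)
    \<Rightarrow> ('x \<times> 'a \<Rightarrow> ereal) \<Rightarrow> real \<Rightarrow> 'x \<Rightarrow> ereal"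
where
  "opt_value_inf X A q c \<alpha> x = (INF \<pi>\<in>policies X A. policy_value_inf X A q c \<alpha> \<pi> x)"

definition horizon_optimal ::
  "'x::topological_space set \<Rightarrow> 'a::topological_space set \<Rightarrow> ('x \<times> 'a \<Rightarrow> 'x measure)
    \<Rightarrow> ('x \<times> 'a \<Rightarrow> ereal) \<Rightarrow> real \<Rightarrow> nat \<Rightarrow> ('x, 'a) policy \<Rightarrow> bool"
where
  "horizon_optimal X A q c \<alpha> T \<pi> \<longleftrightarrow>
    \<pi> \<in> policies X A \<and> (\<forall>x\<in>X. policy_value X A q c \<alpha> T \<pi> x = opt_value X A q c \<alpha> T x)"

definition discount_optimal ::
  "'x::topological_space set \<Rightarrow> 'a::topological_space set \<Rightarrow> ('x \<times> 'a \<Rightarrow> 'x measure)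
    \<Rightarrow> ('x \<times> 'a \<Rightarrow> ereal) \<Rightarrow> real \<Rightarrow> ('x, 'a) policy \<Rightarrow> bool"
where
  "discount_optimal X A q c \<alpha> \<pi> \<longleftrightarrow>
    \<pi> \<in> policies X A \<and> (\<forall>x\<in>X. policy_value_inf X A q c \<alpha> \<pi> x = opt_value_inf X A q c \<alpha> x)"


subsection \<open>Markov policies\<close>

definition markov_policy ::
  "'a::topological_space set \<Rightarrow> (nat \<Rightarrow> 'x \<Rightarrow> 'a) \<Rightarrow> ('x, 'a) policy"
where
  "markov_policy A \<phi> = (\<lambda>t (h, x). return (borel_on A) (\<phi> t x))"

definition stationary_policy ::
  "'a::topological_space set \<Rightarrow> ('x \<Rightarrow> 'a) \<Rightarrow> ('x, 'a) policy"
where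
  "stationary_policy A \<phi> = markov_policy A (\<lambda>_. \<phi>)"

text \<open>A \<open>T\<close>-horizon Markov policy \<open>(\<phi>\<^sub>0, \<dots>, \<phi>\<^sub>T\<^sub>-\<^sub>1)\<close> is viewed as a policy by repeating its last
  map; the decisions from time \<open>T\<close> on do not affect \<open>T\<close>-horizon values.\<close>

definition horizon_markov_policy ::
  "'a::topological_space set \<Rightarrow> nat \<Rightarrow> (nat \<Rightarrow> 'x \<Rightarrow> 'a) \<Rightarrow> ('x, 'a) policy"
where
  "horizon_markov_policy A T \<phi> = markov_policy A (\<lambda>t. \<phi> (min t (T - 1)))"


subsection \<open>Optimality operator\<close>

definition eta ::
  "('x \<times> 'a \<Rightarrow> 'x measure) \<Rightarrow> ('x \<times> 'a \<Rightarrow> ereal) \<Rightarrow> real \<Rightarrow> ('x \<Rightarrow> ereal) \<Rightarrow> 'x \<Rightarrow> 'a \<Rightarrow> ereal"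
where
  "eta q c \<alpha> u x a = c (x, a) + ereal \<alpha> * ext_integral (q (x, a)) u"

definition is_min_over :: "'a set \<Rightarrow> ('a \<Rightarrow> ereal) \<Rightarrow> ereal \<Rightarrow> bool" where
  "is_min_over A f m \<longleftrightarrow> m \<in> f ` A \<and> (\<forall>a\<in>A. m \<le> f a)"

definition opt_actions ::
  "'x::topological_space set \<Rightarrow> 'a::topological_space set \<Rightarrow> ('x \<times> 'a \<Rightarrow> 'x measure)
    \<Rightarrow> ('x \<times> 'a \<Rightarrow> ereal) \<Rightarrow> real \<Rightarrow> nat \<Rightarrow> 'x \<Rightarrow> 'a set"
where
  "opt_actions X A q c \<alpha> t x =
    {a \<in> A. opt_value X A q c \<alpha> (t + 1) x = eta q c \<alpha> (opt_value X A q c \<alpha> t) x a}"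

definition opt_actions_inf ::
  "'x::topological_space set \<Rightarrow> 'a::topological_space set \<Rightarrow> ('x \<times> 'a \<Rightarrow> 'x measure)
    \<Rightarrow> ('x \<times> 'a \<Rightarrow> ereal) \<Rightarrow> real \<Rightarrow> 'x \<Rightarrow> 'a set"
where
  "opt_actions_inf X A q c \<alpha> x =
    {a \<in> A. opt_value_inf X A q c \<alpha> x = eta q c \<alpha> (opt_value_inf X A q c \<alpha>) x a}"

definition graph_on :: "'x set \<Rightarrow> ('x \<Rightarrow> 'a set) \<Rightarrow> ('x \<times> 'a) set" where
  "graph_on X F = {(x, a). x \<in> X \<and> a \<in> F x}"

end

theory Submission
  imports Defs
begin

text \<open>
Dynamic programming for nonnegative costs rests on three facts: the one-step optimality operator
maps \<open>LW\<close> into itself, its minima are attained by Borel maps, and it commutes with increasing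
limits. Everything is computed in \<^typ>\<open>ennreal\<close>; only the last part of the proof translates to
\<^typ>\<open>ereal\<close>.

Borel measurability is the deep point. The minimum over \<open>a\<close> of a Borel function with compact
level sets is Borel exactly because a Borel set \<open>E\<close> with compact sections has a Borel projection,
and a minimizing Borel map is a Borel uniformization of such a set. Both follow from Novikov's
separation theorem for sequences of analytic sets (\<open>novikov_separation\<close>): it gives the
Kunugui-Novikov theorem (\<open>borel_rectangle_cover\<close>), by which a Borel set with open sections is a
countable union of rectangles \<open>Y n \<times> V n\<close> with Borel \<open>Y n\<close> and open \<open>V n\<close>. Applied to
the complement of \<open>E\<close>, together with a Borel choice of finite covers of the sections by small
balls, it turns "the section over \<open>x\<close> is empty" into a countable combination of Borel conditions
(\<open>borel_projection_compact_sections\<close>). A selector is then found by successive approximation in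
ever smaller balls (\<open>borel_selector_compact_sections\<close>).

The same rectangles give lower semi-continuity of \<open>(w, a) \<mapsto> \<integral> u dq(\<cdot> | w, y, a)\<close> for \<open>u\<close> in
\<open>LW\<close>: the set where \<open>u > t\<close> is a countable union of rectangles \<open>V n \<times> Y n\<close>, semi-uniform
Feller continuity makes the measure of one rectangle lower semi-continuous, splitting along the
sets \<open>Y n\<close> extends this to finite unions, and the layer-cake formula with Fatou's lemma
extends it to the integral (\<open>seq_lsc_on_integral\<close>). Adding the inf-compact cost, \<open>\<eta>\<close> becomes
inf-compact in \<open>(w, a)\<close>, which makes the minimum attained and lower semi-continuous in \<open>w\<close>.

Put \<open>V 0 = 0\<close>, let \<open>V (n + 1)\<close> be the minimum over \<open>a\<close> of \<open>\<eta>\<close> for \<open>V n\<close>, and let \<open>Vinf\<close> be the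
limit of the increasing sequence \<open>V n\<close>. Compactness of the level sets allows the limit to be
exchanged with the minimum, so \<open>Vinf\<close> solves the optimality equation (\<open>bellman_Vinf\<close>). On the
side of policies, conditioning on the first step of the Ionescu-Tulcea measure gives, by backward
induction over histories, that no policy costs less than \<open>V n\<close> over \<open>n\<close> steps, while a Markov
policy built from minimizers attains it. For the infinite horizon the cost of a stationary policy
\<open>\<phi>\<close> is the least nonnegative solution of \<open>U(x) = \<eta>\<^sub>U(x, \<phi>(x))\<close>. It is at least \<open>Vinf\<close>, and it
equals \<open>Vinf\<close> exactly when \<open>Vinf\<close> itself is a solution, that is, when \<open>\<phi>\<close> selects minimizers.
\<close>

section \<open>Analytic sets and Novikov separation\<close>

instance prod :: (polish_space, polish_space) polish_space ..

text \<open>Allowing an arbitrary closed domain in the Baire space, and not only the whole space, includes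
the empty set and makes closure under countable intersections immediate: the points of the domain
at which all the maps agree form a closed set again.\<close>

definition analytic_set :: "'a::topological_space set \<Rightarrow> bool" where
  "analytic_set S \<longleftrightarrow> (\<exists>C (f::(nat \<Rightarrow> nat) \<Rightarrow> 'a). closed C \<and> continuous_on C f \<and> S = f ` C)"

lemma analytic_set_continuous_image:
  fixes S :: "'a::topological_space set"
  assumes "analytic_set S" "continuous_on S g"
  shows "analytic_set (g ` S)"
proof -
  obtain C and f :: "(nat \<Rightarrow> nat) \<Rightarrow> 'a" where "closed C" "continuous_on C f" "S = f ` C"
    using assms(1) unfolding analytic_set_def by blast
  then show ?thesis
    using assms(2) unfolding analytic_set_def
    by (intro exI[of _ C] exI[of _ "g \<circ> f"]) (auto intro!: continuous_on_compose simp: image_comp simp del: o_apply)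
qed

lemma continuous_on_coordinate_compose:
  fixes f :: "nat \<Rightarrow> 'b::topological_space"
  shows "continuous_on S (\<lambda>\<alpha>::nat\<Rightarrow>nat. f (\<alpha> n))"
proof -
  have "continuous_on S (\<lambda>\<alpha>::nat\<Rightarrow>nat. \<alpha> n)"
    by (rule continuous_on_product_then_coordinatewise) (rule continuous_on_id)
  moreover have "continuous_on T f" for T by simp
  ultimately show ?thesis
    using continuous_on_compose[of S "\<lambda>\<alpha>. \<alpha> n" f] by (simp add: comp_def)
qed

lemma dense_sequence_exists:
  obtains d :: "nat \<Rightarrow> 'a::polish_space" where "\<And>x e. e > 0 \<Longrightarrow> \<exists>n. dist (d n) x < e"
proof -
  obtain D :: "'a set" where D: "countable D" "\<And>X. open X \<Longrightarrow> X \<noteq> {} \<Longrightarrow> \<exists>d\<in>D. d \<in> X"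
    using countable_dense_exists by blast
  have "D \<noteq> {}" using D(2)[of UNIV] by auto
  show ?thesis
  proof (rule that[of "from_nat_into D"])
    fix x :: 'a and e :: real assume "e > 0"
    then obtain y where "y \<in> D" "y \<in> ball x e" using D(2)[of "ball x e"] by auto
    then show "\<exists>n. dist (from_nat_into D n) x < e"
      using from_nat_into_surj[OF D(1)] by (metis dist_commute mem_ball)
  qed
qed

lemma geometric_dist_bound:
  fixes x :: "nat \<Rightarrow> 'a::metric_space"
  assumes "\<And>n. dist (x n) (x (Suc n)) \<le> (1/2)^n"
  shows "dist (x n) (x (n + k)) \<le> 2 * (1/2)^n"
proof -
  have "dist (x n) (x (n + k)) \<le> 2 * (1/2)^n - 2 * (1/2)^(n+k)"
  proof (induction k)
    case (Suc k)
    have "dist (x n) (x (n + Suc k)) \<le> dist (x n) (x (n+k)) + dist (x (n+k)) (x (Suc (n+k)))"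
      by (simp add: dist_triangle)
    also have "\<dots> \<le> 2 * (1/2)^n - 2 * (1/2)^(n+k) + (1/2)^(n+k)"
      using Suc assms[of "n+k"] by simp
    finally show ?case by simp
  qed simp
  also have "\<dots> \<le> 2 * (1/2)^n" by simp
  finally show ?thesis .
qed

text \<open>A point of a Polish space is coded by a sequence of indices of a dense sequence along which
consecutive distances are at most $2^{-n}$. Such codes form a closed set, and the limit depends
continuously on the code because the convergence is uniform.\<close>

lemma analytic_set_closed:
  fixes S :: "'a::polish_space set"
  assumes "closed S"
  shows "analytic_set S"
proof -
  obtain d :: "nat \<Rightarrow> 'a" where d: "\<And>x e. e > 0 \<Longrightarrow> \<exists>n. dist (d n) x < e"
    using dense_sequence_exists by blast
  define C where "C = {\<alpha>::nat\<Rightarrow>nat. \<forall>n. dist (d (\<alpha> n)) (d (\<alpha> (Suc n))) \<le> (1/2)^n}"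
  define f where "f \<alpha> = lim (\<lambda>n. d (\<alpha> n))" for \<alpha> :: "nat \<Rightarrow> nat"
  have closedC: "closed C"
    unfolding C_def
    by (intro closed_Collect_all closed_Collect_le continuous_intros continuous_on_coordinate_compose)
  have conv: "(\<lambda>n. d (\<alpha> n)) \<longlonglongrightarrow> f \<alpha>" and bound: "dist (d (\<alpha> n)) (f \<alpha>) \<le> 2 * (1/2)^n"
    if "\<alpha> \<in> C" for \<alpha> n
  proof -
    have b: "dist (d (\<alpha> n)) (d (\<alpha> (n + k))) \<le> 2 * (1/2)^n" for n k
      using that by (intro geometric_dist_bound[of "\<lambda>n. d (\<alpha> n)"]) (auto simp: C_def)
    have "Cauchy (\<lambda>n. d (\<alpha> n))"
    proof (rule metric_CauchyI)
      fix e :: real assume "e > 0"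
      have "(\<lambda>n. 2 * (1/2::real)^n) \<longlonglongrightarrow> 2 * 0"
        by (intro tendsto_intros LIMSEQ_power_zero) auto
      then obtain M where M: "2 * (1/2::real)^M < e / 2"
        using \<open>e > 0\<close> order_tendstoD(2)[of "\<lambda>n. 2 * (1/2::real)^n" 0 sequentially "e/2"]
        by (auto simp: eventually_sequentially simp del: power_one_over)
      show "\<exists>M. \<forall>m\<ge>M. \<forall>n\<ge>M. dist (d (\<alpha> m)) (d (\<alpha> n)) < e"
      proof (intro exI allI impI)
        fix m n assume "m \<ge> M" "n \<ge> M"
        then have "dist (d (\<alpha> M)) (d (\<alpha> m)) < e/2" "dist (d (\<alpha> M)) (d (\<alpha> n)) < e/2"
          using b[of M "m - M"] b[of M "n - M"] M by auto
        then show "dist (d (\<alpha> m)) (d (\<alpha> n)) < e"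
          by (metis dist_commute dist_triangle_half_l)
      qed
    qed
    then show c: "(\<lambda>n. d (\<alpha> n)) \<longlonglongrightarrow> f \<alpha>"
      unfolding f_def by (simp add: Cauchy_convergent convergent_LIMSEQ_iff[symmetric])
    have "(\<lambda>k. dist (d (\<alpha> n)) (d (\<alpha> (k + n)))) \<longlonglongrightarrow> dist (d (\<alpha> n)) (f \<alpha>)"
      by (intro tendsto_intros LIMSEQ_ignore_initial_segment c)
    then show "dist (d (\<alpha> n)) (f \<alpha>) \<le> 2 * (1/2)^n"
      by (rule LIMSEQ_le_const2) (use b[of n] in \<open>simp add: add.commute\<close>)
  qed
  have cont: "continuous_on C f"
  proof (rule uniform_limit_theorem)
    show "\<forall>\<^sub>F n in sequentially. continuous_on C (\<lambda>\<alpha>. d (\<alpha> n))"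
      by (simp add: continuous_on_coordinate_compose)
    show "uniform_limit C (\<lambda>n \<alpha>. d (\<alpha> n)) f sequentially"
    proof (rule uniform_limitI)
      fix e :: real assume "e > 0"
      have "(\<lambda>n. 2 * (1/2::real)^n) \<longlonglongrightarrow> 2 * 0"
        by (intro tendsto_intros LIMSEQ_power_zero) auto
      then have "\<forall>\<^sub>F n in sequentially. 2 * (1/2::real)^n < e"
        using \<open>e > 0\<close> order_tendstoD(2)[of "\<lambda>n. 2 * (1/2::real)^n" 0 sequentially e] by simp
      then show "\<forall>\<^sub>F n in sequentially. \<forall>\<alpha>\<in>C. dist (d (\<alpha> n)) (f \<alpha>) < e"
        by eventually_elim (use bound in \<open>auto intro: le_less_trans\<close>)
    qed
  qed simp
  have surj: "\<exists>\<alpha>\<in>C. f \<alpha> = x" for x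
  proof -
    have "\<exists>i. dist (d i) x < (1/2)^n / 4" for n :: nat by (rule d) simp
    then obtain \<alpha> where \<alpha>: "\<And>n. dist (d (\<alpha> n)) x < (1/2)^n / 4" by metis
    have "dist (d (\<alpha> n)) (d (\<alpha> (Suc n))) \<le> (1/2)^n" for n
    proof -
      have "dist (d (\<alpha> n)) (d (\<alpha> (Suc n))) \<le> dist (d (\<alpha> n)) x + dist (d (\<alpha> (Suc n))) x"
        by (rule dist_triangle2)
      also have "\<dots> \<le> (1/2)^n / 4 + (1/2)^Suc n / 4"
        using \<alpha>[of n] \<alpha>[of "Suc n"] by linarith
      also have "\<dots> \<le> (1/2)^n" by simp
      finally show ?thesis .
    qed
    then have "\<alpha> \<in> C" by (simp add: C_def)
    moreover have "(\<lambda>n. d (\<alpha> n)) \<longlonglongrightarrow> x"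
    proof (rule metric_tendsto_imp_tendsto)
      have "(\<lambda>n. (1/2::real)^n / 4) \<longlonglongrightarrow> 0 / 4"
        by (intro tendsto_intros LIMSEQ_power_zero) auto
      then show "(\<lambda>n. (1/2::real)^n / 4) \<longlonglongrightarrow> 0" by simp
      show "\<forall>\<^sub>F n in sequentially. dist (d (\<alpha> n)) x \<le> dist ((1/2::real)^n / 4) 0"
        using \<alpha> by (intro always_eventually allI) (simp add: less_imp_le dist_real_def del: power_one_over)
    qed
    ultimately show ?thesis using LIMSEQ_unique conv by blast
  qed
  have "closed (C \<inter> f -` S)" using continuous_closed_preimage[OF cont closedC assms] .
  moreover have "f ` (C \<inter> f -` S) = S"
  proof (intro equalityI subsetI)
    fix x assume "x \<in> S"
    moreover obtain \<alpha> where "\<alpha> \<in> C" "f \<alpha> = x" using surj[of x] by blast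
    ultimately show "x \<in> f ` (C \<inter> f -` S)" by (intro image_eqI[of _ _ \<alpha>]) auto
  qed auto
  ultimately show ?thesis
    unfolding analytic_set_def using continuous_on_subset[OF cont, of "C \<inter> f -` S"]
    by (metis inf_le1)
qed

text \<open>The first entry of a code tells which of the sets it is meant for, the rest is a code for that set.\<close>

lemma analytic_set_UN:
  fixes A :: "nat \<Rightarrow> 'a::topological_space set"
  assumes "\<And>n. analytic_set (A n)"
  shows "analytic_set (\<Union>n. A n)"
proof -
  obtain C and f :: "nat \<Rightarrow> (nat \<Rightarrow> nat) \<Rightarrow> 'a" where
    Cf: "\<And>n. closed (C n)" "\<And>n. continuous_on (C n) (f n)" "\<And>n. A n = f n ` C n"
    using assms unfolding analytic_set_def by metis
  define shift :: "(nat \<Rightarrow> nat) \<Rightarrow> nat \<Rightarrow> nat" where "shift \<alpha> = (\<lambda>k. \<alpha> (Suc k))" for \<alpha>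
  have cont_shift: "continuous_on S shift" for S
    unfolding shift_def
    by (intro continuous_on_coordinatewise_then_product continuous_on_coordinate_compose[where f="\<lambda>x. x"])
  define D where "D = {\<alpha>. shift \<alpha> \<in> C (\<alpha> 0)}"
  have op0: "open {\<alpha>::nat\<Rightarrow>nat. \<alpha> 0 = n}" for n
    using open_vimage[OF Topological_Spaces.open_discrete[of "{n}"] continuous_on_coordinate_compose[of UNIV "\<lambda>x. x" 0]]
    by (simp add: vimage_def)
  have "closed ({\<alpha>. \<alpha> 0 \<noteq> n} \<union> shift -` C n)" for n
    using op0[of n] closed_vimage[OF Cf(1) cont_shift, of n]
    by (intro closed_Un) (auto simp: closed_def Compl_eq)
  then have "closed (\<Inter>n. {\<alpha>. \<alpha> 0 \<noteq> n} \<union> shift -` C n)" by blast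
  moreover have "(\<Inter>n. {\<alpha>. \<alpha> 0 \<noteq> n} \<union> shift -` C n) = D" by (auto simp: D_def)
  ultimately have "closed D" by simp
  moreover have "continuous_on D (\<lambda>\<alpha>. f (\<alpha> 0) (shift \<alpha>))"
    unfolding continuous_on_def
  proof
    fix \<alpha> assume \<alpha>: "\<alpha> \<in> D"
    let ?N = "D \<inter> {\<beta>. \<beta> 0 = \<alpha> 0}"
    have "continuous_on ?N (f (\<alpha> 0) \<circ> shift)"
      by (intro continuous_on_compose cont_shift continuous_on_subset[OF Cf(2)]) (auto simp: D_def)
    then have "continuous_on ?N (\<lambda>\<alpha>. f (\<alpha> 0) (shift \<alpha>))"
      by (rule continuous_on_eq) auto
    then have "((\<lambda>\<alpha>. f (\<alpha> 0) (shift \<alpha>)) \<longlongrightarrow> f (\<alpha> 0) (shift \<alpha>)) (at \<alpha> within ?N)"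
      using \<alpha> unfolding continuous_on_def by blast
    moreover have "at \<alpha> within ?N = at \<alpha> within D"
      by (rule at_within_nhd[of _ "{\<beta>. \<beta> 0 = \<alpha> 0}"]) (auto simp: op0)
    ultimately show "((\<lambda>\<alpha>. f (\<alpha> 0) (shift \<alpha>)) \<longlongrightarrow> f (\<alpha> 0) (shift \<alpha>)) (at \<alpha> within D)" by simp
  qed
  moreover have "(\<Union>n. A n) = (\<lambda>\<alpha>. f (\<alpha> 0) (shift \<alpha>)) ` D"
  proof (intro equalityI subsetI)
    fix x assume "x \<in> (\<Union>n. A n)"
    then obtain n \<beta> where n: "\<beta> \<in> C n" "x = f n \<beta>" using Cf(3) by auto
    then have "shift (case_nat n \<beta>) = \<beta>" "case_nat n \<beta> 0 = n" by (auto simp: shift_def)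
    then show "x \<in> (\<lambda>\<alpha>. f (\<alpha> 0) (shift \<alpha>)) ` D" using n by (intro image_eqI[of _ _ "case_nat n \<beta>"]) (auto simp: D_def)
  qed (use Cf(3) in \<open>auto simp: D_def\<close>)
  ultimately show ?thesis unfolding analytic_set_def by blast
qed

text \<open>The components of the homeomorphism from the Baire space to its countable power.\<close>

definition nth_row :: "nat \<Rightarrow> (nat \<Rightarrow> nat) \<Rightarrow> nat \<Rightarrow> nat" where
  "nth_row n \<gamma> = (\<lambda>m. \<gamma> (prod_encode (n, m)))"

lemma continuous_on_nth_row: "continuous_on S (nth_row n)"
  unfolding nth_row_def
  by (intro continuous_on_coordinatewise_then_product continuous_on_coordinate_compose[where f="\<lambda>x. x"])

lemma rows_exist: "\<exists>\<gamma>. \<forall>n. nth_row n \<gamma> = \<alpha> n"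
  by (rule exI[of _ "\<lambda>k. case prod_decode k of (n, m) \<Rightarrow> \<alpha> n m"]) (auto simp: nth_row_def)

lemma analytic_set_INT:
  fixes A :: "nat \<Rightarrow> 'a::metric_space set"
  assumes "\<And>n. analytic_set (A n)"
  shows "analytic_set (\<Inter>n. A n)"
proof -
  obtain C and f :: "nat \<Rightarrow> (nat \<Rightarrow> nat) \<Rightarrow> 'a" where
    Cf: "\<And>n. closed (C n)" "\<And>n. continuous_on (C n) (f n)" "\<And>n. A n = f n ` C n"
    using assms unfolding analytic_set_def by metis
  define D where "D = (\<Inter>n. nth_row n -` C n)"
  have "closed D" unfolding D_def
    by (intro closed_INT ballI closed_vimage Cf continuous_on_nth_row)
  have cont: "continuous_on D (\<lambda>\<gamma>. f n (nth_row n \<gamma>))" for n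
    using continuous_on_compose[OF continuous_on_nth_row continuous_on_subset[OF Cf(2)], of n D n]
    by (auto simp: D_def comp_def)
  define E where "E = (\<Inter>n. {\<gamma>\<in>D. dist (f n (nth_row n \<gamma>)) (f 0 (nth_row 0 \<gamma>)) = 0})"
  have "closed E" unfolding E_def
    by (intro closed_INT ballI continuous_closed_preimage_constant continuous_intros cont \<open>closed D\<close>)
  moreover have "continuous_on E (\<lambda>\<gamma>. f 0 (nth_row 0 \<gamma>))"
    by (rule continuous_on_subset[OF cont]) (auto simp: E_def)
  moreover have "(\<Inter>n. A n) = (\<lambda>\<gamma>. f 0 (nth_row 0 \<gamma>)) ` E"
  proof (intro equalityI subsetI)
    fix x assume "x \<in> (\<Inter>n. A n)"
    then have "\<forall>n. \<exists>\<beta>. \<beta> \<in> C n \<and> x = f n \<beta>" using Cf(3) by auto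
    then obtain \<alpha> where \<alpha>: "\<And>n. \<alpha> n \<in> C n" "\<And>n. x = f n (\<alpha> n)" by metis
    obtain \<gamma> where \<gamma>: "\<And>n. nth_row n \<gamma> = \<alpha> n" using rows_exist by metis
    then have "\<gamma> \<in> E" using \<alpha>(1) by (auto simp: E_def D_def \<alpha>(2)[symmetric])
    then show "x \<in> (\<lambda>\<gamma>. f 0 (nth_row 0 \<gamma>)) ` E" using \<alpha>(2)[of 0] \<gamma>[of 0] by (intro image_eqI[of _ _ \<gamma>]) auto
  next
    fix x assume "x \<in> (\<lambda>\<gamma>. f 0 (nth_row 0 \<gamma>)) ` E"
    then obtain \<gamma> where g: "\<gamma> \<in> E" "x = f 0 (nth_row 0 \<gamma>)" by auto
    then have "f n (nth_row n \<gamma>) = x" "nth_row n \<gamma> \<in> C n" for n by (simp_all add: E_def D_def)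
    then show "x \<in> (\<Inter>n. A n)" using Cf(3) by (metis INT_I imageI)
  qed
  ultimately show ?thesis unfolding analytic_set_def by blast
qed

lemma analytic_set_Un:
  assumes "analytic_set S" "analytic_set T"
  shows "analytic_set (S \<union> T)"
proof -
  have "(\<Union>n::nat. if n = 0 then S else T) = S \<union> T" by (auto split: if_splits)
  then show ?thesis using analytic_set_UN[of "\<lambda>n::nat. if n = 0 then S else T"] assms by auto
qed

lemma analytic_set_Int:
  fixes S T :: "'a::metric_space set"
  assumes "analytic_set S" "analytic_set T"
  shows "analytic_set (S \<inter> T)"
proof -
  have "(\<Inter>n::nat. if n = 0 then S else T) = S \<inter> T" by (auto split: if_splits)
  then show ?thesis using analytic_set_INT[of "\<lambda>n::nat. if n = 0 then S else T"] assms by auto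
qed

lemma analytic_set_Times:
  fixes S :: "'a::topological_space set" and T :: "'b::topological_space set"
  assumes "analytic_set S" "analytic_set T"
  shows "analytic_set (S \<times> T)"
proof -
  obtain C and f :: "(nat \<Rightarrow> nat) \<Rightarrow> 'a" where Cf: "closed C" "continuous_on C f" "S = f ` C"
    using assms(1) unfolding analytic_set_def by blast
  obtain D and g :: "(nat \<Rightarrow> nat) \<Rightarrow> 'b" where Dg: "closed D" "continuous_on D g" "T = g ` D"
    using assms(2) unfolding analytic_set_def by blast
  define E where "E = nth_row 0 -` C \<inter> nth_row 1 -` D"
  have "closed E" unfolding E_def
    by (intro closed_Int closed_vimage Cf Dg continuous_on_nth_row)
  moreover have "continuous_on E (\<lambda>\<gamma>. (f (nth_row 0 \<gamma>), g (nth_row 1 \<gamma>)))"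
    using continuous_on_compose[OF continuous_on_nth_row continuous_on_subset[OF Cf(2)], of 0 E]
      continuous_on_compose[OF continuous_on_nth_row continuous_on_subset[OF Dg(2)], of 1 E]
    by (intro continuous_on_Pair) (auto simp: E_def comp_def)
  moreover have "S \<times> T = (\<lambda>\<gamma>. (f (nth_row 0 \<gamma>), g (nth_row 1 \<gamma>))) ` E"
  proof (intro equalityI subsetI)
    fix p assume "p \<in> S \<times> T"
    then obtain a b where ab: "a \<in> C" "b \<in> D" "p = (f a, g b)" using Cf Dg by auto
    obtain \<gamma> where "\<And>n. nth_row n \<gamma> = (if n = 0 then a else b)"
      using rows_exist[of "\<lambda>n. if n = 0 then a else b"] by auto
    then show "p \<in> (\<lambda>\<gamma>. (f (nth_row 0 \<gamma>), g (nth_row 1 \<gamma>))) ` E"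
      using ab by (intro image_eqI[of _ _ \<gamma>]) (auto simp: E_def)
  qed (use Cf Dg in \<open>auto simp: E_def\<close>)
  ultimately show ?thesis unfolding analytic_set_def by blast
qed

lemma analytic_set_open:
  fixes S :: "'a::polish_space set"
  assumes "open S"
  shows "analytic_set S"
proof (cases "S = UNIV")
  case True then show ?thesis by (simp add: analytic_set_closed)
next
  case False
  have "S = (\<Union>n::nat. {x. inverse (Suc n) \<le> infdist x (- S)})"
  proof (intro equalityI subsetI)
    fix x assume "x \<in> S"
    then have "infdist x (- S) > 0"
      using assms False by (intro infdist_pos_not_in_closed) auto
    then obtain n where "inverse (Suc n) < infdist x (- S)" using reals_Archimedean by blast
    then show "x \<in> (\<Union>n::nat. {x. inverse (Suc n) \<le> infdist x (- S)})" by (auto intro: less_imp_le)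
  next
    fix x assume "x \<in> (\<Union>n::nat. {x. inverse (Suc n) \<le> infdist x (- S)})"
    then obtain n where n: "inverse (Suc n) \<le> infdist x (- S)" by auto
    show "x \<in> S"
    proof (rule ccontr)
      assume "x \<notin> S"
      then have "infdist x (- S) = 0" by simp
      then show False using n by (simp add: not_le)
    qed
  qed
  moreover have "closed {x. inverse (Suc n) \<le> infdist x (- S)}" for n
    by (intro closed_Collect_le continuous_intros)
  ultimately show ?thesis using analytic_set_UN analytic_set_closed by (metis (no_types, lifting))
qed

text \<open>Complements of analytic sets need not be analytic, so the induction over the Borel sets carries
analyticity of the set and of its complement together.\<close>

lemma analytic_set_borel:
  fixes S :: "'a::polish_space set"
  assumes "S \<in> sets borel"
  shows "analytic_set S"
proof -
  have "S \<in> sigma_sets UNIV {S. open S}" using assms by (simp add: borel_def)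
  then have "analytic_set S \<and> analytic_set (- S)"
  proof (induction rule: sigma_sets.induct)
    case (Basic a)
    then show ?case by (auto intro: analytic_set_open analytic_set_closed)
  next
    case (Compl a)
    then show ?case by (simp add: Compl_eq_Diff_UNIV[symmetric])
  next
    case (Union a)
    then show ?case by (auto simp: uminus_Sup intro: analytic_set_UN analytic_set_INT)
  qed (auto intro: analytic_set_closed)
  then show ?thesis ..
qed

lemma cylinder_in_open:
  fixes \<alpha> :: "nat \<Rightarrow> nat"
  assumes "open W" "\<alpha> \<in> W"
  shows "\<exists>k. \<forall>\<beta>. (\<forall>i<k. \<beta> i = \<alpha> i) \<longrightarrow> \<beta> \<in> W"
proof (rule ccontr)
  assume "\<not> ?thesis"
  then have "\<forall>k. \<exists>\<beta>. (\<forall>i<k. \<beta> i = \<alpha> i) \<and> \<beta> \<notin> W" by blast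
  then obtain \<beta> where \<beta>: "\<And>k i. i < k \<Longrightarrow> \<beta> k i = \<alpha> i" "\<And>k. \<beta> k \<notin> W" by metis
  have "limitin (product_topology (\<lambda>i. euclidean) UNIV) \<beta> \<alpha> sequentially"
    unfolding limitin_componentwise
  proof (intro conjI ballI)
    fix i :: nat
    have "\<forall>\<^sub>F k in sequentially. \<beta> k i = \<alpha> i"
      using eventually_gt_at_top[of i] by eventually_elim (simp add: \<beta>)
    then show "limitin euclidean (\<lambda>c. \<beta> c i) (\<alpha> i) sequentially"
      by (simp add: tendsto_eventually)
  qed (auto simp: PiE_def)
  then have "\<beta> \<longlonglongrightarrow> \<alpha>" by (simp add: euclidean_product_topology)
  then have "\<forall>\<^sub>F k in sequentially. \<beta> k \<in> W" using assms by (rule topological_tendstoD)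
  then show False using \<beta>(2) by simp
qed

text \<open>Dependent choice for properties that concern only the first \<open>k\<close> entries of a sequence: the
partial choices fit together to one sequence.\<close>

lemma prefix_choice:
  fixes P :: "nat \<Rightarrow> (nat \<Rightarrow> 'b) \<Rightarrow> bool"
  assumes zero: "P 0 \<gamma>0"
    and step: "\<And>k \<gamma>. P k \<gamma> \<Longrightarrow> \<exists>j. P (Suc k) (\<gamma>(k := j))"
    and local: "\<And>k \<gamma> \<gamma>'. P k \<gamma> \<Longrightarrow> (\<And>i. i < k \<Longrightarrow> \<gamma> i = \<gamma>' i) \<Longrightarrow> P k \<gamma>'"
  shows "\<exists>\<gamma>. \<forall>k. P k \<gamma>"
proof -
  have "\<exists>g. \<forall>k. P k (g k) \<and> (\<exists>j. g (Suc k) = (g k)(k := j))"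
    by (rule dependent_nat_choice) (use zero step in blast)+
  then obtain g where g: "\<And>k. P k (g k)" "\<And>k. \<exists>j. g (Suc k) = (g k)(k := j)" by blast
  have stable: "g (Suc i + n) i = g (Suc i) i" for i n
  proof (induction n)
    case (Suc n)
    then show ?case using g(2)[of "Suc i + n"] by auto
  qed simp
  have "P k (\<lambda>i. g (Suc i) i)" for k
  proof (rule local[OF g(1)])
    fix i assume "i < k"
    then show "g k i = g (Suc i) i" using stable[of i "k - Suc i"] by simp
  qed
  then show ?thesis by blast
qed

definition borel_separable :: "(nat \<Rightarrow> 'a::topological_space set) \<Rightarrow> bool" where
  "borel_separable A \<longleftrightarrow> (\<exists>B. (\<forall>n. B n \<in> sets borel \<and> A n \<subseteq> B n) \<and> (\<Inter>n. B n) = {})"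

text \<open>If the set at position \<open>i\<close> is split into countably many pieces and the sequence is separable
for each piece, then the separating sets combine: unions at position \<open>i\<close>, intersections at
all other positions.\<close>

lemma borel_separable_split:
  assumes sep: "\<And>j::nat. borel_separable (A(i := D j))" and "A i \<subseteq> (\<Union>j. D j)"
  shows "borel_separable A"
proof -
  obtain B where B: "\<And>j n. B j n \<in> sets borel" "\<And>j n. (A(i := D j)) n \<subseteq> B j n" "\<And>j. (\<Inter>n. B j n) = {}"
    using sep unfolding borel_separable_def by metis
  let ?B = "\<lambda>n. if n = i then \<Union>j. B j i else \<Inter>j. B j n"
  have "?B n \<in> sets borel" for n using B(1) by auto
  moreover have "A n \<subseteq> ?B n" for n
      proof (cases "n = i")
    case True
    have "D j \<subseteq> B j i" for j using B(2)[of j i] by simp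
    then show ?thesis using True assms(2) by fastforce
  next
    case False
    then show ?thesis using B(2)[of _ n] by auto
  qed
  moreover have "(\<Inter>n. ?B n) = {}"
  proof (rule ccontr)
    assume "(\<Inter>n. ?B n) \<noteq> {}"
    then obtain x where x: "\<And>n. x \<in> ?B n" by blast
    then obtain j where "x \<in> B j i" using x[of i] by auto
    moreover have "x \<in> B j n" if "n \<noteq> i" for n using x[of n] that by auto
    ultimately have "x \<in> B j n" for n by (cases "n = i") auto
    then have "x \<in> (\<Inter>n. B j n)" by blast
    then show False using B(3) by simp
  qed
  ultimately show ?thesis unfolding borel_separable_def by (intro exI[of _ ?B]) auto
qed

text \<open>If the sequence were not separable, each \<open>A n\<close> could be shrunk, one entry of one code at a time
and with every entry of every code fixed eventually, so that non-separability persists. The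
codes of the points of the \<open>A n\<close> are enumerated jointly as the rows of one sequence \<open>\<gamma>\<close>. In the
limit each \<open>A n\<close> shrinks to a single point. If all these points agree, the intersection is not empty; if two of them
differ, disjoint neighbourhoods separate the sequence at a finite stage. Both are impossible.\<close>

lemma novikov_separation:
  fixes A :: "nat \<Rightarrow> 'a::t2_space set"
  assumes an: "\<And>n. analytic_set (A n)" and disj: "(\<Inter>n. A n) = {}"
  shows "borel_separable A"
proof (rule ccontr)
  assume nsep: "\<not> borel_separable A"
  obtain C and f :: "nat \<Rightarrow> (nat \<Rightarrow> nat) \<Rightarrow> 'a" where
    Cf: "\<And>n. closed (C n)" "\<And>n. continuous_on (C n) (f n)" "\<And>n. A n = f n ` C n"
    using an unfolding analytic_set_def by metis
  \<comment> \<open>the codes for A n that agree with the part of row n fixed before stage k\<close>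
  define N where "N k \<gamma> n = {\<beta>\<in>C n. \<forall>m. prod_encode (n, m) < k \<longrightarrow> \<beta> m = nth_row n \<gamma> m}"
    for k \<gamma> and n :: nat
  define P where "P k \<gamma> \<longleftrightarrow> \<not> borel_separable (\<lambda>n. f n ` N k \<gamma> n)" for k \<gamma>
  have "\<exists>\<gamma>. \<forall>k. P k \<gamma>"
  proof (rule prefix_choice)
    show "P 0 (\<lambda>_. 0)" using nsep by (simp add: P_def N_def Cf(3)[symmetric])
  next
    fix k \<gamma> assume P: "P k \<gamma>"
    obtain i m where k: "k = prod_encode (i, m)" by (metis prod_decode_inverse surj_pair)
    show "\<exists>j. P (Suc k) (\<gamma>(k := j))"
    proof (rule ccontr)
      assume "\<not> ?thesis"
      then have sep: "borel_separable (\<lambda>n. f n ` N (Suc k) (\<gamma>(k := j)) n)" for j by (simp add: P_def)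
      have other: "N (Suc k) (\<gamma>(k := j)) n = N k \<gamma> n" if "n \<noteq> i" for n j
        using that by (auto simp: N_def k nth_row_def less_Suc_eq)
      have "borel_separable ((\<lambda>n. f n ` N k \<gamma> n)(i := f i ` N (Suc k) (\<gamma>(k := j)) i))" for j
        using sep[of j] by (rule back_subst[of borel_separable]) (auto simp: other fun_eq_iff)
      moreover have "f i ` N k \<gamma> i \<subseteq> (\<Union>j. f i ` N (Suc k) (\<gamma>(k := j)) i)"
      proof (intro subsetI)
        fix x assume "x \<in> f i ` N k \<gamma> i"
        then obtain \<beta> where \<beta>: "\<beta> \<in> N k \<gamma> i" "x = f i \<beta>" by auto
        then have "\<beta> \<in> N (Suc k) (\<gamma>(k := \<beta> m)) i"
          by (auto simp: N_def k nth_row_def less_Suc_eq)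
        then show "x \<in> (\<Union>j. f i ` N (Suc k) (\<gamma>(k := j)) i)" using \<beta> by blast
      qed
      ultimately have "borel_separable (\<lambda>n. f n ` N k \<gamma> n)"
        by (rule borel_separable_split)
      then show False using P by (simp add: P_def)
    qed
  next
    fix k \<gamma> \<gamma>' assume "P k \<gamma>" and eq: "\<And>i. i < k \<Longrightarrow> \<gamma> i = \<gamma>' i"
    moreover have "N k \<gamma> = N k \<gamma>'" using eq by (auto simp: N_def nth_row_def fun_eq_iff)
    ultimately show "P k \<gamma>'" by (simp add: P_def)
  qed
  then obtain \<gamma> where \<gamma>: "\<And>k. P k \<gamma>" by blast
  have cyl: "\<exists>k. N k \<gamma> n \<subseteq> W" if W: "open W" "nth_row n \<gamma> \<in> W" for n W
  proof -
    obtain M where M: "\<And>\<beta>. (\<forall>i<M. \<beta> i = nth_row n \<gamma> i) \<Longrightarrow> \<beta> \<in> W" using cylinder_in_open[OF W] by blast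
    obtain k where k: "\<And>m. m < M \<Longrightarrow> prod_encode (n, m) < k"
      using finite_nat_set_iff_bounded[of "(\<lambda>m. prod_encode (n, m)) ` {..<M}"] by auto
    have "N k \<gamma> n \<subseteq> W" using M k by (auto simp: N_def)
    then show ?thesis by blast
  qed
  have nonempty: "N k \<gamma> n \<noteq> {}" for k n
  proof
    assume "N k \<gamma> n = {}"
    then have "borel_separable (\<lambda>n. f n ` N k \<gamma> n)"
      unfolding borel_separable_def by (intro exI[of _ "\<lambda>i. if i = n then {} else UNIV"]) auto
    then show False using \<gamma>[of k] by (simp add: P_def)
  qed
  have inC: "nth_row n \<gamma> \<in> C n" for n
  proof (rule ccontr)
    assume "nth_row n \<gamma> \<notin> C n"
    then obtain k where "N k \<gamma> n \<subseteq> - C n" using cyl[of "- C n" n] Cf(1) by auto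
    then show False using nonempty[of k n] by (auto simp: N_def)
  qed
  have "f n (nth_row n \<gamma>) = f 0 (nth_row 0 \<gamma>)" for n
  proof (rule ccontr)
    assume ne: "f n (nth_row n \<gamma>) \<noteq> f 0 (nth_row 0 \<gamma>)"
    have "n \<noteq> 0"
    proof
      assume "n = 0"
      then show False using ne by simp
    qed
    obtain U V where UV: "open U" "open V" "f n (nth_row n \<gamma>) \<in> U" "f 0 (nth_row 0 \<gamma>) \<in> V" "U \<inter> V = {}"
      using hausdorff[OF ne] by (elim exE conjE)
    have ex: "\<exists>k. f i ` N k \<gamma> i \<subseteq> Z" if Z: "open Z" "f i (nth_row i \<gamma>) \<in> Z" for i Z
    proof -
      obtain W where W: "open W" "W \<inter> C i = f i -` Z \<inter> C i"
        using continuous_on_open_invariant[THEN iffD1, OF Cf(2)[of i], rule_format, OF Z(1)] by (elim exE conjE)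
      then have "nth_row i \<gamma> \<in> W" using inC[of i] Z(2) by auto
      then obtain k where "N k \<gamma> i \<subseteq> W" using cyl[OF W(1), of i] by auto
      then have "f i ` N k \<gamma> i \<subseteq> Z" using W by (auto simp: N_def)
      then show ?thesis ..
    qed
    obtain k where k: "f n ` N k \<gamma> n \<subseteq> U" using ex[OF UV(1,3)] by (elim exE)
    obtain l where l: "f 0 ` N l \<gamma> 0 \<subseteq> V" using ex[OF UV(2,4)] by (elim exE)
    have mono: "N (max k l) \<gamma> i \<subseteq> N k \<gamma> i" "N (max k l) \<gamma> i \<subseteq> N l \<gamma> i" for i by (auto simp: N_def)
    have "borel_separable (\<lambda>n. f n ` N (max k l) \<gamma> n)"
      unfolding borel_separable_def
    proof (intro exI[of _ "\<lambda>i. if i = n then U else if i = 0 then V else UNIV"] conjI allI)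
      show "(\<Inter>i. if i = n then U else if i = 0 then V else UNIV) = {}"
      proof (rule ccontr)
        assume "(\<Inter>i. if i = n then U else if i = 0 then V else UNIV) \<noteq> {}"
        then obtain x where "\<And>i. x \<in> (if i = n then U else if i = 0 then V else UNIV)" by blast
        from this[of n] this[of 0] show False using UV \<open>n \<noteq> 0\<close> by auto
      qed
    next
      have "f n ` N (max k l) \<gamma> n \<subseteq> U" "f 0 ` N (max k l) \<gamma> 0 \<subseteq> V"
        using k l mono by (meson image_mono order_trans)+
      then show "f i ` N (max k l) \<gamma> i \<subseteq> (if i = n then U else if i = 0 then V else UNIV)" for i
        by simp
    qed (use UV in auto)
    then show False using \<gamma>[of "max k l"] by (simp add: P_def)
  qed
  then have "f 0 (nth_row 0 \<gamma>) \<in> A n" for n using Cf(3)[of n] inC[of n] by (metis imageI)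
  then show False using disj by blast
qed

lemma lusin_separation:
  fixes S T :: "'a::t2_space set"
  assumes "analytic_set S" "analytic_set T" "S \<inter> T = {}"
  shows "\<exists>B\<in>sets borel. S \<subseteq> B \<and> B \<inter> T = {}"
proof -
  have "borel_separable (\<lambda>n::nat. if n = 0 then S else T)"
    using assms by (intro novikov_separation) (auto split: if_splits)
  then obtain B where B: "\<And>n::nat. B n \<in> sets borel" "\<And>n::nat. (if n = 0 then S else T) \<subseteq> B n" "(\<Inter>n. B n) = {}"
    unfolding borel_separable_def by blast
  have "B 0 \<inter> T = {}"
  proof (rule ccontr)
    assume "B 0 \<inter> T \<noteq> {}"
    then obtain x where "x \<in> B 0" "x \<in> T" by blast
    then have "x \<in> B n" for n using B(2)[of n] by (cases "n = 0") auto
    then show False using B(3) by blast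
  qed
  then show ?thesis using B(1)[of 0] B(2)[of 0] by auto
qed

section \<open>Borel sets with compact or open sections\<close>

text \<open>The Kunugui-Novikov theorem, for two Borel sets instead of a set and its complement. The set of
\<open>x\<close> for which \<open>V n\<close> misses the section of \<open>E\<close> is only coanalytic, but together with \<open>V n\<close>
these sets cover \<open>G\<close>. Novikov separation shrinks the rectangles to Borel subsets of \<open>G\<close> that still cover, and a
Borel set \<open>Y n\<close> then fits between the projection of such a subset and the coanalytic set.\<close>

lemma borel_rectangle_cover:
  fixes G E :: "('x::polish_space \<times> 'y::polish_space) set" and V :: "nat \<Rightarrow> 'y set"
  assumes "G \<in> sets borel" "E \<in> sets borel" and V: "\<And>n. V n \<in> sets borel"
    and cover: "\<And>x y. (x, y) \<in> G \<Longrightarrow> \<exists>n. y \<in> V n \<and> (\<forall>y'\<in>V n. (x, y') \<notin> E)"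
  shows "\<exists>Y. (\<forall>n. Y n \<in> sets borel) \<and> G \<subseteq> (\<Union>n. Y n \<times> V n) \<and> (\<forall>n. (Y n \<times> V n) \<inter> E = {})"
proof -
  have an: "analytic_set (fst ` S)" if "analytic_set S" for S :: "('x \<times> 'y) set"
    using that by (intro analytic_set_continuous_image continuous_intros)
  define P where "P n = fst ` (E \<inter> UNIV \<times> V n)" for n
  have anP: "analytic_set (P n)" for n
    unfolding P_def using assms(2) V
    by (intro an analytic_set_Int analytic_set_Times analytic_set_borel) auto
  define Q where "Q n = G \<inter> (P n \<times> UNIV \<union> UNIV \<times> - V n)" for n
  have "analytic_set (Q n)" for n
    unfolding Q_def using assms(1) V
    by (intro analytic_set_Int analytic_set_Un analytic_set_Times analytic_set_borel anP) auto
  moreover have "(\<Inter>n. Q n) = {}"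
  proof (rule ccontr)
    assume "(\<Inter>n. Q n) \<noteq> {}"
    then obtain x y where xy: "\<And>n. (x, y) \<in> Q n" by auto
    then have "(x, y) \<in> G" by (auto simp: Q_def)
    from cover[OF this] obtain n where n: "y \<in> V n" "\<forall>y'\<in>V n. (x, y') \<notin> E" by blast
    then have "x \<notin> P n" by (auto simp: P_def)
    then show False using xy[of n] n(1) by (auto simp: Q_def)
  qed
  ultimately have "borel_separable Q" by (rule novikov_separation)
  then obtain B where B: "\<And>n. B n \<in> sets borel" "\<And>n. Q n \<subseteq> B n" "(\<Inter>n. B n) = {}"
    unfolding borel_separable_def by blast
  have sub: "G - B n \<subseteq> (- P n) \<times> V n" for n
  proof
    fix p assume p: "p \<in> G - B n"
    then have "p \<notin> Q n" using B(2)[of n] by blast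
    then show "p \<in> (- P n) \<times> V n" using p by (cases p) (auto simp: Q_def)
  qed
  have "\<exists>Y\<in>sets borel. fst ` (G - B n) \<subseteq> Y \<and> Y \<inter> P n = {}" for n
  proof (rule lusin_separation[OF _ anP])
    show "analytic_set (fst ` (G - B n))"
      using assms(1) B(1) by (intro an analytic_set_borel) auto
    show "fst ` (G - B n) \<inter> P n = {}" using sub[of n] by auto
  qed
  then obtain Y where Y: "\<And>n. Y n \<in> sets borel" "\<And>n. fst ` (G - B n) \<subseteq> Y n" "\<And>n. Y n \<inter> P n = {}"
    by metis
  have "G \<subseteq> (\<Union>n. Y n \<times> V n)"
  proof
    fix p assume "p \<in> G"
    moreover obtain n where "p \<notin> B n" using B(3) by blast
    ultimately have "p \<in> G - B n" by simp
    moreover from this have "fst p \<in> Y n" using Y(2)[of n] by blast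
    ultimately show "p \<in> (\<Union>n. Y n \<times> V n)" using sub[of n] by (cases p) auto
  qed
  moreover have "(Y n \<times> V n) \<inter> E = {}" for n
    using Y(3)[of n] by (force simp: P_def)
  ultimately show ?thesis using Y(1) by blast
qed

lemma countable_basis_sequence:
  obtains V :: "nat \<Rightarrow> 'a::second_countable_topology set"
  where "\<And>n. open (V n)" "\<And>S x. open S \<Longrightarrow> x \<in> S \<Longrightarrow> \<exists>n. x \<in> V n \<and> V n \<subseteq> S"
proof -
  obtain B :: "'a set set" where B: "countable B" "topological_basis B"
    using ex_countable_basis by blast
  have "B \<noteq> {}" using topological_basisE[OF B(2), of UNIV undefined] by auto
  show ?thesis
  proof (rule that[of "from_nat_into B"])
    show "open (from_nat_into B n)" for n
      using topological_basis_open[OF B(2)] from_nat_into[OF \<open>B \<noteq> {}\<close>] by blast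
    show "\<exists>n. x \<in> from_nat_into B n \<and> from_nat_into B n \<subseteq> S" if "open S" "x \<in> S" for S x
      using topological_basisE[OF B(2) that] from_nat_into_surj[OF B(1)] by metis
  qed
qed

lemma convergent_subseq_if_totally_bounded:
  fixes x :: "nat \<Rightarrow> 'a::complete_space"
  assumes tb: "\<And>e. e > 0 \<Longrightarrow> \<exists>F. finite F \<and> (\<forall>\<^sub>F n in sequentially. \<exists>z\<in>F. dist z (x n) \<le> e)"
  shows "\<exists>l r. strict_mono (r :: nat \<Rightarrow> nat) \<and> (x \<circ> r) \<longlonglongrightarrow> l"
proof -
  have "compact (closure (range x))"
    unfolding compact_eq_totally_bounded
  proof (intro conjI allI impI)
    show "uniform_space_class.complete (closure (range x))" by (simp add: complete_eq_closed)
    fix e :: real assume "e > 0"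
    then obtain F where F: "finite F" "\<forall>\<^sub>F n in sequentially. \<exists>z\<in>F. dist z (x n) \<le> e/2"
      using tb[of "e/2"] by auto
    then obtain N where N: "\<And>n. n \<ge> N \<Longrightarrow> \<exists>z\<in>F. dist z (x n) \<le> e/2"
      by (auto simp: eventually_sequentially)
    let ?F = "F \<union> x ` {..<N}"
    have "finite ?F" using F by simp
    have "range x \<subseteq> (\<Union>z\<in>?F. cball z (e/2))"
    proof (intro subsetI)
      fix y assume "y \<in> range x"
      then obtain n where y: "y = x n" by auto
      show "y \<in> (\<Union>z\<in>?F. cball z (e/2))"
      proof (cases "n < N")
        case True
        then show ?thesis using y \<open>e > 0\<close> by (intro UN_I[of y]) auto
      next
        case False
        then show ?thesis using N[of n] y by auto
      qed
    qed
    moreover have "closed (\<Union>z\<in>?F. cball z (e/2))" using \<open>finite ?F\<close> by (intro closed_UN) auto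
    ultimately have "closure (range x) \<subseteq> (\<Union>z\<in>?F. cball z (e/2))" by (rule closure_minimal)
    also have "\<dots> \<subseteq> (\<Union>z\<in>?F. ball z e)" using \<open>e > 0\<close> by (intro UN_mono) auto
    finally show "\<exists>k. finite k \<and> closure (range x) \<subseteq> (\<Union>x\<in>k. ball x e)" using \<open>finite ?F\<close> by blast
  qed
  then have sc: "seq_compact (closure (range x))" by (simp add: compact_eq_seq_compact_metric)
  have "\<forall>n. x n \<in> closure (range x)" using closure_subset[of "range x"] by auto
  from seq_compactE[OF sc this] show ?thesis by metis
qed

text \<open>Compactness enters twice. Each section is covered by finitely many balls of radius
\<open>1 / (n + 1)\<close>, and Novikov separation chooses such covers in a Borel way. Hence the section over
\<open>x\<close> is empty if and only if finitely many of these covers already force its points into finitely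
many of the open sets that miss the section. For if the section is empty, these open sets cover the whole
space; were the covers never enough, there would be a sequence of points in more and more of the covers
and outside more and more of the open sets, and the limit of a convergent subsequence would be in none of them.\<close>

theorem borel_projection_compact_sections:
  fixes E :: "('x::polish_space \<times> 'a::polish_space) set"
  assumes E: "E \<in> sets borel" and cpt: "\<And>x. compact {a. (x, a) \<in> E}"
  shows "fst ` E \<in> sets borel"
proof -
  obtain V :: "nat \<Rightarrow> 'a set" where V: "\<And>n. open (V n)"
    "\<And>S x. open S \<Longrightarrow> x \<in> S \<Longrightarrow> \<exists>n. x \<in> V n \<and> V n \<subseteq> S"
    using countable_basis_sequence by blast
  obtain d :: "nat \<Rightarrow> 'a" where d: "\<And>x e. e > 0 \<Longrightarrow> \<exists>n. dist (d n) x < e"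
    using dense_sequence_exists by blast
  have "\<exists>Y. (\<forall>n. Y n \<in> sets borel) \<and> - E \<subseteq> (\<Union>n. Y n \<times> V n) \<and> (\<forall>n. (Y n \<times> V n) \<inter> E = {})"
  proof (rule borel_rectangle_cover)
    fix x a assume "(x, a) \<in> - E"
    moreover have "open (- {a. (x, a) \<in> E})" using compact_imp_closed[OF cpt] by auto
    ultimately show "\<exists>n. a \<in> V n \<and> (\<forall>a'\<in>V n. (x, a') \<notin> E)"
      using V(2)[of "- {a. (x, a) \<in> E}" a] by blast
  qed (use E V in auto)
  then obtain Y where Y: "\<And>n. Y n \<in> sets borel" "- E \<subseteq> (\<Union>n. Y n \<times> V n)" "\<And>n. (Y n \<times> V n) \<inter> E = {}"
    by blast
  \<comment> \<open>by compactness each section of E lies in U n k for all large k\<close>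
  define U where "U n k = (\<Union>i\<le>k. cball (d i) (1 / Suc n))" for n k :: nat
  have "borel_separable (\<lambda>k. fst ` (E \<inter> UNIV \<times> - U n k))" for n
  proof (rule novikov_separation)
    fix k
    have "closed (U n k)" unfolding U_def by (intro closed_UN) auto
    then show "analytic_set (fst ` (E \<inter> UNIV \<times> - U n k))"
      using E by (intro analytic_set_continuous_image analytic_set_Int analytic_set_Times analytic_set_borel continuous_intros)
        auto
  next
    show "(\<Inter>k. fst ` (E \<inter> UNIV \<times> - U n k)) = {}"
    proof (rule ccontr)
      assume "(\<Inter>k. fst ` (E \<inter> UNIV \<times> - U n k)) \<noteq> {}"
      then obtain x where x: "\<And>k. x \<in> fst ` (E \<inter> UNIV \<times> - U n k)" by blast
      have "{a. (x, a) \<in> E} \<subseteq> (\<Union>i. ball (d i) (1 / Suc n))"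
        using d[of "1 / Suc n"] by auto
      then obtain I where I: "finite I" "{a. (x, a) \<in> E} \<subseteq> (\<Union>i\<in>I. ball (d i) (1 / Suc n))"
        using compactE_image[OF cpt, of UNIV "\<lambda>i. ball (d i) (1 / Suc n)" x] by auto
      obtain k where k: "\<forall>i\<in>I. i \<le> k" using I(1) finite_nat_set_iff_bounded_le by auto
      have "{a. (x, a) \<in> E} \<subseteq> (\<Union>i\<in>I. cball (d i) (1 / Suc n))"
        using I(2) ball_subset_cball by (rule order_trans[OF _ UN_mono[OF order_refl]])
      also have "\<dots> \<subseteq> U n k" unfolding U_def using k by (intro UN_mono) auto
      finally have "{a. (x, a) \<in> E} \<subseteq> U n k" .
      then show False using x[of k] by auto
    qed
  qed
  then have "\<exists>B. (\<forall>k. B k \<in> sets borel \<and> fst ` (E \<inter> UNIV \<times> - U n k) \<subseteq> B k) \<and> (\<Inter>k. B k) = {}" for n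
    unfolding borel_separable_def .
  then obtain B where B: "\<And>n k. B n k \<in> sets borel" "\<And>n k. fst ` (E \<inter> UNIV \<times> - U n k) \<subseteq> B n k"
    "\<And>n. (\<Inter>k. B n k) = {}"
    by metis
  have [measurable]: "B n k \<in> sets borel" "Y n \<in> sets borel" for n k using B(1) Y(1) .
  \<comment> \<open>n ranges over radii, ks ! n is the size of the cover used for radius n, ms lists the open sets\<close>
  have iff: "x \<notin> fst ` E \<longleftrightarrow>
      (\<exists>ks ms :: nat list. (\<forall>n<length ks. x \<notin> B n (ks ! n)) \<and> (\<forall>i<length ms. x \<in> Y (ms ! i)) \<and>
         (\<Inter>n<length ks. U n (ks ! n)) \<subseteq> (\<Union>i<length ms. V (ms ! i)))" (is "_ \<longleftrightarrow> ?R x") for x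
  proof
    assume "?R x"
    then obtain ks ms :: "nat list" where
      k: "\<And>n. n < length ks \<Longrightarrow> x \<notin> B n (ks ! n)" "\<And>i. i < length ms \<Longrightarrow> x \<in> Y (ms ! i)"
      "(\<Inter>n<length ks. U n (ks ! n)) \<subseteq> (\<Union>i<length ms. V (ms ! i))" by blast
    show "x \<notin> fst ` E"
    proof
      assume "x \<in> fst ` E"
      then obtain a where a: "(x, a) \<in> E" by auto
      have "a \<in> U n (ks ! n)" if "n < length ks" for n
      proof (rule ccontr)
        assume "a \<notin> U n (ks ! n)"
        then have "x \<in> fst ` (E \<inter> UNIV \<times> - U n (ks ! n))" using a by force
        then show False using k(1)[OF that] B(2)[of n "ks ! n"] by blast
      qed
      then obtain i where "i < length ms" "a \<in> V (ms ! i)" using k(3) by blast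
      then show False using k(2)[of i] Y(3)[of "ms ! i"] a by blast
    qed
  next
    assume x: "x \<notin> fst ` E"
    have "\<exists>k. x \<notin> B n k" for n using B(3)[of n] by blast
    then obtain k where k: "\<And>n. x \<notin> B n (k n)" by metis
    \<comment> \<open>over a point outside the projection the sets V m with x in Y m cover the whole space\<close>
    have cov: "\<exists>m. x \<in> Y m \<and> a \<in> V m" for a
      using Y(2) x by force
    have "\<exists>N. (\<Inter>n<N. U n (k n)) \<subseteq> (\<Union>m\<in>{m. m < N \<and> x \<in> Y m}. V m)"
    proof (rule ccontr)
      assume "\<not> ?thesis"
      then have "\<forall>N. \<exists>a. a \<in> (\<Inter>n<N. U n (k n)) \<and> a \<notin> (\<Union>m\<in>{m. m < N \<and> x \<in> Y m}. V m)" by blast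
      then obtain a where a: "\<And>N. a N \<in> (\<Inter>n<N. U n (k n))"
        "\<And>N. a N \<notin> (\<Union>m\<in>{m. m < N \<and> x \<in> Y m}. V m)" by metis
      have "\<exists>l r. strict_mono (r :: nat \<Rightarrow> nat) \<and> (a \<circ> r) \<longlonglongrightarrow> l"
      proof (rule convergent_subseq_if_totally_bounded)
        fix e :: real assume "e > 0"
        then obtain n :: nat where n: "1 / Suc n < e" using nat_approx_posE by blast
        have "\<forall>\<^sub>F N in sequentially. \<exists>z\<in>d ` {..k n}. dist z (a N) \<le> e"
          using eventually_gt_at_top[of n]
        proof eventually_elim
          case (elim N)
          then have "a N \<in> U n (k n)" using a(1) by blast
          then obtain i where "i \<le> k n" "dist (d i) (a N) \<le> 1 / Suc n" unfolding U_def by auto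
          then show ?case using n by (intro bexI[of _ "d i"]) auto
        qed
        then show "\<exists>F. finite F \<and> (\<forall>\<^sub>F n in sequentially. \<exists>z\<in>F. dist z (a n) \<le> e)"
          by (intro exI[of _ "d ` {..k n}"]) auto
      qed
      then obtain l and r :: "nat \<Rightarrow> nat" where lr: "strict_mono r" "(a \<circ> r) \<longlonglongrightarrow> l" by blast
      obtain m where m: "x \<in> Y m" "l \<in> V m" using cov by blast
      have "\<forall>\<^sub>F i in sequentially. (a \<circ> r) i \<in> V m"
        using topological_tendstoD[OF lr(2) V(1) m(2)] .
      moreover have "\<forall>\<^sub>F i in sequentially. i > m" by (rule eventually_gt_at_top)
      ultimately have "\<forall>\<^sub>F i in sequentially. False"
      proof eventually_elim
        case (elim i)
        then have "m < r i" using seq_suble[OF lr(1), of i] by simp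
        then show False using a(2)[of "r i"] m(1) elim(1) by auto
      qed
      then show False by simp
    qed
    then obtain N where N: "(\<Inter>n<N. U n (k n)) \<subseteq> (\<Union>m\<in>{m. m < N \<and> x \<in> Y m}. V m)" by blast
    obtain ms where ms: "set ms = {m. m < N \<and> x \<in> Y m}"
      using finite_list[of "{m. m < N \<and> x \<in> Y m}"] by auto
    show "?R x"
    proof (rule exI[of _ "map k [0..<N]"], rule exI[of _ ms], intro conjI allI impI)
      show "(\<Inter>n<length (map k [0..<N]). U n (map k [0..<N] ! n)) \<subseteq> (\<Union>i<length ms. V (ms ! i))"
      proof
        fix a assume "a \<in> (\<Inter>n<length (map k [0..<N]). U n (map k [0..<N] ! n))"
        then have "a \<in> (\<Inter>n<N. U n (k n))" by auto
        then obtain m where "m \<in> set ms" "a \<in> V m" using N ms by blast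
        then show "a \<in> (\<Union>i<length ms. V (ms ! i))" by (metis UN_I in_set_conv_nth lessThan_iff)
      qed
    next
      fix i assume "i < length ms"
      then have "ms ! i \<in> set ms" by simp
      then show "x \<in> Y (ms ! i)" using ms by simp
    qed (use k in auto)
  qed
  have "- (fst ` E) = {x \<in> space borel. ?R x}"
    by (intro set_eqI) (simp only: Compl_iff mem_Collect_eq space_borel UNIV_I iff simp_thms)
  moreover have "{x \<in> space borel. ?R x} \<in> sets borel" by measurable
  ultimately show ?thesis by (metis borel_comp double_complement)
qed

text \<open>The selector is the limit of centres of balls of radius $2^{-m}$: at each step the first centre is
taken for which all balls chosen so far have a common point in the section. Whether a finite list
of balls has such a point is a Borel condition by the projection theorem.\<close>

theorem borel_selector_compact_sections:
  fixes E :: "('x::polish_space \<times> 'a::polish_space) set"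
  assumes E: "E \<in> sets borel" and cpt: "\<And>x. compact {a. (x, a) \<in> E}"
  shows "\<exists>\<phi>\<in>borel_measurable borel. \<forall>x\<in>fst ` E. (x, \<phi> x) \<in> E"
proof -
  obtain d :: "nat \<Rightarrow> 'a" where d: "\<And>x e. e > 0 \<Longrightarrow> \<exists>n. dist (d n) x < e"
    using dense_sequence_exists by blast
  define hits where "hits ks x \<longleftrightarrow> (\<exists>a. (x, a) \<in> E \<and> (\<forall>m<length ks. dist a (d (ks ! m)) \<le> (1/2)^m))"
    for ks x
  have hits_borel: "{x. hits ks x} \<in> sets borel" for ks
  proof -
    let ?C = "{a. \<forall>m<length ks. dist a (d (ks ! m)) \<le> (1/2)^m}"
    have "closed ?C"
      by (intro closed_Collect_all closed_Collect_imp open_Collect_const closed_Collect_le continuous_intros)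
    have "fst ` (E \<inter> UNIV \<times> ?C) \<in> sets borel"
    proof (rule borel_projection_compact_sections)
      show "E \<inter> UNIV \<times> ?C \<in> sets borel"
        using E borel_closed[OF closed_Times[OF closed_UNIV \<open>closed ?C\<close>]] by (rule sets.Int)
      have "compact ({a. (x, a) \<in> E} \<inter> ?C)" for x
        using cpt \<open>closed ?C\<close> by (rule compact_Int_closed)
      then show "compact {a. (x, a) \<in> E \<inter> UNIV \<times> ?C}" for x
        by (rule back_subst[of compact]) auto
    qed
    also have "fst ` (E \<inter> UNIV \<times> ?C) = {x. hits ks x}" by (force simp: hits_def)
    finally show ?thesis .
  qed
  have [measurable]: "Measurable.pred borel (hits ks)" for ks
    using hits_borel[of ks] by (simp add: pred_def)
  define idx where "idx = rec_nat (\<lambda>x. []) (\<lambda>n g x. g x @ [LEAST i. hits (g x @ [i]) x])"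
  have idx_0: "idx 0 x = []" and idx_Suc: "idx (Suc n) x = idx n x @ [LEAST i. hits (idx n x @ [i]) x]" for n x
    by (simp_all add: idx_def)
  have idx_meas [measurable]: "idx n \<in> borel \<rightarrow>\<^sub>M count_space UNIV" for n
  proof (induction n)
    case 0
    have "idx 0 = (\<lambda>x. [])" by (simp add: idx_def)
    then show ?case by simp
  next
    case (Suc n)
    have "(\<lambda>x. (\<lambda>ks x. ks @ [LEAST i. hits (ks @ [i]) x]) (idx n x) x) \<in> borel \<rightarrow>\<^sub>M count_space UNIV"
      by (rule measurable_compose_countable[OF _ Suc]) measurable
    moreover have "idx (Suc n) = (\<lambda>x. (\<lambda>ks x. ks @ [LEAST i. hits (ks @ [i]) x]) (idx n x) x)"
      by (simp add: idx_Suc fun_eq_iff)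
    ultimately show ?case by simp
  qed
  have len: "length (idx n x) = n" for n x by (induction n) (simp_all add: idx_0 idx_Suc)
  have nth: "idx n x ! m = last (idx (Suc m) x)" if "m < n" for n m x
    using that
  proof (induction n)
    case (Suc n)
    then show ?case by (cases "m = n") (auto simp: idx_Suc nth_append len)
  qed simp
  have hits_idx: "hits (idx n x) x" if "x \<in> fst ` E" for n x
  proof (induction n)
    case 0 then show ?case using that by (auto simp: hits_def idx_0)
  next
    case (Suc n)
    then obtain a where a: "(x, a) \<in> E" "\<And>m. m < n \<Longrightarrow> dist a (d (idx n x ! m)) \<le> (1/2)^m"
      by (auto simp: hits_def len)
    obtain i where "dist (d i) a < (1/2)^n" using d[of "(1/2)^n" a] by auto
    then have "hits (idx n x @ [i]) x"
      using a unfolding hits_def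
      by (intro exI[of _ a]) (auto simp: nth_append len less_Suc_eq dist_commute less_imp_le)
    then show ?case unfolding idx_Suc by (rule LeastI)
  qed
  have limit: "\<exists>a. (x, a) \<in> E \<and> (\<lambda>n. d (last (idx (Suc n) x))) \<longlonglongrightarrow> a" if x: "x \<in> fst ` E" for x
  proof -
    have "\<exists>a. (x, a) \<in> E \<and> (\<forall>m<n. dist a (d (last (idx (Suc m) x))) \<le> (1/2)^m)" for n
      using hits_idx[OF x, of n] by (auto simp: hits_def len nth)
    then obtain b where b: "\<And>n. (x, b n) \<in> E" "\<And>n m. m < n \<Longrightarrow> dist (b n) (d (last (idx (Suc m) x))) \<le> (1/2)^m"
      by metis
    have "seq_compact {a. (x, a) \<in> E}" using cpt by (simp add: compact_eq_seq_compact_metric)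
    moreover have "\<forall>n. b n \<in> {a. (x, a) \<in> E}" using b(1) by simp
    ultimately obtain a and r :: "nat \<Rightarrow> nat" where
      "a \<in> {a. (x, a) \<in> E}" "strict_mono r" "(b \<circ> r) \<longlonglongrightarrow> a"
      by (rule seq_compactE)
    then have ar: "(x, a) \<in> E" "strict_mono r" "(b \<circ> r) \<longlonglongrightarrow> a" by auto
    have "dist a (d (last (idx (Suc m) x))) \<le> (1/2)^m" for m
    proof (rule tendsto_upperbound)
      show "(\<lambda>n. dist ((b \<circ> r) n) (d (last (idx (Suc m) x)))) \<longlonglongrightarrow> dist a (d (last (idx (Suc m) x)))"
        by (intro tendsto_intros ar)
      show "\<forall>\<^sub>F n in sequentially. dist ((b \<circ> r) n) (d (last (idx (Suc m) x))) \<le> (1/2)^m"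
        using eventually_gt_at_top[of m]
      proof eventually_elim
        case (elim n)
        then have "m < r n" using seq_suble[OF ar(2), of n] by simp
        then show ?case using b(2) by simp
      qed
    qed simp
    then have "(\<lambda>n. d (last (idx (Suc n) x))) \<longlonglongrightarrow> a"
      by (intro metric_tendsto_imp_tendsto[OF LIMSEQ_power_zero[of "1/2::real"]])
        (auto simp: dist_commute simp del: power_one_over)
    then show ?thesis using ar by blast
  qed
  define \<phi> where "\<phi> x = (if x \<in> fst ` E then lim (\<lambda>n. d (last (idx (Suc n) x))) else d 0)" for x
  have lim_\<phi>: "(\<lambda>n. if x \<in> fst ` E then d (last (idx (Suc n) x)) else d 0) \<longlonglongrightarrow> \<phi> x" for x
  proof (cases "x \<in> fst ` E")
    case True
    then obtain a where "(\<lambda>n. d (last (idx (Suc n) x))) \<longlonglongrightarrow> a" using limit by metis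
    then show ?thesis using True limI by (auto simp: \<phi>_def)
  qed (simp add: \<phi>_def)
  have [measurable]: "fst ` E \<in> sets borel" by (rule borel_projection_compact_sections[OF E cpt])
  have "(\<lambda>x. if x \<in> fst ` E then d (last (idx (Suc n) x)) else d 0) \<in> borel_measurable borel" for n
  proof (intro measurable_If)
    have "(\<lambda>ks. d (last ks)) \<in> count_space UNIV \<rightarrow>\<^sub>M borel" by simp
    from measurable_compose[OF idx_meas this]
    show "(\<lambda>x. d (last (idx (Suc n) x))) \<in> borel_measurable borel" .
  qed auto
  then have "\<phi> \<in> borel_measurable borel"
    by (rule borel_measurable_LIMSEQ_metric[where f="\<lambda>n x. if x \<in> fst ` E then d (last (idx (Suc n) x)) else d 0"])
      (use lim_\<phi> in auto)
  moreover have "(x, \<phi> x) \<in> E" if x: "x \<in> fst ` E" for x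
  proof -
    obtain a where a: "(x, a) \<in> E" "(\<lambda>n. d (last (idx (Suc n) x))) \<longlonglongrightarrow> a"
      using limit[OF x] by metis
    then show ?thesis using limI[OF a(2)] x by (simp add: \<phi>_def)
  qed
  ultimately show ?thesis by blast
qed

section \<open>Lower semi-continuity of integrals under semi-uniform Feller kernels\<close>

definition seq_lsc_on :: "'s::topological_space set \<Rightarrow> ('s \<Rightarrow> ennreal) \<Rightarrow> bool" where
  "seq_lsc_on S F \<longleftrightarrow>
    (\<forall>s l. (\<forall>n. s n \<in> S) \<longrightarrow> l \<in> S \<longrightarrow> s \<longlonglongrightarrow> l \<longrightarrow> F l \<le> liminf (\<lambda>n. F (s n)))"

lemma seq_lsc_onI:
  assumes "\<And>s l. (\<And>n. s n \<in> S) \<Longrightarrow> l \<in> S \<Longrightarrow> s \<longlonglongrightarrow> l \<Longrightarrow> F l \<le> liminf (\<lambda>n. F (s n))"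
  shows "seq_lsc_on S F"
  using assms by (auto simp: seq_lsc_on_def)

lemma seq_lsc_onD:
  assumes "seq_lsc_on S F" "\<And>n. s n \<in> S" "l \<in> S" "s \<longlonglongrightarrow> l"
  shows "F l \<le> liminf (\<lambda>n. F (s n))"
  using assms by (auto simp: seq_lsc_on_def)

text \<open>Fatou's lemma. With suitable measures on finite sets it also covers sums and multiples.\<close>

lemma seq_lsc_on_nn_integral:
  assumes lsc: "\<And>i. i \<in> space M \<Longrightarrow> seq_lsc_on S (F i)"
    and meas: "\<And>s. s \<in> S \<Longrightarrow> (\<lambda>i. F i s) \<in> borel_measurable M"
  shows "seq_lsc_on S (\<lambda>s. \<integral>\<^sup>+i. F i s \<partial>M)"
proof (rule seq_lsc_onI)
  fix s l assume s: "\<And>n. s n \<in> S" "l \<in> S" "s \<longlonglongrightarrow> l"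
  have "(\<integral>\<^sup>+i. F i l \<partial>M) \<le> (\<integral>\<^sup>+i. liminf (\<lambda>n. F i (s n)) \<partial>M)"
    by (intro nn_integral_mono seq_lsc_onD[OF lsc] s)
  also have "\<dots> \<le> liminf (\<lambda>n. \<integral>\<^sup>+i. F i (s n) \<partial>M)"
    using meas s by (intro nn_integral_liminf) auto
  finally show "(\<integral>\<^sup>+i. F i l \<partial>M) \<le> liminf (\<lambda>n. \<integral>\<^sup>+i. F i (s n) \<partial>M)" .
qed

lemma seq_lsc_on_add:
  assumes "seq_lsc_on S F" "seq_lsc_on S G"
  shows "seq_lsc_on S (\<lambda>s. F s + G s)"
proof -
  have "seq_lsc_on S (\<lambda>s. \<integral>\<^sup>+i. (if i then F s else G s) \<partial>count_space UNIV)"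
  proof (rule seq_lsc_on_nn_integral)
    show "seq_lsc_on S (\<lambda>s. if i then F s else G s)" for i using assms by (cases i) auto
  qed auto
  then show ?thesis by (simp add: nn_integral_count_space_finite UNIV_bool add.commute)
qed

lemma seq_lsc_on_cmult:
  assumes "seq_lsc_on S F"
  shows "seq_lsc_on S (\<lambda>s. c * F s)"
proof -
  have "seq_lsc_on S (\<lambda>s. \<integral>\<^sup>+i. F s \<partial>scale_measure c (count_space {()}))"
    by (intro seq_lsc_on_nn_integral) (use assms in auto)
  moreover have "(\<integral>\<^sup>+i. F s \<partial>scale_measure c (count_space {()})) = c * F s" for s
    by (subst nn_integral_scale_measure) auto
  ultimately show ?thesis by (simp only:)
qed

lemma seq_lsc_on_SUP:
  assumes "\<And>i. i \<in> I \<Longrightarrow> seq_lsc_on S (F i)"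
  shows "seq_lsc_on S (\<lambda>s. SUP i\<in>I. F i s)"
proof (rule seq_lsc_onI, rule SUP_least)
  fix s l i assume s: "\<And>n. s n \<in> S" "l \<in> S" "s \<longlonglongrightarrow> l" and "i \<in> I"
  then have "F i l \<le> liminf (\<lambda>n. F i (s n))" using assms by (intro seq_lsc_onD) auto
  also have "\<dots> \<le> liminf (\<lambda>n. SUP i\<in>I. F i (s n))"
    using \<open>i \<in> I\<close> by (intro Liminf_mono always_eventually allI SUP_upper)
  finally show "F i l \<le> liminf (\<lambda>n. SUP i\<in>I. F i (s n))" .
qed

lemma seq_lsc_on_cong: "(\<And>s. s \<in> S \<Longrightarrow> F s = G s) \<Longrightarrow> seq_lsc_on S G \<Longrightarrow> seq_lsc_on S F"
  by (auto simp: seq_lsc_on_def)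

lemma layer_cake: "(\<integral>\<^sup>+t. indicator {t. 0 \<le> t \<and> ennreal t < v} t \<partial>lborel) = v"
proof (cases v)
  case (real r)
  then have "{t. 0 \<le> t \<and> ennreal t < v} = {0..<r}" by (auto simp: ennreal_less_iff)
  then show ?thesis using real by simp
next
  case top
  have "{t. 0 \<le> t \<and> ennreal t < v} = {0::real..}" using top by (auto simp: less_top[symmetric])
  moreover have "emeasure lborel {0::real..} = \<infinity>"
  proof -
    have "ennreal n \<le> emeasure lborel {0::real..}" if "n \<ge> 0" for n :: real
      using that emeasure_mono[of "{0..n}" "{0::real..}" lborel] by auto
    from this[of "enn2real (emeasure lborel {0::real..}) + 1"] show ?thesis
      by (cases "emeasure lborel {0::real..}") auto
  qed
  ultimately show ?thesis using top by simp
qed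

lemma nn_integral_layer_cake:
  assumes "sigma_finite_measure M" and [measurable]: "u \<in> borel_measurable M"
  shows "(\<integral>\<^sup>+p. u p \<partial>M) = (\<integral>\<^sup>+t. indicator {0..} t * emeasure M {p\<in>space M. ennreal t < u p} \<partial>lborel)"
proof -
  interpret pair_sigma_finite M lborel
    using assms(1) sigma_finite_lborel by (simp add: pair_sigma_finite_def)
  define g where "g p t = (indicator {t. 0 \<le> t \<and> ennreal t < u p} t :: ennreal)" for p and t :: real
  have "Measurable.pred (M \<Otimes>\<^sub>M lborel) (\<lambda>(p, t). 0 \<le> t \<and> ennreal t < u p)" by measurable
  then have "(\<lambda>x. indicator {x\<in>space (M \<Otimes>\<^sub>M lborel). (\<lambda>(p, t). 0 \<le> t \<and> ennreal t < u p) x} x :: ennreal)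
      \<in> borel_measurable (M \<Otimes>\<^sub>M lborel)"
    by (intro borel_measurable_indicator) (simp add: pred_def)
  then have meas: "case_prod g \<in> borel_measurable (M \<Otimes>\<^sub>M lborel)"
    by (rule measurable_cong[THEN iffD1, rotated]) (auto simp: g_def indicator_def)
  have "(\<integral>\<^sup>+p. u p \<partial>M) = (\<integral>\<^sup>+p. (\<integral>\<^sup>+t. g p t \<partial>lborel) \<partial>M)"
    unfolding g_def layer_cake ..
  also have "\<dots> = (\<integral>\<^sup>+t. (\<integral>\<^sup>+p. g p t \<partial>M) \<partial>lborel)"
    by (rule Fubini'[OF meas, symmetric])
  also have "\<dots> = (\<integral>\<^sup>+t. indicator {0..} t * emeasure M {p\<in>space M. ennreal t < u p} \<partial>lborel)"
  proof (rule nn_integral_cong)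
    fix t :: real
    have "(\<integral>\<^sup>+p. g p t \<partial>M) = (\<integral>\<^sup>+p. indicator {0..} t * indicator {p\<in>space M. ennreal t < u p} p \<partial>M)"
      by (intro nn_integral_cong) (auto simp: g_def split: split_indicator)
    also have "\<dots> = indicator {0..} t * emeasure M {p\<in>space M. ennreal t < u p}"
      by (subst nn_integral_cmult) auto
    finally show "(\<integral>\<^sup>+p. g p t \<partial>M) = indicator {0..} t * emeasure M {p\<in>space M. ennreal t < u p}" .
  qed
  finally show ?thesis .
qed

lemma Times_in_borel:
  fixes A :: "'a::second_countable_topology set" and B :: "'b::second_countable_topology set"
  assumes "A \<in> sets borel" "B \<in> sets borel"
  shows "A \<times> B \<in> sets borel"
  using pair_measureI[OF assms] by (simp only: borel_prod)

lemma fst_measurable_borel_on: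
  "fst \<in> borel_on (S1 \<times> S2) \<rightarrow>\<^sub>M borel_on S1"
  by (intro measurable_restrict_space3 borel_measurable_continuous_onI continuous_intros) auto

lemma snd_measurable_borel_on:
  "snd \<in> borel_on (S1 \<times> S2) \<rightarrow>\<^sub>M borel_on S2"
  by (intro measurable_restrict_space3 borel_measurable_continuous_onI continuous_intros) auto

lemma slice_eq_distr:
  fixes S1 :: "'a::second_countable_topology set" and S2 :: "'b::second_countable_topology set"
  assumes "S1 \<in> sets borel" "S2 \<in> sets borel" and sets: "sets \<mu> = sets (borel_on (S1 \<times> S2))"
    and B: "B \<in> sets (borel_on S2)"
  shows "slice S1 \<mu> B = distr (restrict_space \<mu> (S1 \<times> B)) (borel_on S1) fst"
proof -
  have sp: "space \<mu> = S1 \<times> S2" using sets_eq_imp_space_eq[OF sets] by (simp add: space_restrict_space)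
  have BS: "B \<subseteq> S2" "B \<in> sets borel" using B assms(2) by (auto simp: sets_restrict_space)
  have inS: "A \<times> B \<in> sets \<mu>" if "A \<in> sets (borel_on S1)" for A
  proof -
    have "A \<subseteq> S1" "A \<in> sets borel" using that assms(1) by (auto simp: sets_restrict_space)
    then show ?thesis using BS assms(1,2) unfolding sets
      by (subst sets_restrict_space_iff) (auto intro!: Times_in_borel)
  qed
  show ?thesis
    unfolding slice_def distr_def
  proof (rule trans[OF measure_of_eq arg_cong[where f="\<lambda>S. measure_of S _ _"]])
    fix A assume "A \<in> sigma_sets S1 (sets (borel_on S1))"
    moreover have "S1 = space (borel_on S1)" by (simp add: space_restrict_space)
    ultimately have A: "A \<in> sets (borel_on S1)" by (metis sets.sigma_sets_eq)
    have "A \<subseteq> S1" using sets.sets_into_space[OF A] by (simp add: space_restrict_space)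
    then have eq: "fst -` A \<inter> space (restrict_space \<mu> (S1 \<times> B)) = A \<times> B"
      using BS by (auto simp: space_restrict_space sp)
    have "S1 \<in> sets (borel_on S1)" using assms(1) by (simp add: sets_restrict_space_iff)
    then have "S1 \<times> B \<in> sets \<mu>" by (rule inS)
    then show "emeasure \<mu> (A \<times> B) =
        emeasure (restrict_space \<mu> (S1 \<times> B)) (fst -` A \<inter> space (restrict_space \<mu> (S1 \<times> B)))"
      unfolding eq using \<open>A \<subseteq> S1\<close> BS
      by (subst emeasure_restrict_space) (auto simp: sp Times_Int_Times Int_absorb2)
  next
    show "sets (borel_on S1) \<subseteq> Pow S1" using sets.space_closed[of "borel_on S1"] by (simp add: space_restrict_space)
    show "S1 = space (borel_on S1)" by (simp add: space_restrict_space)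
  qed
qed

lemma integral_slice:
  fixes S1 :: "'a::second_countable_topology set" and S2 :: "'b::second_countable_topology set"
  assumes S: "S1 \<in> sets borel" "S2 \<in> sets borel"
    and \<mu>: "\<mu> \<in> space (prob_algebra (borel_on (S1 \<times> S2)))"
    and B: "B \<in> sets (borel_on S2)"
    and f: "f \<in> borel_measurable (borel_on S1)" "\<And>w. w \<in> S1 \<Longrightarrow> 0 \<le> f w" "\<And>w. w \<in> S1 \<Longrightarrow> f w \<le> (1::real)"
  shows "(\<integral>\<^sup>+p. ennreal (f (fst p)) * indicator B (snd p) \<partial>\<mu>) = ennreal (\<integral>z. f z \<partial>slice S1 \<mu> B)"
    and "0 \<le> (\<integral>z. f z \<partial>slice S1 \<mu> B)" "(\<integral>z. f z \<partial>slice S1 \<mu> B) \<le> 1"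
proof -
  have sets: "sets \<mu> = sets (borel_on (S1 \<times> S2))" and "prob_space \<mu>"
    using \<mu> by (auto simp: space_prob_algebra)
  interpret prob_space \<mu> by fact
  have sp: "space \<mu> = S1 \<times> S2" using sets_eq_imp_space_eq[OF sets] by (simp add: space_restrict_space)
  have fst: "fst \<in> \<mu> \<rightarrow>\<^sub>M borel_on S1" and snd: "snd \<in> \<mu> \<rightarrow>\<^sub>M borel_on S2"
    using fst_measurable_borel_on snd_measurable_borel_on by (simp_all add: measurable_cong_sets[OF sets refl])
  have BS: "B \<subseteq> S2" using sets.sets_into_space[OF B] by (simp add: space_restrict_space)
  have "snd -` B \<inter> space \<mu> = S1 \<times> B" using BS by (auto simp: sp)
  then have SB: "S1 \<times> B \<in> sets \<mu>" using measurable_sets[OF snd B] by simp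
  define g where "g p = indicator (S1 \<times> B) p * f (fst p)" for p
  have fm: "(\<lambda>p. f (fst p)) \<in> borel_measurable \<mu>" using measurable_compose[OF fst f(1)] .
  have gm: "g \<in> borel_measurable \<mu>" unfolding g_def using SB fm by measurable
  have g01: "0 \<le> g p" "g p \<le> 1" if "p \<in> space \<mu>" for p
    using that f(2,3)[of "fst p"] by (auto simp: g_def sp split: split_indicator)
  have gi: "integrable \<mu> g"
    by (rule integrable_const_bound[of _ 1]) (use g01 gm in \<open>auto intro!: AE_I2\<close>)
  have eq: "(\<integral>z. f z \<partial>slice S1 \<mu> B) = (\<integral>p. g p \<partial>\<mu>)"
  proof -
    have "fst \<in> restrict_space \<mu> (S1 \<times> B) \<rightarrow>\<^sub>M borel_on S1"
      by (rule measurable_restrict_space1[OF fst])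
    then have "(\<integral>z. f z \<partial>slice S1 \<mu> B) = (\<integral>p. f (fst p) \<partial>restrict_space \<mu> (S1 \<times> B))"
      unfolding slice_eq_distr[OF S sets B] by (intro integral_distr f)
    also have "\<dots> = (\<integral>p. g p \<partial>\<mu>)"
      using SB by (subst integral_restrict_space) (auto simp: g_def[abs_def])
    finally show ?thesis .
  qed
  have "(\<integral>\<^sup>+p. ennreal (f (fst p)) * indicator B (snd p) \<partial>\<mu>) = (\<integral>\<^sup>+p. ennreal (g p) \<partial>\<mu>)"
    by (intro nn_integral_cong) (auto simp: g_def sp split: split_indicator)
  also have "\<dots> = ennreal (\<integral>p. g p \<partial>\<mu>)"
    by (intro nn_integral_eq_integral gi) (use g01 in \<open>auto intro!: AE_I2\<close>)
  finally show "(\<integral>\<^sup>+p. ennreal (f (fst p)) * indicator B (snd p) \<partial>\<mu>) = ennreal (\<integral>z. f z \<partial>slice S1 \<mu> B)"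
    by (simp add: eq)
  show "0 \<le> (\<integral>z. f z \<partial>slice S1 \<mu> B)" unfolding eq by (intro integral_nonneg_AE AE_I2 g01)
  show "(\<integral>z. f z \<partial>slice S1 \<mu> B) \<le> 1" unfolding eq by (intro integral_le_const gi AE_I2 g01)
qed

locale semi_uniform_feller_kernel =
  fixes S1 :: "'s1::polish_space set" and S2 :: "'s2::polish_space set"
    and S3 :: "'s3::topological_space set" and \<Psi> :: "'s3 \<Rightarrow> ('s1 \<times> 's2) measure"
  assumes S: "S1 \<in> sets borel" "S2 \<in> sets borel"
    and \<Psi>: "\<And>s. s \<in> S3 \<Longrightarrow> \<Psi> s \<in> space (prob_algebra (borel_on (S1 \<times> S2)))"
    and suf: "semi_uniform_feller S1 S2 S3 \<Psi>"
begin

lemma sets_kernel: "s \<in> S3 \<Longrightarrow> sets (\<Psi> s) = sets (borel_on (S1 \<times> S2))"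
  and prob_kernel: "s \<in> S3 \<Longrightarrow> prob_space (\<Psi> s)"
  using \<Psi> by (auto simp: space_prob_algebra)

lemma space_kernel: "s \<in> S3 \<Longrightarrow> space (\<Psi> s) = S1 \<times> S2"
  using sets_eq_imp_space_eq[OF sets_kernel] by (simp add: space_restrict_space)

lemma Times_sets: "S1 \<times> S2 \<in> sets borel"
  using S by (rule Times_in_borel)

lemma sets_kernelI: "s \<in> S3 \<Longrightarrow> G \<in> sets borel \<Longrightarrow> G \<inter> S1 \<times> S2 \<in> sets (\<Psi> s)"
  using Times_sets by (simp add: sets_kernel sets_restrict_space_iff)

lemma seq_lsc_on_rectangle_function:
  assumes f: "continuous_on S1 f" "\<And>w. w \<in> S1 \<Longrightarrow> 0 \<le> f w" "\<And>w. w \<in> S1 \<Longrightarrow> f w \<le> 1"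
    and B: "B \<in> sets (borel_on S2)"
  shows "seq_lsc_on S3 (\<lambda>s. \<integral>\<^sup>+p. ennreal (f (fst p)) * indicator B (snd p) \<partial>\<Psi> s)"
proof (rule seq_lsc_onI)
  fix s l assume s: "\<And>n. s n \<in> S3" "l \<in> S3" "s \<longlonglongrightarrow> l"
  have fm: "f \<in> borel_measurable (borel_on S1)"
    using f(1) by (rule borel_measurable_continuous_on_restrict)
  let ?I = "\<lambda>s B. \<integral>z. f z \<partial>slice S1 (\<Psi> s) B"
  have bnd: "0 \<le> ?I s B" "?I s B \<le> 1" if "s \<in> S3" "B \<in> sets (borel_on S2)" for s B
    using integral_slice(2,3)[OF S \<Psi>[OF that(1)] that(2) fm f(2,3)] by auto
  have "bounded (f ` S1)" by (rule boundedI[of _ 1]) (use f in auto)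
  then have lim: "(\<lambda>n. SUP B \<in> sets (borel_on S2). \<bar>?I (s n) B - ?I l B\<bar>) \<longlonglongrightarrow> 0"
    using suf s f(1) unfolding semi_uniform_feller_def by blast
  have le: "\<bar>?I (s n) B - ?I l B\<bar> \<le> (SUP B \<in> sets (borel_on S2). \<bar>?I (s n) B - ?I l B\<bar>)" for n
  proof (rule cSUP_upper[OF B])
    show "bdd_above ((\<lambda>B. \<bar>?I (s n) B - ?I l B\<bar>) ` sets (borel_on S2))"
    proof (rule bdd_aboveI2)
      fix B assume "B \<in> sets (borel_on S2)"
      then show "\<bar>?I (s n) B - ?I l B\<bar> \<le> 1" using bnd[of "s n" B] bnd[of l B] s by (simp add: abs_le_iff)
    qed
  qed
  have "(\<lambda>n. ?I (s n) B - ?I l B) \<longlonglongrightarrow> 0"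
    by (rule Lim_null_comparison[OF _ lim]) (use le in auto)
  then have "(\<lambda>n. ?I (s n) B) \<longlonglongrightarrow> ?I l B" by (simp add: LIM_zero_iff)
  then have "(\<lambda>n. ennreal (?I (s n) B)) \<longlonglongrightarrow> ennreal (?I l B)" by (rule tendsto_ennrealI)
  then have "(\<lambda>n. \<integral>\<^sup>+p. ennreal (f (fst p)) * indicator B (snd p) \<partial>\<Psi> (s n))
      \<longlonglongrightarrow> (\<integral>\<^sup>+p. ennreal (f (fst p)) * indicator B (snd p) \<partial>\<Psi> l)"
    using integral_slice(1)[OF S \<Psi> B fm f(2,3)] s by simp
  then show "(\<integral>\<^sup>+p. ennreal (f (fst p)) * indicator B (snd p) \<partial>\<Psi> l)
      \<le> liminf (\<lambda>n. \<integral>\<^sup>+p. ennreal (f (fst p)) * indicator B (snd p) \<partial>\<Psi> (s n))"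
    using lim_imp_Liminf[OF sequentially_bot] by fastforce
qed

text \<open>The indicator of an open set is an increasing limit of continuous functions.\<close>

lemma seq_lsc_on_rectangle:
  assumes "open V" "B \<in> sets borel"
  shows "seq_lsc_on S3 (\<lambda>s. emeasure (\<Psi> s) (V \<times> B \<inter> S1 \<times> S2))"
proof -
  \<comment> \<open>infdist to the empty set is 0, hence the separate case of the whole space\<close>
  define f where "f j w = (if V = UNIV then 1 else min 1 (real j * infdist w (- V)))" for j w
  have f: "continuous_on T (f j)" "0 \<le> f j w" "f j w \<le> 1" for j w T
    unfolding f_def by (cases "V = UNIV"; auto intro!: continuous_intros simp: infdist_nonneg)+
  have mono: "mono (\<lambda>j. ennreal (f j w))" for w
  proof (intro monoI ennreal_leI)
    fix i j :: nat assume "i \<le> j"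
    then have "real i * infdist w (- V) \<le> real j * infdist w (- V)"
      by (intro mult_right_mono) (auto simp: infdist_nonneg)
    then show "f i w \<le> f j w" by (auto simp: f_def)
  qed
  have sup: "(SUP j. ennreal (f j w)) = indicator V w" for w
  proof (cases "w \<in> V")
    case True
    have "\<exists>j. f j w = 1"
    proof (cases "V = UNIV")
      case False
      then have "infdist w (- V) > 0" using True assms by (intro infdist_pos_not_in_closed) auto
      then obtain j :: nat where "1 \<le> j * infdist w (- V)" using ex_less_of_nat_mult less_imp_le by metis
      then show ?thesis by (intro exI[of _ j]) (simp add: f_def)
    qed (simp add: f_def)
    then obtain j where "f j w = 1" ..
    then have "1 \<le> (SUP j. ennreal (f j w))" by (intro SUP_upper2[of j]) auto
    moreover have "(SUP j. ennreal (f j w)) \<le> 1" using f(3) by (intro SUP_least) auto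
    ultimately show ?thesis using True by simp
  next
    case False
    then have "f j w = 0" for j by (auto simp: f_def)
    then show ?thesis using False by simp
  qed
  have B: "B \<inter> S2 \<in> sets (borel_on S2)" using assms S by (auto simp: sets_restrict_space_iff)
  have "emeasure (\<Psi> s) (V \<times> B \<inter> S1 \<times> S2)
      = (SUP j. \<integral>\<^sup>+p. ennreal (f j (fst p)) * indicator (B \<inter> S2) (snd p) \<partial>\<Psi> s)" if s: "s \<in> S3" for s
  proof -
    have VB: "V \<times> B \<inter> S1 \<times> S2 \<in> sets (\<Psi> s)"
      using assms s by (intro sets_kernelI) (auto intro!: Times_in_borel)
    have m: "(\<lambda>p. ennreal (f j (fst p)) * indicator (B \<inter> S2) (snd p)) \<in> borel_measurable (\<Psi> s)" for j
    proof -
      have [measurable]: "f j \<in> borel_measurable borel" "B \<inter> S2 \<in> sets borel"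
        using f(1) assms S by (auto intro: borel_measurable_continuous_onI)
      have "(\<lambda>p. ennreal (f j (fst p)) * indicator (B \<inter> S2) (snd p)) \<in> borel_measurable (borel \<Otimes>\<^sub>M borel)"
        by measurable
      then show ?thesis
        by (subst measurable_cong_sets[OF sets_kernel[OF s] refl]) (auto simp: borel_prod intro: measurable_restrict_space1)
    qed
    have "emeasure (\<Psi> s) (V \<times> B \<inter> S1 \<times> S2) = (\<integral>\<^sup>+p. indicator (V \<times> B \<inter> S1 \<times> S2) p \<partial>\<Psi> s)"
      using VB by simp
    also have "\<dots> = (\<integral>\<^sup>+p. (SUP j. ennreal (f j (fst p)) * indicator (B \<inter> S2) (snd p)) \<partial>\<Psi> s)"
    proof (rule nn_integral_cong)
      fix p assume "p \<in> space (\<Psi> s)"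
      then show "indicator (V \<times> B \<inter> S1 \<times> S2) p = (SUP j. ennreal (f j (fst p)) * indicator (B \<inter> S2) (snd p))"
        by (subst SUP_mult_right_ennreal[symmetric]) (auto simp: sup space_kernel[OF s] split: split_indicator)
    qed
    also have "\<dots> = (SUP j. \<integral>\<^sup>+p. ennreal (f j (fst p)) * indicator (B \<inter> S2) (snd p) \<partial>\<Psi> s)"
      using mono m by (intro nn_integral_monotone_convergence_SUP)
        (auto simp: mono_def le_fun_def intro!: mult_right_mono)
    finally show ?thesis .
  qed
  moreover have "seq_lsc_on S3 (\<lambda>s. SUP j. \<integral>\<^sup>+p. ennreal (f j (fst p)) * indicator (B \<inter> S2) (snd p) \<partial>\<Psi> s)"
    by (intro seq_lsc_on_SUP seq_lsc_on_rectangle_function f B)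
  ultimately show ?thesis by (rule seq_lsc_on_cong)
qed

text \<open>Rectangles overlap, so their measures do not add up. Splitting along \<open>Y N\<close> removes the last
rectangle: over \<open>Y N\<close> the set \<open>V N\<close> is merged into \<open>W\<close>, off \<open>Y N\<close> the rectangle is empty. This is the reason for
the extra parameters \<open>W\<close> and \<open>C\<close> in the induction.\<close>

lemma seq_lsc_on_finite_union_rectangles:
  fixes N :: nat
  assumes V: "\<And>n. open (V n)" and Y: "\<And>n. Y n \<in> sets borel" and "open W" "C \<in> sets borel"
  shows "seq_lsc_on S3 (\<lambda>s. emeasure (\<Psi> s) (W \<times> C \<inter> S1 \<times> S2 \<union> (\<Union>n<N. V n \<times> (Y n \<inter> C)) \<inter> S1 \<times> S2))"
  using assms(3,4)
proof (induction N arbitrary: W C)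
  case 0
  then show ?case using seq_lsc_on_rectangle by simp
next
  case (Suc N)
  let ?G = "\<lambda>N W C. W \<times> C \<inter> S1 \<times> S2 \<union> (\<Union>n<N. V n \<times> (Y n \<inter> C)) \<inter> S1 \<times> S2"
  have m: "?G N W C \<in> sets (\<Psi> s)" if "s \<in> S3" "open W" "C \<in> sets borel" for s W C
  proof -
    have "W \<times> C \<in> sets borel" "V n \<times> (Y n \<inter> C) \<in> sets borel" for n
      using that V Y by (auto intro!: Times_in_borel)
    then show ?thesis
      using that(1) unfolding Int_Un_distrib2[symmetric] by (intro sets_kernelI sets.Un sets.countable_UN') auto
  qed
  have "emeasure (\<Psi> s) (?G (Suc N) W C) = emeasure (\<Psi> s) (?G N (W \<union> V N) (C \<inter> Y N)) + emeasure (\<Psi> s) (?G N W (C - Y N))"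
    if "s \<in> S3" for s
  proof -
    have G: "?G (Suc N) W C = ?G N (W \<union> V N) (C \<inter> Y N) \<union> ?G N W (C - Y N)"
      by (auto simp: less_Suc_eq)
    have disj: "?G N (W \<union> V N) (C \<inter> Y N) \<inter> ?G N W (C - Y N) = {}" by auto
    have "?G N (W \<union> V N) (C \<inter> Y N) \<in> sets (\<Psi> s)" "?G N W (C - Y N) \<in> sets (\<Psi> s)"
      by (rule m; use that Suc.prems V Y in auto)+
    from plus_emeasure[OF this disj] show ?thesis unfolding G by simp
  qed
  moreover have "seq_lsc_on S3 (\<lambda>s. emeasure (\<Psi> s) (?G N (W \<union> V N) (C \<inter> Y N)) + emeasure (\<Psi> s) (?G N W (C - Y N)))"
    using Suc.prems V Y by (intro seq_lsc_on_add Suc.IH) auto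
  ultimately show ?case by (rule seq_lsc_on_cong)
qed

text \<open>By the Kunugui-Novikov theorem such a set is an increasing union of finite unions of rectangles.\<close>

lemma seq_lsc_on_open_sections:
  assumes G: "G \<in> sets borel" "G \<subseteq> S1 \<times> S2"
    and op: "\<And>w y. (w, y) \<in> G \<Longrightarrow> \<exists>V. open V \<and> w \<in> V \<and> (\<forall>w'\<in>V \<inter> S1. (w', y) \<in> G)"
  shows "seq_lsc_on S3 (\<lambda>s. emeasure (\<Psi> s) G)"
proof -
  obtain V :: "nat \<Rightarrow> 's1 set" where V: "\<And>n. open (V n)"
    "\<And>S x. open S \<Longrightarrow> x \<in> S \<Longrightarrow> \<exists>n. x \<in> V n \<and> V n \<subseteq> S"
    using countable_basis_sequence by blast
  let ?sw = "\<lambda>G. (\<lambda>(y, w). (w, y)) -` G :: ('s2 \<times> 's1) set"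
  have sw: "?sw H \<in> sets borel" if "H \<in> sets borel" for H
  proof -
    have "(\<lambda>(y, w). (w, y)) \<in> borel_measurable (borel :: ('s2 \<times> 's1) measure)"
      unfolding case_prod_unfold by (intro borel_measurable_continuous_onI continuous_intros)
    from measurable_sets[OF this that] show ?thesis by simp
  qed
  have "\<exists>Y. (\<forall>n. Y n \<in> sets borel) \<and> ?sw G \<subseteq> (\<Union>n. Y n \<times> V n) \<and>
      (\<forall>n. (Y n \<times> V n) \<inter> ?sw (S1 \<times> S2 - G) = {})"
  proof (rule borel_rectangle_cover)
    show "?sw G \<in> sets borel" "?sw (S1 \<times> S2 - G) \<in> sets borel" using G Times_sets by (intro sw; blast)+
    fix y w assume "(y, w) \<in> ?sw G"
    then obtain V' where V': "open V'" "w \<in> V'" "\<And>w'. w' \<in> V' \<Longrightarrow> w' \<in> S1 \<Longrightarrow> (w', y) \<in> G"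
      using op[of w y] by auto
    obtain n where "w \<in> V n" "V n \<subseteq> V'" using V(2)[OF V'(1,2)] by blast
    then show "\<exists>n. w \<in> V n \<and> (\<forall>w'\<in>V n. (y, w') \<notin> ?sw (S1 \<times> S2 - G))"
      using V'(3) by (intro exI[of _ n]) auto
  qed (use V in auto)
  then obtain Y where Y: "\<And>n. Y n \<in> sets borel" "?sw G \<subseteq> (\<Union>n. Y n \<times> V n)"
      "\<And>n. (Y n \<times> V n) \<inter> ?sw (S1 \<times> S2 - G) = {}" by blast
  have G_eq: "G = (\<Union>N. (\<Union>n<N. V n \<times> Y n) \<inter> S1 \<times> S2)"
  proof (intro equalityI subsetI)
    fix p assume p: "p \<in> G"
    then have "(snd p, fst p) \<in> ?sw G" by simp
    then obtain n where "snd p \<in> Y n" "fst p \<in> V n" using Y(2) by blast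
    then have "p \<in> V n \<times> Y n" by (simp add: mem_Times_iff)
    then have "p \<in> (\<Union>n<Suc n. V n \<times> Y n) \<inter> S1 \<times> S2" using p G(2) by blast
    then show "p \<in> (\<Union>N. (\<Union>n<N. V n \<times> Y n) \<inter> S1 \<times> S2)" by blast
  next
    fix p assume "p \<in> (\<Union>N. (\<Union>n<N. V n \<times> Y n) \<inter> S1 \<times> S2)"
    then obtain N where "p \<in> (\<Union>n<N. V n \<times> Y n)" "p \<in> S1 \<times> S2" by blast
    then obtain n where n: "fst p \<in> V n" "snd p \<in> Y n" "p \<in> S1 \<times> S2" by (auto simp: mem_Times_iff)
    show "p \<in> G"
    proof (rule ccontr)
      assume "p \<notin> G"
      then have "(snd p, fst p) \<in> (Y n \<times> V n) \<inter> ?sw (S1 \<times> S2 - G)" using n by simp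
      then show False unfolding Y(3) by simp
    qed
  qed
  have "emeasure (\<Psi> s) G = (SUP N. emeasure (\<Psi> s) ((\<Union>n<N. V n \<times> Y n) \<inter> S1 \<times> S2))" if "s \<in> S3" for s
  proof -
    have "(SUP N. emeasure (\<Psi> s) ((\<Union>n<N. V n \<times> Y n) \<inter> S1 \<times> S2)) = emeasure (\<Psi> s) (\<Union>N. (\<Union>n<N. V n \<times> Y n) \<inter> S1 \<times> S2)"
    proof (rule SUP_emeasure_incseq)
      show "range (\<lambda>N. (\<Union>n<N. V n \<times> Y n) \<inter> S1 \<times> S2) \<subseteq> sets (\<Psi> s)"
        using V Y that by (auto intro!: sets_kernelI sets.countable_UN' Times_in_borel)
      show "incseq (\<lambda>N. (\<Union>n<N. V n \<times> Y n) \<inter> S1 \<times> S2)"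
        unfolding incseq_def by (intro allI impI Int_mono UN_mono) auto
    qed
    then show ?thesis using G_eq by simp
  qed
  moreover have "seq_lsc_on S3 (\<lambda>s. SUP N. emeasure (\<Psi> s) ((\<Union>n<N. V n \<times> Y n) \<inter> S1 \<times> S2))"
  proof (rule seq_lsc_on_SUP)
    show "seq_lsc_on S3 (\<lambda>s. emeasure (\<Psi> s) ((\<Union>n<N. V n \<times> Y n) \<inter> S1 \<times> S2))" for N
      using seq_lsc_on_finite_union_rectangles[OF V(1) Y(1) open_empty, where C=UNIV and N=N] by simp
  qed
  ultimately show ?thesis by (rule seq_lsc_on_cong)
qed

text \<open>By the layer-cake formula it suffices that \<open>s \<mapsto> \<Psi> s {u > t}\<close> is lower semi-continuous for each
\<open>t\<close>; the set \<open>{u > t}\<close> has open sections because \<open>u\<close> is lower semi-continuous in the first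
variable.\<close>

theorem seq_lsc_on_integral:
  assumes u: "u \<in> borel_measurable (borel_on (S1 \<times> S2))"
    and lsc: "\<And>w y r. w \<in> S1 \<Longrightarrow> y \<in> S2 \<Longrightarrow> r < u (w, y) \<Longrightarrow>
      \<exists>V. open V \<and> w \<in> V \<and> (\<forall>w'\<in>V \<inter> S1. r < u (w', y))"
  shows "seq_lsc_on S3 (\<lambda>s. \<integral>\<^sup>+p. u p \<partial>\<Psi> s)"
proof -
  let ?G = "\<lambda>t. {p\<in>S1 \<times> S2. ennreal t < u p}"
  have um: "u \<in> borel_measurable (\<Psi> s)" if "s \<in> S3" for s
    using u that by (simp add: measurable_cong_sets[OF sets_kernel refl])
  have eq: "(\<integral>\<^sup>+p. u p \<partial>\<Psi> s) = (\<integral>\<^sup>+t. indicator {0..} t * emeasure (\<Psi> s) (?G t) \<partial>lborel)"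
    if "s \<in> S3" for s
    using nn_integral_layer_cake[OF prob_space_imp_sigma_finite[OF prob_kernel[OF that]] um[OF that]]
    by (simp add: space_kernel[OF that])
  have "seq_lsc_on S3 (\<lambda>s. \<integral>\<^sup>+t. indicator {0..} t * emeasure (\<Psi> s) (?G t) \<partial>lborel)"
  proof (rule seq_lsc_on_nn_integral)
    fix t :: real
    have "{p\<in>space (borel_on (S1 \<times> S2)). ennreal t < u p} \<in> sets (borel_on (S1 \<times> S2))"
      using u by measurable
    then have "?G t \<in> sets borel"
      using Times_sets by (auto simp: space_restrict_space sets_restrict_space_iff)
    then show "seq_lsc_on S3 (\<lambda>s. indicator {0..} t * emeasure (\<Psi> s) (?G t))"
      using lsc by (intro seq_lsc_on_cmult seq_lsc_on_open_sections) auto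
  next
    fix s assume s: "s \<in> S3"
    interpret prob_space "\<Psi> s" by (rule prob_kernel[OF s])
    have [measurable]: "u \<in> borel_measurable (\<Psi> s)" by (rule um[OF s])
    have "(\<lambda>t::real. indicator {0..} t * emeasure (\<Psi> s) {p\<in>space (\<Psi> s). ennreal t < u p}) \<in> borel_measurable lborel"
      by measurable
    then show "(\<lambda>t::real. indicator {0..} t * emeasure (\<Psi> s) (?G t)) \<in> borel_measurable lborel"
      by (simp add: space_kernel[OF s])
  qed
  with eq show ?thesis by (rule seq_lsc_on_cong)
qed

end

section \<open>Minimization of inf-compact functions\<close>

definition inf_compact_on ::
  "'s::topological_space set \<Rightarrow> 'a::topological_space set \<Rightarrow> ('s \<times> 'a \<Rightarrow> ennreal) \<Rightarrow> bool"
where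
  "inf_compact_on S A F \<longleftrightarrow>
    (\<forall>K r. compact K \<longrightarrow> K \<subseteq> S \<longrightarrow> r < top \<longrightarrow> compact {p \<in> K \<times> A. F p \<le> r})"

lemma inf_compact_onD:
  "inf_compact_on S A F \<Longrightarrow> compact K \<Longrightarrow> K \<subseteq> S \<Longrightarrow> r < top \<Longrightarrow> compact {p \<in> K \<times> A. F p \<le> r}"
  by (auto simp: inf_compact_on_def)

lemma frequently_less_of_liminf_less:
  fixes f :: "nat \<Rightarrow> ennreal"
  assumes "\<not> y \<le> liminf f"
  obtains r where "r < y" "\<exists>\<^sub>F n in sequentially. f n \<le> r"
proof -
  obtain r where r: "r < y" "\<not> (\<forall>\<^sub>F n in sequentially. r < f n)"
    using assms by (auto simp: le_Liminf_iff)
  then show ?thesis by (intro that[of r]) (auto simp: frequently_def not_le)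
qed

lemma frequently_in_closed_limit:
  assumes "closed L" "s \<longlonglongrightarrow> l" "\<exists>\<^sub>F n in sequentially. s n \<in> L"
  shows "l \<in> L"
proof (rule ccontr)
  assume "l \<notin> L"
  then have "\<forall>\<^sub>F n in sequentially. s n \<in> - L"
    using assms by (intro topological_tendstoD[OF assms(2)]) auto
  then show False using assms(3) by (simp add: frequently_def)
qed

lemma compact_insert_limit:
  fixes s :: "nat \<Rightarrow> 'a::topological_space"
  assumes "s \<longlonglongrightarrow> l"
  shows "compact (insert l (range s))"
  unfolding compact_eq_Heine_Borel
proof (intro allI impI, elim conjE)
  fix C assume C: "\<forall>t\<in>C. open t" "insert l (range s) \<subseteq> \<Union>C"
  then obtain T where T: "T \<in> C" "l \<in> T" by blast
  then have "\<forall>\<^sub>F n in sequentially. s n \<in> T" using C(1) by (intro topological_tendstoD[OF assms]) auto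
  then obtain N where N: "\<And>n. n \<ge> N \<Longrightarrow> s n \<in> T" by (auto simp: eventually_sequentially)
  have "\<forall>n. \<exists>t\<in>C. s n \<in> t" using C(2) by blast
  then obtain t where t: "\<And>n. t n \<in> C" "\<And>n. s n \<in> t n" by metis
  have "insert l (range s) \<subseteq> \<Union>(insert T (t ` {..<N}))"
  proof
    fix x assume "x \<in> insert l (range s)"
    then consider "x = l" | n where "x = s n" by blast
    then show "x \<in> \<Union>(insert T (t ` {..<N}))"
    proof cases
      case 2
      then show ?thesis using N[of n] t(2)[of n] by (cases "n < N") auto
    qed (use T in auto)
  qed
  then show "\<exists>C'\<subseteq>C. finite C' \<and> insert l (range s) \<subseteq> \<Union>C'"
    using T t(1) by (intro exI[of _ "insert T (t ` {..<N})"]) auto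
qed

text \<open>A convergent sequence together with its limit is compact, so the values along the sequence are
governed by compact, hence closed, level sets.\<close>

lemma seq_lsc_on_of_inf_compact:
  fixes S :: "'s::metric_space set" and A :: "'a::metric_space set"
  assumes F: "inf_compact_on S A F"
  shows "seq_lsc_on (S \<times> A) F"
proof (rule seq_lsc_onI, rule ccontr)
  fix s l assume s: "\<And>n. s n \<in> S \<times> A" "l \<in> S \<times> A" "s \<longlonglongrightarrow> l"
  assume "\<not> F l \<le> liminf (\<lambda>n. F (s n))"
  then obtain r where r: "r < F l" "\<exists>\<^sub>F n in sequentially. F (s n) \<le> r"
    by (rule frequently_less_of_liminf_less)
  define K where "K = insert (fst l) (range (\<lambda>n. fst (s n)))"
  have "compact K" unfolding K_def
    using tendsto_fst[OF s(3)] by (rule compact_insert_limit)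
  moreover have "K \<subseteq> S" using s(1,2) by (force simp: K_def mem_Times_iff)
  moreover have "r < top" using r(1) by (rule less_le_trans) simp
  ultimately have "compact {p \<in> K \<times> A. F p \<le> r}" using F by (intro inf_compact_onD)
  then have "closed {p \<in> K \<times> A. F p \<le> r}" by (rule compact_imp_closed)
  moreover have "\<exists>\<^sub>F n in sequentially. s n \<in> {p \<in> K \<times> A. F p \<le> r}"
    using r(2) by (rule frequently_elim1) (use s(1) in \<open>auto simp: K_def mem_Times_iff\<close>)
  ultimately have "l \<in> {p \<in> K \<times> A. F p \<le> r}" using s(3) by (intro frequently_in_closed_limit)
  then show False using r(1) by auto
qed

lemma inf_compact_on_add:
  fixes S :: "'s::metric_space set" and A :: "'a::metric_space set"
  assumes F: "inf_compact_on S A F" and G: "seq_lsc_on (S \<times> A) G"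
  shows "inf_compact_on S A (\<lambda>p. F p + G p)"
  unfolding inf_compact_on_def
proof (intro allI impI)
  fix K and r :: ennreal assume K: "compact K" "K \<subseteq> S" "r < top"
  let ?L = "{p \<in> K \<times> A. F p + G p \<le> r}"
  show "compact ?L"
    unfolding compact_eq_seq_compact_metric
  proof (rule seq_compactI)
    fix s :: "nat \<Rightarrow> 's \<times> 'a" assume "\<forall>n. s n \<in> ?L"
    then have s: "s n \<in> K \<times> A" "F (s n) + G (s n) \<le> r" for n by auto
    have "F (s n) \<le> r" for n using s(2)[of n] by (rule order_trans[rotated]) simp
    then have sL: "\<forall>n. s n \<in> {p \<in> K \<times> A. F p \<le> r}" using s(1) by blast
    have "seq_compact {p \<in> K \<times> A. F p \<le> r}"
      using inf_compact_onD[OF F K] by (simp add: compact_eq_seq_compact_metric)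
    from this sL obtain l and k :: "nat \<Rightarrow> nat" where
      l: "l \<in> {p \<in> K \<times> A. F p \<le> r}" "strict_mono k" "(s \<circ> k) \<longlonglongrightarrow> l"
      by (rule seq_compactE)
    have "F l + G l \<le> liminf (\<lambda>n. F ((s \<circ> k) n) + G ((s \<circ> k) n))"
    proof (rule seq_lsc_onD[OF seq_lsc_on_add[OF seq_lsc_on_of_inf_compact[OF F] G] _ _ l(3)])
      show "(s \<circ> k) n \<in> S \<times> A" for n using s(1)[of "k n"] K(2) by (auto simp: mem_Times_iff)
      show "l \<in> S \<times> A" using l(1) K(2) by auto
    qed
    also have "\<dots> \<le> r"
      using s(2) Liminf_mono[of "\<lambda>n. F ((s \<circ> k) n) + G ((s \<circ> k) n)" "\<lambda>n. r" sequentially]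
      by (simp add: Liminf_const)
    finally show "\<exists>l\<in>?L. \<exists>k. strict_mono k \<and> (s \<circ> k) \<longlonglongrightarrow> l" using l by blast
  qed
qed

lemma compact_level_set:
  assumes F: "inf_compact_on S A F" and "w \<in> S" "r < top"
  shows "compact {a \<in> A. F (w, a) \<le> r}"
proof -
  have "compact (snd ` {p \<in> {w} \<times> A. F p \<le> r})"
    using inf_compact_onD[OF F, of "{w}" r] assms(2,3)
    by (intro compact_continuous_image continuous_intros) auto
  also have "snd ` {p \<in> {w} \<times> A. F p \<le> r} = {a \<in> A. F (w, a) \<le> r}" by force
  finally show ?thesis .
qed

text \<open>Nested compact nonempty sets meet. This serves both to attain a minimum and to exchange the minimum
with an increasing limit, hence the sequence of functions.\<close>

lemma common_point_of_level_sets: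
  fixes F :: "nat \<Rightarrow> 's::t1_space \<times> 'a::metric_space \<Rightarrow> ennreal"
  assumes F: "\<And>n. inf_compact_on S A (F n)" and w: "w \<in> S" and r: "\<And>n. r n < top"
    and ne: "\<And>n. \<exists>a\<in>A. F n (w, a) \<le> r n"
    and dec: "\<And>m n a. m \<le> n \<Longrightarrow> a \<in> A \<Longrightarrow> F n (w, a) \<le> r n \<Longrightarrow> F m (w, a) \<le> r m"
  shows "\<exists>a\<in>A. \<forall>n. F n (w, a) \<le> r n"
proof -
  let ?L = "\<lambda>n. {a \<in> A. F n (w, a) \<le> r n}"
  have cpt: "compact (?L n)" for n by (rule compact_level_set[OF F w r])
  obtain a where a: "\<And>n. a n \<in> ?L n" using ne by (simp add: Bex_def) metis
  have "seq_compact (?L 0)" using cpt by (simp add: compact_eq_seq_compact_metric)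
  moreover have "\<forall>n. a n \<in> ?L 0" using a dec[of 0] by blast
  ultimately obtain l and k :: "nat \<Rightarrow> nat" where l: "strict_mono k" "(a \<circ> k) \<longlonglongrightarrow> l"
    by (rule seq_compactE)
  have "l \<in> ?L n" for n
  proof (rule frequently_in_closed_limit[OF compact_imp_closed[OF cpt] l(2)])
    have "(a \<circ> k) m \<in> ?L n" if "n \<le> m" for m
      using a[of "k m"] dec[of n "k m"] seq_suble[OF l(1), of m] that by auto
    then have "\<forall>\<^sub>F m in sequentially. (a \<circ> k) m \<in> ?L n"
      by (auto simp: eventually_sequentially)
    then show "\<exists>\<^sub>F m in sequentially. (a \<circ> k) m \<in> ?L n"
      by (rule eventually_frequently[rotated]) simp
  qed
  then show ?thesis by blast
qed

lemma inf_compact_on_min_attained: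
  fixes F :: "'s::t1_space \<times> 'a::metric_space \<Rightarrow> ennreal"
  assumes F: "inf_compact_on S A F" and w: "w \<in> S" and "A \<noteq> {}"
  shows "\<exists>a\<in>A. F (w, a) = (INF a\<in>A. F (w, a))"
proof (cases "(INF a\<in>A. F (w, a)) < top")
  case False
  then have "(INF a\<in>A. F (w, a)) = top" by (metis top.not_eq_extremum)
  moreover obtain a where "a \<in> A" using \<open>A \<noteq> {}\<close> by blast
  ultimately show ?thesis by (metis INF_lower top.extremum_unique)
next
  case True
  let ?v = "INF a\<in>A. F (w, a)"
  let ?e = "\<lambda>n. ennreal (1 / Suc n)"
  have "\<exists>a\<in>A. \<forall>n. F (w, a) \<le> ?v + ?e n"
  proof (rule common_point_of_level_sets[where F="\<lambda>_. F" and r="\<lambda>n. ?v + ?e n", OF F w])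
    fix n
    show "?v + ?e n < top" using True by simp
    obtain v where v: "?v = ennreal v" "0 \<le> v" using True by (cases ?v) auto
    then have "?v < ?v + ?e n" by (simp add: ennreal_plus[symmetric] ennreal_less_iff del: ennreal_plus)
    then show "\<exists>a\<in>A. F (w, a) \<le> ?v + ?e n" by (auto simp: INF_less_iff intro: less_imp_le)
  next
    fix m n a assume mn: "m \<le> (n::nat)" "F (w, a) \<le> ?v + ?e n"
    have "?e n \<le> ?e m" using mn(1) by (intro ennreal_leI) (simp add: frac_le)
    then show "F (w, a) \<le> ?v + ?e m" using mn(2) by (meson add_left_mono order_trans)
  qed
  then obtain a where a: "a \<in> A" "\<And>n. F (w, a) \<le> ?v + ?e n" by blast
  have "(\<lambda>n. ?v + ?e n) \<longlonglongrightarrow> ?v + ennreal 0"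
    by (intro tendsto_add tendsto_const tendsto_ennrealI LIMSEQ_Suc lim_1_over_n)
  then have "F (w, a) \<le> ?v + ennreal 0" by (rule LIMSEQ_le_const) (use a in auto)
  then show ?thesis using a(1) by (intro bexI[of _ a] antisym INF_lower) auto
qed

lemma seq_lsc_on_min:
  fixes S :: "'s::metric_space set" and A :: "'a::metric_space set"
  assumes F: "inf_compact_on S A F" and "A \<noteq> {}"
  shows "seq_lsc_on S (\<lambda>w. INF a\<in>A. F (w, a))"
proof (rule seq_lsc_onI, rule ccontr)
  fix s l assume s: "\<And>n. s n \<in> S" "l \<in> S" "s \<longlonglongrightarrow> l"
  assume "\<not> (INF a\<in>A. F (l, a)) \<le> liminf (\<lambda>n. INF a\<in>A. F (s n, a))"
  then obtain r where r: "r < (INF a\<in>A. F (l, a))" "\<exists>\<^sub>F n in sequentially. (INF a\<in>A. F (s n, a)) \<le> r"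
    by (rule frequently_less_of_liminf_less)
  let ?L = "{p \<in> insert l (range s) \<times> A. F p \<le> r}"
  have "r < top" using r(1) by (rule less_le_trans) simp
  then have "compact ?L"
    using compact_insert_limit[OF s(3)] s(1,2) by (intro inf_compact_onD[OF F]) auto
  then have "closed (fst ` ?L)"
    by (intro compact_imp_closed compact_continuous_image continuous_intros)
  moreover have "\<exists>\<^sub>F n in sequentially. s n \<in> fst ` ?L"
    using r(2)
  proof (rule frequently_elim1)
    fix n assume "(INF a\<in>A. F (s n, a)) \<le> r"
    then obtain a where "a \<in> A" "F (s n, a) \<le> r"
      using inf_compact_on_min_attained[OF F s(1) \<open>A \<noteq> {}\<close>] by metis
    then show "s n \<in> fst ` ?L" by (intro image_eqI[of _ _ "(s n, a)"]) auto
  qed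
  ultimately have "l \<in> fst ` ?L" using s(3) by (intro frequently_in_closed_limit)
  then obtain a where "a \<in> A" "F (l, a) \<le> r" by auto
  then have "(INF a\<in>A. F (l, a)) \<le> r" by (rule INF_lower2)
  then show False using r(1) by simp
qed

text \<open>Where the minimum is attained, its sublevel sets are projections of the sublevel sets of \<open>F\<close>, whose sections are
compact.\<close>

lemma borel_measurable_min:
  fixes X :: "'x::polish_space set" and A :: "'a::polish_space set" and F :: "'x \<times> 'a \<Rightarrow> ennreal"
  assumes X: "X \<in> sets borel" and A: "A \<in> sets borel"
    and F: "F \<in> borel_measurable (borel_on (X \<times> A))"
    and cpt: "\<And>x r. x \<in> X \<Longrightarrow> r < top \<Longrightarrow> compact {a\<in>A. F (x, a) \<le> r}"
    and att: "\<And>x. x \<in> X \<Longrightarrow> \<exists>a\<in>A. F (x, a) = (INF a\<in>A. F (x, a))"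
  shows "(\<lambda>x. INF a\<in>A. F (x, a)) \<in> borel_measurable (borel_on X)"
proof (rule borel_measurableI_le)
  fix r :: ennreal
  show "{x \<in> space (borel_on X). (INF a\<in>A. F (x, a)) \<le> r} \<in> sets (borel_on X)"
  proof (cases "r < top")
    case False
    then have "{x \<in> space (borel_on X). (INF a\<in>A. F (x, a)) \<le> r} = space (borel_on X)"
      by (simp add: top.not_eq_extremum[symmetric])
    then show ?thesis by (metis sets.top)
  next
    case True
    let ?E = "{p \<in> X \<times> A. F p \<le> r}"
    have "{p \<in> space (borel_on (X \<times> A)). F p \<le> r} \<in> sets (borel_on (X \<times> A))"
      using F by measurable
    then have "?E \<in> sets borel"
      using Times_in_borel[OF X A] by (auto simp: space_restrict_space sets_restrict_space_iff)
    moreover have "compact {a. (x, a) \<in> ?E}" for x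
      using cpt[OF _ True, of x] by (cases "x \<in> X") auto
    ultimately have "fst ` ?E \<in> sets borel" by (rule borel_projection_compact_sections)
    moreover have "fst ` ?E = {x \<in> X. (INF a\<in>A. F (x, a)) \<le> r}"
    proof (intro equalityI subsetI)
      fix x assume "x \<in> fst ` ?E"
      then show "x \<in> {x \<in> X. (INF a\<in>A. F (x, a)) \<le> r}" by (auto intro: INF_lower2)
    next
      fix x assume x: "x \<in> {x \<in> X. (INF a\<in>A. F (x, a)) \<le> r}"
      then obtain a where "a \<in> A" "F (x, a) \<le> r" using att[of x] by auto
      then show "x \<in> fst ` ?E" using x by (intro image_eqI[of _ _ "(x, a)"]) auto
    qed
    ultimately show ?thesis
      using X by (auto simp: space_restrict_space sets_restrict_space_iff)
  qed
qed

lemma argmin_graph_in_borel: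
  fixes X :: "'x::polish_space set" and A :: "'a::polish_space set" and F :: "'x \<times> 'a \<Rightarrow> ennreal"
  assumes F: "F \<in> borel_measurable (borel_on (X \<times> A))"
    and V: "V \<in> borel_measurable (borel_on X)"
  shows "{p \<in> X \<times> A. F p = V (fst p)} \<in> sets (borel_on (X \<times> A))"
proof -
  have "(\<lambda>p. V (fst p)) \<in> borel_measurable (borel_on (X \<times> A))"
    using measurable_compose[OF fst_measurable_borel_on V] .
  then have "{p \<in> space (borel_on (X \<times> A)). F p = V (fst p)} \<in> sets (borel_on (X \<times> A))"
    using F by measurable
  then show ?thesis by (simp add: space_restrict_space)
qed

text \<open>The set of minimizers is compact where the minimum is finite; elsewhere every action is a
minimizer and a constant one is taken.\<close>

lemma borel_argmin_selector:
  fixes X :: "'x::polish_space set" and A :: "'a::polish_space set" and F :: "'x \<times> 'a \<Rightarrow> ennreal"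
  assumes X: "X \<in> sets borel" and A: "A \<in> sets borel" "A \<noteq> {}"
    and F: "F \<in> borel_measurable (borel_on (X \<times> A))"
    and cpt: "\<And>x r. x \<in> X \<Longrightarrow> r < top \<Longrightarrow> compact {a\<in>A. F (x, a) \<le> r}"
    and att: "\<And>x. x \<in> X \<Longrightarrow> \<exists>a\<in>A. F (x, a) = (INF a\<in>A. F (x, a))"
  shows "\<exists>\<phi>\<in>borel_on X \<rightarrow>\<^sub>M borel_on A. \<forall>x\<in>X. F (x, \<phi> x) = (INF a\<in>A. F (x, a))"
proof -
  define V where "V x = (INF a\<in>A. F (x, a))" for x
  have V: "V \<in> borel_measurable (borel_on X)"
    unfolding V_def by (rule borel_measurable_min[OF X A(1) F cpt att])
  let ?fin = "{x\<in>X. V x < top}"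
  let ?E = "{p \<in> X \<times> A. F p = V (fst p)} \<inter> ?fin \<times> UNIV"
  have "{x\<in>space (borel_on X). V x < top} \<in> sets (borel_on X)" using V by measurable
  then have fin: "?fin \<in> sets borel" using X by (simp add: space_restrict_space sets_restrict_space_iff)
  have "{p \<in> X \<times> A. F p = V (fst p)} \<in> sets borel"
    using argmin_graph_in_borel[OF F V] Times_in_borel[OF X A(1)] by (simp add: sets_restrict_space_iff)
  then have "?E \<in> sets borel" using fin by (intro sets.Int Times_in_borel) auto
  moreover have "compact {a. (x, a) \<in> ?E}" for x
  proof (cases "x \<in> ?fin")
    case True
    then have "{a. (x, a) \<in> ?E} = {a\<in>A. F (x, a) \<le> V x}"
      by (auto simp: V_def intro!: antisym INF_lower)
    then show ?thesis using cpt[of x "V x"] True by simp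
  qed auto
  ultimately have "\<exists>f\<in>borel_measurable borel. \<forall>x\<in>fst ` ?E. (x, f x) \<in> ?E"
    by (rule borel_selector_compact_sections)
  then obtain f where f: "f \<in> borel_measurable borel" "\<forall>x\<in>fst ` ?E. (x, f x) \<in> ?E"
    by (rule bexE)
  obtain a0 where a0: "a0 \<in> A" using A(2) by blast
  define \<phi> where "\<phi> x = (if x \<in> ?fin then f x else a0)" for x
  have "\<phi> \<in> borel \<rightarrow>\<^sub>M borel" unfolding \<phi>_def using f(1) fin by measurable
  moreover have sel: "\<phi> x \<in> A \<and> F (x, \<phi> x) = V x" if x: "x \<in> X" for x
  proof (cases "V x < top")
    case True
    obtain a where "a \<in> A" "F (x, a) = V x" using att[OF x] by (auto simp: V_def)
    then have "x \<in> fst ` ?E" using x True by (intro image_eqI[of _ _ "(x, a)"]) auto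
    from bspec[OF f(2) this] show ?thesis using x True by (simp add: \<phi>_def)
  next
    case False
    then have "V x = top" by (metis top.not_eq_extremum)
    moreover have "V x \<le> F (x, a0)" unfolding V_def using a0 by (rule INF_lower)
    ultimately show ?thesis using a0 by (simp add: \<phi>_def top_unique)
  qed
  ultimately have "\<phi> \<in> borel_on X \<rightarrow>\<^sub>M borel_on A"
    by (intro measurable_restrict_space3) auto
  then show ?thesis using sel by (auto simp: V_def)
qed

section \<open>Expected costs of policies\<close>

locale controlled_process =
  fixes X :: "'x::topological_space set" and A :: "'a::topological_space set"
    and q :: "'x \<times> 'a \<Rightarrow> 'x measure" and \<pi> :: "('x, 'a) policy" and x0 :: 'x
    and C :: "'x \<times> 'a \<Rightarrow> ennreal" and \<beta> :: ennreal
  assumes q: "q \<in> sa_space X A \<rightarrow>\<^sub>M prob_algebra (borel_on X)"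
    and \<pi>: "\<pi> \<in> policies X A" and x0: "x0 \<in> X"
    and C_measurable [measurable]: "C \<in> borel_measurable (sa_space X A)"
begin

abbreviation S where "S \<equiv> sa_space X A"
abbreviation H where "H t \<equiv> PiM {0..<t::nat} (\<lambda>_. S)"
abbreviation K where "K \<equiv> step_kernel X A q \<pi> x0"

definition state_law :: "nat \<Rightarrow> (nat \<Rightarrow> 'x \<times> 'a) \<Rightarrow> 'x measure" where
  "state_law t h = (case t of 0 \<Rightarrow> return (borel_on X) x0 | Suc s \<Rightarrow> q (h s))"

lemma space_S: "space S = X \<times> A"
  by (simp add: space_pair_measure space_restrict_space)

lemma state_law_measurable: "state_law t \<in> H t \<rightarrow>\<^sub>M prob_algebra (borel_on X)"
proof (cases t)
  case 0
  have "return (borel_on X) x0 \<in> space (prob_algebra (borel_on X))"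
    using x0 by (auto simp: space_prob_algebra space_restrict_space intro!: prob_space_return)
  then show ?thesis unfolding state_law_def 0 by simp
next
  case (Suc s)
  have "(\<lambda>h. h s) \<in> H t \<rightarrow>\<^sub>M S" using Suc by (intro measurable_component_singleton) auto
  from measurable_compose[OF this q] show ?thesis unfolding state_law_def Suc by simp
qed

lemma sets_state_law: "h \<in> space (H t) \<Longrightarrow> sets (state_law t h) = sets (borel_on X)"
  using measurable_space[OF state_law_measurable] by (auto simp: space_prob_algebra)

lemma space_state_law: "h \<in> space (H t) \<Longrightarrow> space (state_law t h) = X"
  using sets_eq_imp_space_eq[OF sets_state_law] by (simp add: space_restrict_space)

lemma policy_measurable: "\<pi> t \<in> H t \<Otimes>\<^sub>M borel_on X \<rightarrow>\<^sub>M prob_algebra (borel_on A)"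
  using \<pi> by (auto simp: policies_def)

lemma policy_space: "h \<in> space (H t) \<Longrightarrow> x \<in> X \<Longrightarrow> \<pi> t (h, x) \<in> space (prob_algebra (borel_on A))"
  using measurable_space[OF policy_measurable] by (auto simp: space_pair_measure space_restrict_space)

lemma action_kernel_measurable:
  "(\<lambda>(h, x). Giry_Monad.bind (\<pi> t (h, x)) (\<lambda>a. return S (x, a))) \<in> H t \<Otimes>\<^sub>M borel_on X \<rightarrow>\<^sub>M prob_algebra S"
proof -
  have "(\<lambda>p. Giry_Monad.bind (\<pi> t p) (\<lambda>a. return S (snd p, a))) \<in> H t \<Otimes>\<^sub>M borel_on X \<rightarrow>\<^sub>M prob_algebra S"
  proof (rule measurable_bind_prob_space2[OF policy_measurable])
    have "(\<lambda>(p, a). (snd p, a)) \<in> (H t \<Otimes>\<^sub>M borel_on X) \<Otimes>\<^sub>M borel_on A \<rightarrow>\<^sub>M S" by measurable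
    from measurable_compose[OF this measurable_return_prob_space]
    show "(\<lambda>(p, a). return S (snd p, a)) \<in> (H t \<Otimes>\<^sub>M borel_on X) \<Otimes>\<^sub>M borel_on A \<rightarrow>\<^sub>M prob_algebra S"
      by (simp add: case_prod_unfold)
  qed
  then show ?thesis by (simp add: case_prod_unfold)
qed

lemma step_kernel_eq:
  "K t h = Giry_Monad.bind (state_law t h) (\<lambda>x. Giry_Monad.bind (\<pi> t (h, x)) (\<lambda>a. return S (x, a)))"
  by (simp add: step_kernel_def state_law_def)

lemma step_kernel_measurable: "K t \<in> H t \<rightarrow>\<^sub>M prob_algebra S"
  unfolding step_kernel_eq[abs_def]
  using action_kernel_measurable by (intro measurable_bind_prob_space2[OF state_law_measurable]) auto

lemma nn_integral_step_kernel:
  assumes h: "h \<in> space (H t)" and f: "f \<in> borel_measurable S"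
  shows "(\<integral>\<^sup>+z. f z \<partial>K t h) = (\<integral>\<^sup>+x. (\<integral>\<^sup>+a. f (x, a) \<partial>\<pi> t (h, x)) \<partial>state_law t h)"
proof -
  have "(\<lambda>x. Giry_Monad.bind (\<pi> t (h, x)) (\<lambda>a. return S (x, a))) \<in> borel_on X \<rightarrow>\<^sub>M prob_algebra S"
    using measurable_compose[OF measurable_Pair1'[OF h] action_kernel_measurable] by simp
  then have "(\<lambda>x. Giry_Monad.bind (\<pi> t (h, x)) (\<lambda>a. return S (x, a))) \<in> state_law t h \<rightarrow>\<^sub>M subprob_algebra S"
    by (simp add: measurable_prob_algebraD measurable_cong_sets[OF sets_state_law[OF h] refl])
  then have "(\<integral>\<^sup>+z. f z \<partial>K t h) =
      (\<integral>\<^sup>+x. (\<integral>\<^sup>+z. f z \<partial>Giry_Monad.bind (\<pi> t (h, x)) (\<lambda>a. return S (x, a))) \<partial>state_law t h)"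
    unfolding step_kernel_eq by (rule nn_integral_bind[OF f])
  also have "\<dots> = (\<integral>\<^sup>+x. (\<integral>\<^sup>+a. f (x, a) \<partial>\<pi> t (h, x)) \<partial>state_law t h)"
  proof (rule nn_integral_cong)
    fix x assume "x \<in> space (state_law t h)"
    then have x: "x \<in> X" by (simp add: space_state_law[OF h])
    note p = policy_space[OF h x]
    have sets: "sets (\<pi> t (h, x)) = sets (borel_on A)" using p by (simp add: space_prob_algebra)
    then have sp: "space (\<pi> t (h, x)) = A" using sets_eq_imp_space_eq[OF sets] by (simp add: space_restrict_space)
    have "(\<lambda>a. (x, a)) \<in> \<pi> t (h, x) \<rightarrow>\<^sub>M S"
      using measurable_Pair1'[of x "borel_on X" "borel_on A"] x
      by (simp add: measurable_cong_sets[OF sets refl] space_restrict_space)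
    from measurable_compose[OF this return_measurable]
    have "(\<integral>\<^sup>+z. f z \<partial>Giry_Monad.bind (\<pi> t (h, x)) (\<lambda>a. return S (x, a))) =
        (\<integral>\<^sup>+a. (\<integral>\<^sup>+z. f z \<partial>return S (x, a)) \<partial>\<pi> t (h, x))"
      by (rule nn_integral_bind[OF f])
    also have "\<dots> = (\<integral>\<^sup>+a. f (x, a) \<partial>\<pi> t (h, x))"
      by (intro nn_integral_cong nn_integral_return f) (auto simp: space_S sp x)
    finally show "(\<integral>\<^sup>+z. f z \<partial>Giry_Monad.bind (\<pi> t (h, x)) (\<lambda>a. return S (x, a))) = (\<integral>\<^sup>+a. f (x, a) \<partial>\<pi> t (h, x))" .
  qed
  finally show ?thesis .
qed

sublocale IT: Ionescu_Tulcea K "\<lambda>_. S"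
proof (rule Ionescu_Tulcea.intro)
  show "K i \<in> H i \<rightarrow>\<^sub>M subprob_algebra S" for i
    using step_kernel_measurable by (rule measurable_prob_algebraD)
  show "prob_space (K i h)" if "h \<in> space (H i)" for i h
    using measurable_space[OF step_kernel_measurable that] by (simp add: space_prob_algebra)
qed

lemma strategic_measure_eq: "strategic_measure X A q \<pi> x0 = IT.PF.lim"
  by (simp add: strategic_measure_def)

lemma sets_strategic_measure: "sets (strategic_measure X A q \<pi> x0) = sets (PiM UNIV (\<lambda>_. S))"
  by (simp add: strategic_measure_eq)

text \<open>Only the first \<open>T\<close> coordinates matter, and their joint law is the \<open>T\<close>-fold composition of the
step kernels, started from the empty history.\<close>

lemma nn_integral_strategic_measure:
  assumes f [measurable]: "f \<in> borel_measurable (H T)"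
  shows "(\<integral>\<^sup>+\<omega>. f (restrict \<omega> {0..<T}) \<partial>strategic_measure X A q \<pi> x0) = (\<integral>\<^sup>+\<omega>. f \<omega> \<partial>IT.C 0 T (\<lambda>_. undefined))"
proof -
  have u: "(\<lambda>_. undefined) \<in> space (H 0)" by (simp add: space_PiM)
  have upto: "IT.up_to {0..<T} = T"
    using IT.up_to_iff_Ico[of "{0..<T}" T] IT.up_to[of "{0..<T}"] by (auto intro!: antisym)
  have r: "(\<lambda>\<omega>. restrict \<omega> {0..<T}) \<in> PiM UNIV (\<lambda>_. S) \<rightarrow>\<^sub>M H T" by (rule measurable_restrict_subset) simp
  have sC: "sets (IT.C 0 T (\<lambda>_. undefined)) = sets (H T)" using IT.sets_C[OF u, of T] by simp
  have r': "(\<lambda>\<omega>. restrict \<omega> {0..<T}) \<in> IT.C 0 T (\<lambda>_. undefined) \<rightarrow>\<^sub>M H T"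
    unfolding measurable_cong_sets[OF sC refl] by (rule measurable_restrict_subset) simp
  have "(\<integral>\<^sup>+\<omega>. f (restrict \<omega> {0..<T}) \<partial>strategic_measure X A q \<pi> x0) =
      (\<integral>\<^sup>+\<omega>. f \<omega> \<partial>distr IT.PF.lim (H T) (\<lambda>\<omega>. restrict \<omega> {0..<T}))"
    unfolding strategic_measure_eq
    by (rule nn_integral_distr[symmetric]) (simp_all only: measurable_cong_sets[OF IT.PF.sets_lim refl] r f measurable_distr_eq1)
  also have "\<dots> = (\<integral>\<^sup>+\<omega>. f \<omega> \<partial>distr (IT.C 0 T (\<lambda>_. undefined)) (H T) (\<lambda>\<omega>. restrict \<omega> {0..<T}))"
    by (subst IT.distr_lim) (simp_all add: IT.CI_def upto)
  also have "\<dots> = (\<integral>\<^sup>+\<omega>. f (restrict \<omega> {0..<T}) \<partial>IT.C 0 T (\<lambda>_. undefined))"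
    by (rule nn_integral_distr[OF r']) simp
  also have "\<dots> = (\<integral>\<^sup>+\<omega>. f \<omega> \<partial>IT.C 0 T (\<lambda>_. undefined))"
    by (intro nn_integral_cong arg_cong[where f=f]) (auto simp: IT.space_C[OF u] space_PiM)
  finally show ?thesis .
qed

text \<open>The expected cost of \<open>n\<close> further steps after a history \<open>h\<close> of length \<open>t\<close>, with discounting
restarted at time \<open>t\<close>.\<close>

definition cost_to_go :: "nat \<Rightarrow> nat \<Rightarrow> (nat \<Rightarrow> 'x \<times> 'a) \<Rightarrow> ennreal" where
  "cost_to_go n t h = (\<integral>\<^sup>+\<omega>. (\<Sum>i<n. \<beta> ^ i * C (\<omega> (t + i))) \<partial>IT.C t n h)"

lemma coordinate_cost_measurable: "i < m \<Longrightarrow> (\<lambda>\<omega>. C (\<omega> i)) \<in> borel_measurable (H m)"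
  using measurable_compose[OF measurable_component_singleton[of i "{0..<m}" "\<lambda>_. S"] C_measurable] by simp

lemma path_cost_measurable:
  assumes "t + n \<le> m"
  shows "(\<lambda>\<omega>. \<Sum>i<n. \<beta> ^ i * C (\<omega> (t + i))) \<in> borel_measurable (H m)"
  using assms by (intro borel_measurable_sum borel_measurable_times borel_measurable_const coordinate_cost_measurable) auto

lemma fun_upd_in_H: "h \<in> space (H t) \<Longrightarrow> z \<in> space S \<Longrightarrow> h(t := z) \<in> space (H (Suc t))"
  by (auto simp: space_PiM PiE_iff extensional_def)

lemma cost_to_go_measurable: "cost_to_go n t \<in> borel_measurable (H t)"
  unfolding cost_to_go_def[abs_def]
  by (rule measurable_compose[OF IT.measurable_C nn_integral_measurable_subprob_algebra])
    (rule path_cost_measurable, simp)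

lemma cost_to_go_0: "cost_to_go 0 t h = 0"
  by (simp add: cost_to_go_def)

lemma fun_upd_measurable: "h \<in> space (H t) \<Longrightarrow> fun_upd h t \<in> S \<rightarrow>\<^sub>M H (Suc t)"
  by (rule measurable_fun_upd[where J="{0..<t}"]) (auto simp: atLeast0_lessThan_Suc)

text \<open>Conditioning on the next state-action pair.\<close>

lemma cost_to_go_Suc:
  assumes h: "h \<in> space (H t)"
  shows "cost_to_go (Suc n) t h = (\<integral>\<^sup>+z. C z + \<beta> * cost_to_go n (Suc t) (h(t := z)) \<partial>K t h)"
proof -
  let ?f = "\<lambda>\<omega>. \<Sum>i<Suc n. \<beta> ^ i * C (\<omega> (t + i))"
  let ?g = "\<lambda>\<omega>. \<Sum>i<n. \<beta> ^ i * C (\<omega> (Suc t + i))"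
  have f: "?f \<in> borel_measurable (H (Suc t + n))" by (rule path_cost_measurable) simp
  have g: "?g \<in> borel_measurable (H (Suc t + n))" by (rule path_cost_measurable) simp
  have split: "?f \<omega> = C (\<omega> t) + \<beta> * ?g \<omega>" for \<omega>
    by (simp only: sum.lessThan_Suc_shift) (simp add: sum_distrib_left mult.assoc)
  have "IT.C t (Suc n) h = Giry_Monad.bind (IT.C t 1 h) (IT.C (t + 1) n)"
    using IT.split_C[OF h, of 1 n] by simp
  also have "IT.C t 1 h = IT.eP t h"
    using bind_return[OF IT.measurable_eP h] by simp
  finally have C_eq: "IT.C t (Suc n) h = Giry_Monad.bind (IT.eP t h) (IT.C (Suc t) n)" by simp
  have "cost_to_go (Suc n) t h = (\<integral>\<^sup>+h'. (\<integral>\<^sup>+\<omega>. ?f \<omega> \<partial>IT.C (Suc t) n h') \<partial>IT.eP t h)"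
    unfolding cost_to_go_def C_eq
    using IT.measurable_C[of "Suc t" n] IT.sets_eP[OF h]
    by (intro nn_integral_bind[OF f]) (simp add: measurable_cong_sets[OF IT.sets_eP[OF h] refl])
  also have "\<dots> = (\<integral>\<^sup>+z. (\<integral>\<^sup>+\<omega>. ?f \<omega> \<partial>IT.C (Suc t) n (h(t := z))) \<partial>K t h)"
    by (rule IT.nn_integral_eP[OF h])
      (rule measurable_compose[OF IT.measurable_C nn_integral_measurable_subprob_algebra[OF f]])
  also have "\<dots> = (\<integral>\<^sup>+z. C z + \<beta> * cost_to_go n (Suc t) (h(t := z)) \<partial>K t h)"
  proof (rule nn_integral_cong)
    fix z assume "z \<in> space (K t h)"
    then have h': "h(t := z) \<in> space (H (Suc t))" using IT.space_P[OF h] fun_upd_in_H[OF h] by simp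
    have sets: "sets (IT.C (Suc t) n (h(t := z))) = sets (H (Suc t + n))" by (rule IT.sets_C[OF h'])
    note Ct = coordinate_cost_measurable[of t]
    \<comment> \<open>later steps do not change coordinate t, so its cost is C z\<close>
    have "(\<integral>\<^sup>+\<omega>. C (\<omega> t) \<partial>IT.C (Suc t) 0 (h(t := z))) = (\<integral>\<^sup>+\<omega>. C (restrict \<omega> {0..<Suc t + 0} t) \<partial>IT.C (Suc t) n (h(t := z)))"
      by (rule IT.nn_integral_C) (use Ct h' in auto)
    moreover have "(\<integral>\<^sup>+\<omega>. C (\<omega> t) \<partial>IT.C (Suc t) 0 (h(t := z))) = C z"
      using Ct[of "Suc t"] h' by (simp add: nn_integral_return)
    ultimately have "(\<integral>\<^sup>+\<omega>. C (\<omega> t) \<partial>IT.C (Suc t) n (h(t := z))) = C z" by simp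
    then show "(\<integral>\<^sup>+\<omega>. ?f \<omega> \<partial>IT.C (Suc t) n (h(t := z))) = C z + \<beta> * cost_to_go n (Suc t) (h(t := z))"
      unfolding split cost_to_go_def using Ct[of "Suc t + n"] g
      by (subst nn_integral_add) (auto simp: nn_integral_cmult measurable_cong_sets[OF sets refl])
  qed
  finally show ?thesis .
qed

lemma state_law_Suc: "state_law (Suc t) (h(t := z)) = q z"
  by (simp add: state_law_def)

lemma cost_to_go_Suc':
  assumes h: "h \<in> space (H t)"
  shows "cost_to_go (Suc n) t h =
    (\<integral>\<^sup>+x. (\<integral>\<^sup>+a. C (x, a) + \<beta> * cost_to_go n (Suc t) (h(t := (x, a))) \<partial>\<pi> t (h, x)) \<partial>state_law t h)"
  unfolding cost_to_go_Suc[OF h]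
proof (rule nn_integral_step_kernel[OF h])
  show "(\<lambda>z. C z + \<beta> * cost_to_go n (Suc t) (h(t := z))) \<in> borel_measurable S"
    using measurable_compose[OF fun_upd_measurable[OF h] cost_to_go_measurable[of n "Suc t"]]
    by measurable
qed

text \<open>A family \<open>W\<close> of subsolutions of the optimality equation bounds the cost of every policy, whatever the
policy remembers, because the recursion for the cost depends on the history only through the law
of the current state and the choice of the action.\<close>

lemma cost_to_go_lower_bound:
  assumes W0: "W 0 = (\<lambda>_. 0)"
    and W: "\<And>n x a. x \<in> X \<Longrightarrow> a \<in> A \<Longrightarrow> W (Suc n) x \<le> C (x, a) + \<beta> * (\<integral>\<^sup>+y. W n y \<partial>q (x, a))"
    and h: "h \<in> space (H t)"
  shows "(\<integral>\<^sup>+x. W n x \<partial>state_law t h) \<le> cost_to_go n t h"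
  using h
proof (induction n arbitrary: t h)
  case 0
  then show ?case by (simp add: W0)
next
  case (Suc n)
  note h = Suc.prems
  have "(\<integral>\<^sup>+x. W (Suc n) x \<partial>state_law t h) \<le>
      (\<integral>\<^sup>+x. (\<integral>\<^sup>+a. C (x, a) + \<beta> * cost_to_go n (Suc t) (h(t := (x, a))) \<partial>\<pi> t (h, x)) \<partial>state_law t h)"
  proof (rule nn_integral_mono)
    fix x assume "x \<in> space (state_law t h)"
    then have x: "x \<in> X" by (simp add: space_state_law[OF h])
    note p = policy_space[OF h x]
    then interpret prob_space "\<pi> t (h, x)" by (simp add: space_prob_algebra)
    have sp: "space (\<pi> t (h, x)) = A"
      using p by (auto simp: space_prob_algebra space_restrict_space dest: sets_eq_imp_space_eq)
    have "W (Suc n) x = (\<integral>\<^sup>+a. W (Suc n) x \<partial>\<pi> t (h, x))" by (simp add: emeasure_space_1)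
    also have "\<dots> \<le> (\<integral>\<^sup>+a. C (x, a) + \<beta> * cost_to_go n (Suc t) (h(t := (x, a))) \<partial>\<pi> t (h, x))"
    proof (rule nn_integral_mono)
      fix a assume "a \<in> space (\<pi> t (h, x))"
      then have a: "a \<in> A" by (simp add: sp)
      have h': "h(t := (x, a)) \<in> space (H (Suc t))" using fun_upd_in_H[OF h] x a by (simp add: space_S)
      have "W (Suc n) x \<le> C (x, a) + \<beta> * (\<integral>\<^sup>+y. W n y \<partial>q (x, a))" by (rule W[OF x a])
      also have "\<dots> \<le> C (x, a) + \<beta> * cost_to_go n (Suc t) (h(t := (x, a)))"
        using Suc.IH[OF h', unfolded state_law_Suc] by (intro add_left_mono mult_left_mono) (simp_all only: zero_le)
      finally show "W (Suc n) x \<le> C (x, a) + \<beta> * cost_to_go n (Suc t) (h(t := (x, a)))" .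
    qed
    finally show "W (Suc n) x \<le> (\<integral>\<^sup>+a. C (x, a) + \<beta> * cost_to_go n (Suc t) (h(t := (x, a))) \<partial>\<pi> t (h, x))" .
  qed
  then show ?case by (simp only: cost_to_go_Suc'[OF h])
qed

lemma cost_to_go_markov:
  assumes mk: "\<pi> = markov_policy A \<phi>" and \<phi>: "\<And>t. \<phi> t \<in> borel_on X \<rightarrow>\<^sub>M borel_on A"
    and U0: "\<And>t. U t 0 = (\<lambda>_. 0)"
    and U: "\<And>t n x. x \<in> X \<Longrightarrow> U t (Suc n) x = C (x, \<phi> t x) + \<beta> * (\<integral>\<^sup>+y. U (Suc t) n y \<partial>q (x, \<phi> t x))"
    and h: "h \<in> space (H t)"
  shows "cost_to_go n t h = (\<integral>\<^sup>+x. U t n x \<partial>state_law t h)"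
  using h
proof (induction n arbitrary: t h)
  case 0
  then show ?case by (simp add: U0 cost_to_go_0)
next
  case (Suc n)
  note h = Suc.prems
  show ?case
    unfolding cost_to_go_Suc'[OF h]
  proof (rule nn_integral_cong)
    fix x assume "x \<in> space (state_law t h)"
    then have x: "x \<in> X" by (simp add: space_state_law[OF h])
    have a: "\<phi> t x \<in> A" using measurable_space[OF \<phi>] x by (auto simp: space_restrict_space)
    have h': "h(t := (x, \<phi> t x)) \<in> space (H (Suc t))" using fun_upd_in_H[OF h] x a by (simp add: space_S)
    let ?f = "\<lambda>z. C z + \<beta> * cost_to_go n (Suc t) (h(t := z))"
    have f: "?f \<in> borel_measurable S"
      using measurable_compose[OF fun_upd_measurable[OF h] cost_to_go_measurable[of n "Suc t"]]
      by measurable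
    have "(\<lambda>a. ?f (x, a)) \<in> borel_measurable (borel_on A)"
      using x by (intro measurable_compose[OF measurable_Pair1' f]) (simp add: space_restrict_space)
    then have "(\<integral>\<^sup>+a. ?f (x, a) \<partial>\<pi> t (h, x)) = ?f (x, \<phi> t x)"
      unfolding mk markov_policy_def using a by (simp add: nn_integral_return space_restrict_space)
    also have "\<dots> = U t (Suc n) x"
      unfolding U[OF x] Suc.IH[OF h'] state_law_Suc ..
    finally show "(\<integral>\<^sup>+a. C (x, a) + \<beta> * cost_to_go n (Suc t) (h(t := (x, a))) \<partial>\<pi> t (h, x)) = U t (Suc n) x" .
  qed
qed

lemma expected_cost_eq_cost_to_go:
  "(\<integral>\<^sup>+\<omega>. (\<Sum>i<n. \<beta> ^ i * C (\<omega> i)) \<partial>strategic_measure X A q \<pi> x0) = cost_to_go n 0 (\<lambda>_. undefined)"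
proof -
  have "(\<lambda>\<omega>. \<Sum>i<n. \<beta> ^ i * C (\<omega> i)) \<in> borel_measurable (H n)"
    using path_cost_measurable[of 0 n n] by simp
  from nn_integral_strategic_measure[OF this] show ?thesis by (simp add: cost_to_go_def)
qed

lemma nn_integral_state_law_0:
  "f \<in> borel_measurable (borel_on X) \<Longrightarrow> (\<integral>\<^sup>+x. f x \<partial>state_law 0 h) = f x0"
  using x0 by (simp add: state_law_def nn_integral_return space_restrict_space)

lemma undefined_in_H0: "(\<lambda>_. undefined) \<in> space (H 0)"
  by (simp add: space_PiM)

theorem expected_cost_lower_bound:
  assumes "W 0 = (\<lambda>_. 0)"
    and "\<And>n x a. x \<in> X \<Longrightarrow> a \<in> A \<Longrightarrow> W (Suc n) x \<le> C (x, a) + \<beta> * (\<integral>\<^sup>+y. W n y \<partial>q (x, a))"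
    and W: "W n \<in> borel_measurable (borel_on X)"
  shows "W n x0 \<le> (\<integral>\<^sup>+\<omega>. (\<Sum>i<n. \<beta> ^ i * C (\<omega> i)) \<partial>strategic_measure X A q \<pi> x0)"
  using cost_to_go_lower_bound[OF assms(1,2) undefined_in_H0, of n]
  by (simp add: expected_cost_eq_cost_to_go nn_integral_state_law_0[OF W])

theorem expected_cost_markov:
  assumes "\<pi> = markov_policy A \<phi>" and "\<And>t. \<phi> t \<in> borel_on X \<rightarrow>\<^sub>M borel_on A"
    and "\<And>t. U t 0 = (\<lambda>_. 0)"
    and "\<And>t n x. x \<in> X \<Longrightarrow> U t (Suc n) x = C (x, \<phi> t x) + \<beta> * (\<integral>\<^sup>+y. U (Suc t) n y \<partial>q (x, \<phi> t x))"
    and U: "U 0 n \<in> borel_measurable (borel_on X)"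
  shows "(\<integral>\<^sup>+\<omega>. (\<Sum>i<n. \<beta> ^ i * C (\<omega> i)) \<partial>strategic_measure X A q \<pi> x0) = U 0 n x0"
  using cost_to_go_markov[OF assms(1-4) undefined_in_H0, of n]
  by (simp add: expected_cost_eq_cost_to_go nn_integral_state_law_0[OF U])

theorem expected_total_cost:
  "(\<integral>\<^sup>+\<omega>. (\<Sum>i. \<beta> ^ i * C (\<omega> i)) \<partial>strategic_measure X A q \<pi> x0) =
    (SUP n. \<integral>\<^sup>+\<omega>. (\<Sum>i<n. \<beta> ^ i * C (\<omega> i)) \<partial>strategic_measure X A q \<pi> x0)"
proof -
  have m: "(\<lambda>\<omega>. \<beta> ^ i * C (\<omega> i)) \<in> borel_measurable (strategic_measure X A q \<pi> x0)" for i
  proof -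
    have [measurable]: "(\<lambda>\<omega>. C (\<omega> i)) \<in> borel_measurable (PiM UNIV (\<lambda>_. S))"
      using measurable_compose[OF measurable_component_singleton[of i UNIV "\<lambda>_. S"] C_measurable] by simp
    show ?thesis
      unfolding measurable_cong_sets[OF sets_strategic_measure refl] by measurable
  qed
  show ?thesis
    unfolding nn_integral_suminf[OF m] nn_integral_sum[OF m] by (rule suminf_eq_SUP)
qed

end

lemma markov_policy_in_policies:
  assumes \<phi>: "\<And>t. \<phi> t \<in> borel_on X \<rightarrow>\<^sub>M borel_on A"
  shows "markov_policy A \<phi> \<in> policies X A"
  unfolding policies_def markov_policy_def
proof (intro CollectI allI)
  fix t
  have "(\<lambda>p. \<phi> t (snd p)) \<in> Pi\<^sub>M {0..<t} (\<lambda>_. sa_space X A) \<Otimes>\<^sub>M borel_on X \<rightarrow>\<^sub>M borel_on A"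
    by (rule measurable_compose[OF measurable_snd \<phi>])
  from measurable_compose[OF this measurable_return_prob_space]
  show "(\<lambda>(h, x). return (borel_on A) (\<phi> t x)) \<in> Pi\<^sub>M {0..<t} (\<lambda>_. sa_space X A) \<Otimes>\<^sub>M borel_on X \<rightarrow>\<^sub>M prob_algebra (borel_on A)"
    by (simp add: case_prod_unfold)
qed

section \<open>Value iteration and the optimality equation\<close>

lemma measurable_sa_space:
  fixes X :: "'x::second_countable_topology set" and A :: "'a::second_countable_topology set"
  assumes "f \<in> borel_on (X \<times> A) \<rightarrow>\<^sub>M N"
  shows "f \<in> sa_space X A \<rightarrow>\<^sub>M N"
proof -
  have "(\<lambda>p. (fst p, snd p)) \<in> sa_space X A \<rightarrow>\<^sub>M borel \<Otimes>\<^sub>M borel"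
    by (intro measurable_Pair measurable_compose[OF measurable_fst] measurable_compose[OF measurable_snd]
        measurable_restrict_space1) auto
  then have "(\<lambda>p. p) \<in> sa_space X A \<rightarrow>\<^sub>M borel_on (X \<times> A)"
    by (intro measurable_restrict_space2) (auto simp: borel_prod space_pair_measure space_restrict_space)
  from measurable_compose[OF this assms] show ?thesis .
qed

lemma lsc_on_of_seq_lsc_on:
  fixes S :: "'s::first_countable_topology set"
  assumes v: "seq_lsc_on S v" and f: "\<And>s. s \<in> S \<Longrightarrow> f s = enn2ereal (v s)"
  shows "lsc_on S f"
  unfolding lsc_on_def
proof (intro ballI, unfold le_Liminf_iff, intro allI impI)
  fix s y assume s: "s \<in> S" and y: "y < f s"
  show "\<forall>\<^sub>F x in at s within S. y < f x"
  proof (rule sequentially_imp_eventually_within, intro allI impI, elim conjE)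
    fix z assume z: "\<forall>n. z n \<in> S \<and> z n \<noteq> s" "z \<longlonglongrightarrow> s"
    show "\<forall>\<^sub>F n in sequentially. y < f (z n)"
    proof (cases "0 \<le> y")
      case True
      then have y': "enn2ereal (e2ennreal y) = y" by (simp add: enn2ereal_e2ennreal)
      have "e2ennreal y < v s" using y f[OF s] y' by (simp add: less_ennreal.rep_eq)
      also have "v s \<le> liminf (\<lambda>n. v (z n))" using z s by (intro seq_lsc_onD[OF v]) auto
      finally have "\<forall>\<^sub>F n in sequentially. e2ennreal y < v (z n)" by (rule less_LiminfD)
      then show ?thesis
        by eventually_elim (use z f y' in \<open>simp add: less_ennreal.rep_eq\<close>)
    next
      case False
      then have "y < f (z n)" for n using f z(1) enn2ereal_nonneg[of "v (z n)"]
        by (metis less_le_trans not_le)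
      then show ?thesis by simp
    qed
  qed
qed

lemma open_superlevel_of_seq_lsc_on:
  fixes S :: "'s::metric_space set"
  assumes v: "seq_lsc_on S v" and s: "s \<in> S" "r < v s"
  shows "\<exists>V. open V \<and> s \<in> V \<and> (\<forall>s'\<in>V \<inter> S. r < v s')"
proof (rule ccontr)
  assume neg: "\<not> ?thesis"
  have "\<exists>s'\<in>ball s (1 / Suc n) \<inter> S. \<not> r < v s'" for n
  proof (rule ccontr)
    assume "\<not> (\<exists>s'\<in>ball s (1 / Suc n) \<inter> S. \<not> r < v s')"
    then have "open (ball s (1 / Suc n)) \<and> s \<in> ball s (1 / Suc n) \<and> (\<forall>s'\<in>ball s (1 / Suc n) \<inter> S. r < v s')"
      by auto
    then show False using neg by blast
  qed
  then obtain z where z: "\<And>n. z n \<in> ball s (1 / Suc n)" "\<And>n. z n \<in> S" "\<And>n. v (z n) \<le> r"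
    by (simp add: not_less Bex_def) metis
  have "z \<longlonglongrightarrow> s"
  proof (rule metric_tendsto_imp_tendsto[OF LIMSEQ_Suc[OF lim_1_over_n]])
    show "\<forall>\<^sub>F n in sequentially. dist (z n) s \<le> dist (1 / real (Suc n)) 0"
      using z(1) by (auto simp: dist_commute less_imp_le intro!: always_eventually)
  qed
  then have "v s \<le> liminf (\<lambda>n. v (z n))" using s z(2) by (intro seq_lsc_onD[OF v]) auto
  also have "\<dots> \<le> r" using z(3) Liminf_mono[of "\<lambda>n. v (z n)" "\<lambda>_. r" sequentially] by (simp add: Liminf_const)
  finally show False using s(2) by simp
qed

lemma e2ennreal_le_iff: "0 \<le> x \<Longrightarrow> 0 \<le> r \<Longrightarrow> e2ennreal x \<le> ennreal r \<longleftrightarrow> x \<le> ereal r"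
  by (simp add: less_eq_ennreal.rep_eq enn2ereal_e2ennreal)

locale inf_compact_mdp =
  fixes XW :: "'w::polish_space set" and XY :: "'y::polish_space set"
    and X :: "('w \<times> 'y) set" and A :: "'a::polish_space set"
    and q :: "('w \<times> 'y) \<times> 'a \<Rightarrow> ('w \<times> 'y) measure"
    and c :: "('w \<times> 'y) \<times> 'a \<Rightarrow> ereal"
    and \<alpha> :: real
  assumes XW: "XW \<in> sets borel" and XY: "XY \<in> sets borel" and X_eq: "X = XW \<times> XY"
    and A: "A \<in> sets borel" "A \<noteq> {}"
    and q: "q \<in> borel_on (X \<times> A) \<rightarrow>\<^sub>M prob_algebra (borel_on X)"
    and suf: "\<forall>y\<in>XY. semi_uniform_feller XW XY (XW \<times> A) (\<lambda>(w, a). q ((w, y), a))"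
    and c_nonneg: "\<forall>x\<in>X. \<forall>a\<in>A. 0 \<le> c (x, a)"
    and c_inf_compact: "MK_inf_compact XW XY A (\<lambda>(w, y, a). c ((w, y), a))"
    and \<alpha>_nonneg: "0 \<le> \<alpha>"
begin

definition cost :: "('w \<times> 'y) \<times> 'a \<Rightarrow> ennreal" where
  "cost p = e2ennreal (c p)"

text \<open>The function \<open>\<eta>\<close> in \<^typ>\<open>ennreal\<close>, as a function of the state-action pair.\<close>

definition q_value :: "('w \<times> 'y \<Rightarrow> ennreal) \<Rightarrow> ('w \<times> 'y) \<times> 'a \<Rightarrow> ennreal" where
  "q_value u p = cost p + ennreal \<alpha> * (\<integral>\<^sup>+y. u y \<partial>q p)"

definition bellman :: "('w \<times> 'y \<Rightarrow> ennreal) \<Rightarrow> 'w \<times> 'y \<Rightarrow> ennreal" where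
  "bellman u x = (INF a\<in>A. q_value u (x, a))"

text \<open>The class \<open>LW\<close> in \<^typ>\<open>ennreal\<close>, with lower semi-continuity expressed by sequences.\<close>

definition lsc_class :: "('w \<times> 'y \<Rightarrow> ennreal) set" where
  "lsc_class = {u. u \<in> borel_measurable (borel_on X) \<and> (\<forall>y\<in>XY. seq_lsc_on XW (\<lambda>w. u (w, y)))}"

lemma X: "X \<in> sets borel" unfolding X_eq using XW XY by (rule Times_in_borel)

lemma q_space: "x \<in> X \<Longrightarrow> a \<in> A \<Longrightarrow> q (x, a) \<in> space (prob_algebra (borel_on X))"
  using measurable_space[OF q, of "(x, a)"] by (simp add: space_restrict_space)

lemma sets_q: "x \<in> X \<Longrightarrow> a \<in> A \<Longrightarrow> sets (q (x, a)) = sets (borel_on X)"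
  using q_space by (simp add: space_prob_algebra)

lemma space_q: "x \<in> X \<Longrightarrow> a \<in> A \<Longrightarrow> space (q (x, a)) = X"
  using sets_eq_imp_space_eq[OF sets_q] by (simp add: space_restrict_space)

lemma cost_measurable: "cost \<in> borel_measurable (borel_on (X \<times> A))"
proof -
  have m: "(\<lambda>(w, y, a). c ((w, y), a)) \<in> borel_measurable (borel_on (XW \<times> XY \<times> A))"
    using c_inf_compact by (simp add: MK_inf_compact_def)
  have "(\<lambda>p. (fst (fst p), snd (fst p), snd p)) \<in> borel_on (X \<times> A) \<rightarrow>\<^sub>M borel_on (XW \<times> XY \<times> A)"
    unfolding X_eq
    by (intro measurable_restrict_space3 borel_measurable_continuous_onI continuous_intros) auto
  from measurable_compose[OF this m] have "c \<in> borel_measurable (borel_on (X \<times> A))" by simp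
  from measurable_compose[OF this measurable_e2ennreal] show ?thesis by (simp add: cost_def[abs_def])
qed

lemma q_value_measurable:
  assumes "u \<in> borel_measurable (borel_on X)"
  shows "q_value u \<in> borel_measurable (borel_on (X \<times> A))"
proof -
  have [measurable]: "(\<lambda>p. \<integral>\<^sup>+y. u y \<partial>q p) \<in> borel_measurable (borel_on (X \<times> A))"
    using measurable_compose[OF measurable_prob_algebraD[OF q] nn_integral_measurable_subprob_algebra[OF assms]] .
  note cost_measurable [measurable]
  show ?thesis unfolding q_value_def[abs_def] by measurable
qed

lemma q_value_mono:
  assumes "x \<in> X" "a \<in> A" "\<And>y. y \<in> X \<Longrightarrow> u y \<le> v y"
  shows "q_value u (x, a) \<le> q_value v (x, a)"
  unfolding q_value_def using assms
  by (intro add_left_mono mult_left_mono nn_integral_mono) (auto simp: space_q)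

lemma q_value_cong:
  assumes "x \<in> X" "a \<in> A" "\<And>y. y \<in> X \<Longrightarrow> u y = v y"
  shows "q_value u (x, a) = q_value v (x, a)"
  using assms by (intro antisym q_value_mono) auto

lemma q_value_SUP:
  assumes x: "x \<in> X" "a \<in> A" and u: "\<And>n. u n \<in> borel_measurable (borel_on X)"
    and mono: "\<And>n y. y \<in> X \<Longrightarrow> u n y \<le> u (Suc n) y"
  shows "q_value (\<lambda>y. SUP n. u n y) (x, a) = (SUP n. q_value (u n) (x, a))"
proof -
  have um: "u n \<in> borel_measurable (q (x, a))" for n
    using u by (simp add: measurable_cong_sets[OF sets_q[OF x] refl])
  have "(\<integral>\<^sup>+y. (SUP n. u n y) \<partial>q (x, a)) = (SUP n. \<integral>\<^sup>+y. u n y \<partial>q (x, a))"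
    by (rule nn_integral_monotone_convergence_SUP_AE)
      (use um mono in \<open>auto intro!: AE_I2 simp: space_q[OF x]\<close>)
  then show ?thesis
    unfolding q_value_def
    by (simp add: SUP_mult_left_ennreal ennreal_SUP_add_right)
qed

lemma cost_inf_compact:
  assumes y: "y \<in> XY"
  shows "inf_compact_on XW A (\<lambda>(w, a). cost ((w, y), a))"
  unfolding inf_compact_on_def
proof (intro allI impI)
  fix K and r :: ennreal assume K: "compact K" "K \<subseteq> XW" "r < top"
  show "compact {p \<in> K \<times> A. (case p of (w, a) \<Rightarrow> cost ((w, y), a)) \<le> r}"
  proof (cases "K = {}")
    case False
    obtain r' where r': "r = ennreal r'" "0 \<le> r'" using K(3) by (cases r) auto
    have "K_inf_compact XW A (\<lambda>(w, a). c ((w, y), a))"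
      using c_inf_compact y by (simp add: MK_inf_compact_def)
    then have "compact {p \<in> K \<times> A. (case p of (w, a) \<Rightarrow> c ((w, y), a)) \<le> ereal r'}"
      using K False unfolding K_inf_compact_def by blast
    also have "{p \<in> K \<times> A. (case p of (w, a) \<Rightarrow> c ((w, y), a)) \<le> ereal r'} =
        {p \<in> K \<times> A. (case p of (w, a) \<Rightarrow> cost ((w, y), a)) \<le> r}"
    proof (intro Collect_cong conj_cong refl)
      fix p assume "p \<in> K \<times> A"
      then have "0 \<le> c ((fst p, y), snd p)" using K(2) y c_nonneg by (auto simp: X_eq)
      then show "((case p of (w, a) \<Rightarrow> c ((w, y), a)) \<le> ereal r') = ((case p of (w, a) \<Rightarrow> cost ((w, y), a)) \<le> r)"
        using r' by (simp add: case_prod_unfold cost_def e2ennreal_le_iff)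
    qed
    finally show ?thesis .
  qed simp
qed

lemma transition_integral_lsc:
  assumes u: "u \<in> lsc_class" and y: "y \<in> XY"
  shows "seq_lsc_on (XW \<times> A) (\<lambda>(w, a). \<integral>\<^sup>+z. u z \<partial>q ((w, y), a))"
proof -
  interpret semi_uniform_feller_kernel XW XY "XW \<times> A" "\<lambda>(w, a). q ((w, y), a)"
  proof
    show "(case s of (w, a) \<Rightarrow> q ((w, y), a)) \<in> space (prob_algebra (borel_on (XW \<times> XY)))" if "s \<in> XW \<times> A" for s
      using that q_space[of "(fst s, y)" "snd s"] y by (auto simp: X_eq)
  qed (use XW XY suf y in auto)
  have "seq_lsc_on (XW \<times> A) (\<lambda>s. \<integral>\<^sup>+z. u z \<partial>(case s of (w, a) \<Rightarrow> q ((w, y), a)))"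
  proof (rule seq_lsc_on_integral)
    show "u \<in> borel_measurable (borel_on (XW \<times> XY))" using u unfolding X_eq[symmetric] by (simp add: lsc_class_def)
    show "\<exists>V. open V \<and> w \<in> V \<and> (\<forall>w'\<in>V \<inter> XW. r < u (w', y))"
      if "w \<in> XW" "y \<in> XY" "r < u (w, y)" for w y r
      using u that by (intro open_superlevel_of_seq_lsc_on) (auto simp: lsc_class_def)
  qed
  then show ?thesis by (simp add: case_prod_unfold)
qed

lemma q_value_inf_compact:
  assumes u: "u \<in> lsc_class" and y: "y \<in> XY"
  shows "inf_compact_on XW A (\<lambda>(w, a). q_value u ((w, y), a))"
  using inf_compact_on_add[OF cost_inf_compact[OF y] seq_lsc_on_cmult[OF transition_integral_lsc[OF u y], of "ennreal \<alpha>"]]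
  by (simp add: q_value_def case_prod_unfold)

lemma
  assumes u: "u \<in> lsc_class" and x: "x \<in> X"
  shows q_value_level_compact: "r < top \<Longrightarrow> compact {a\<in>A. q_value u (x, a) \<le> r}"
    and bellman_attained: "\<exists>a\<in>A. q_value u (x, a) = bellman u x"
proof -
  obtain w y where wy: "x = (w, y)" "w \<in> XW" "y \<in> XY" using x by (auto simp: X_eq)
  note ic = q_value_inf_compact[OF u wy(3)]
  show "compact {a\<in>A. q_value u (x, a) \<le> r}" if "r < top"
    using compact_level_set[OF ic wy(2) that] by (simp add: wy(1))
  show "\<exists>a\<in>A. q_value u (x, a) = bellman u x"
    using inf_compact_on_min_attained[OF ic wy(2) A(2)] by (simp add: wy(1) bellman_def)
qed

lemma bellman_le: "a \<in> A \<Longrightarrow> bellman u x \<le> q_value u (x, a)"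
  unfolding bellman_def by (rule INF_lower)

lemma bellman_lsc_class:
  assumes u: "u \<in> lsc_class"
  shows "bellman u \<in> lsc_class"
proof -
  have um: "q_value u \<in> borel_measurable (borel_on (X \<times> A))"
    using u by (intro q_value_measurable) (simp add: lsc_class_def)
  have "(\<lambda>x. INF a\<in>A. q_value u (x, a)) \<in> borel_measurable (borel_on X)"
    by (rule borel_measurable_min[OF X A(1) um])
      (use q_value_level_compact[OF u] bellman_attained[OF u] in \<open>auto simp: bellman_def\<close>)
  moreover have "seq_lsc_on XW (\<lambda>w. bellman u (w, y))" if y: "y \<in> XY" for y
    using seq_lsc_on_min[OF q_value_inf_compact[OF u y] A(2)] by (simp add: bellman_def)
  ultimately show ?thesis by (simp add: lsc_class_def bellman_def[abs_def])
qed

lemma bellman_selector: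
  assumes u: "u \<in> lsc_class"
  shows "\<exists>\<phi>\<in>borel_on X \<rightarrow>\<^sub>M borel_on A. \<forall>x\<in>X. q_value u (x, \<phi> x) = bellman u x"
proof -
  have um: "q_value u \<in> borel_measurable (borel_on (X \<times> A))"
    using u by (intro q_value_measurable) (simp add: lsc_class_def)
  show ?thesis
    unfolding bellman_def
    by (rule borel_argmin_selector[OF X A um])
      (use q_value_level_compact[OF u] bellman_attained[OF u] in \<open>auto simp: bellman_def\<close>)
qed

primrec V :: "nat \<Rightarrow> 'w \<times> 'y \<Rightarrow> ennreal" where
  "V 0 = (\<lambda>_. 0)"
| "V (Suc n) = bellman (V n)"

definition Vinf :: "'w \<times> 'y \<Rightarrow> ennreal" where
  "Vinf x = (SUP n. V n x)"

lemma V_lsc_class: "V n \<in> lsc_class"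
proof (induction n)
  case 0
  show ?case by (auto simp: lsc_class_def intro!: seq_lsc_onI)
qed (simp add: bellman_lsc_class)

lemma V_measurable: "V n \<in> borel_measurable (borel_on X)"
  using V_lsc_class by (simp add: lsc_class_def)

lemma V_mono: "x \<in> X \<Longrightarrow> V n x \<le> V (Suc n) x"
proof (induction n arbitrary: x)
  case (Suc n)
  then have "q_value (V n) (x, a) \<le> q_value (V (Suc n)) (x, a)" if "a \<in> A" for a
    using that by (intro q_value_mono) auto
  then show ?case by (auto simp: bellman_def intro!: INF_mono)
qed simp

lemma Vinf_lsc_class: "Vinf \<in> lsc_class"
proof -
  have "Vinf \<in> borel_measurable (borel_on X)"
    unfolding Vinf_def[abs_def] by (intro borel_measurable_SUP V_measurable) auto
  moreover have "seq_lsc_on XW (\<lambda>w. Vinf (w, y))" if "y \<in> XY" for y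
    unfolding Vinf_def using V_lsc_class that by (intro seq_lsc_on_SUP) (auto simp: lsc_class_def)
  ultimately show ?thesis by (simp add: lsc_class_def)
qed

text \<open>The nontrivial half of the optimality equation: the compact sets of actions with
\<open>q_value (V n) (x, a) \<le> Vinf x\<close> decrease in \<open>n\<close> and are nonempty, since they contain the minimizers for \<open>V n\<close>. A
common point of them attains the value \<open>Vinf x\<close>.\<close>

lemma bellman_Vinf:
  assumes x: "x \<in> X"
  shows "bellman Vinf x = Vinf x"
proof (rule antisym)
  have qV: "q_value Vinf (x, a) = (SUP n. q_value (V n) (x, a))" if "a \<in> A" for a
    unfolding Vinf_def[abs_def] by (rule q_value_SUP[where u=V, OF x that V_measurable V_mono])
  show "Vinf x \<le> bellman Vinf x"
    unfolding bellman_def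
  proof (rule INF_greatest)
    fix a assume a: "a \<in> A"
    show "Vinf x \<le> q_value Vinf (x, a)"
      unfolding Vinf_def[of x] qV[OF a]
    proof (rule SUP_least)
      fix n
      have "V n x \<le> V (Suc n) x" by (rule V_mono[OF x])
      also have "\<dots> \<le> q_value (V n) (x, a)" using a by (simp add: bellman_le)
      also have "\<dots> \<le> (SUP n. q_value (V n) (x, a))" by (rule SUP_upper) simp
      finally show "V n x \<le> (SUP n. q_value (V n) (x, a))" .
    qed
  qed
  show "bellman Vinf x \<le> Vinf x"
  proof (cases "Vinf x < top")
    case False
    then have "Vinf x = top" by (metis top.not_eq_extremum)
    then show ?thesis by simp
  next
    case True
    obtain w y where wy: "x = (w, y)" "w \<in> XW" "y \<in> XY" using x by (auto simp: X_eq)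
    have "\<exists>a\<in>A. \<forall>n. (case (w, a) of (w, a) \<Rightarrow> q_value (V n) ((w, y), a)) \<le> Vinf x"
    proof (rule common_point_of_level_sets[where r="\<lambda>_. Vinf x", OF q_value_inf_compact[OF V_lsc_class wy(3)] wy(2) True])
      fix n
      obtain a where a: "a \<in> A" "q_value (V n) (x, a) = V (Suc n) x" using bellman_attained[OF V_lsc_class x, of n] by auto
      then have "q_value (V n) (x, a) \<le> Vinf x" unfolding Vinf_def by (auto intro: SUP_upper2[of "Suc n"])
      then show "\<exists>a\<in>A. (case (w, a) of (w, a) \<Rightarrow> q_value (V n) ((w, y), a)) \<le> Vinf x"
        using a(1) by (auto simp: wy(1))
    next
      fix m n a assume mn: "m \<le> (n::nat)" "a \<in> A" "(case (w, a) of (w, a) \<Rightarrow> q_value (V n) ((w, y), a)) \<le> Vinf x"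
      have "V m z \<le> V n z" if "z \<in> X" for z
        using mn(1) V_mono[OF that] by (rule lift_Suc_mono_le[rotated])
      then have "q_value (V m) (x, a) \<le> q_value (V n) (x, a)" using x mn(2) by (intro q_value_mono)
      then show "(case (w, a) of (w, a) \<Rightarrow> q_value (V m) ((w, y), a)) \<le> Vinf x"
        using mn(3) by (simp add: wy(1))
    qed
    then obtain a where a: "a \<in> A" "\<And>n. q_value (V n) (x, a) \<le> Vinf x" by (auto simp: wy(1))
    have "bellman Vinf x \<le> q_value Vinf (x, a)" using a(1) by (rule bellman_le)
    also have "\<dots> \<le> Vinf x" unfolding qV[OF a(1)] using a(2) by (intro SUP_least)
    finally show ?thesis .
  qed
qed

section \<open>Optimality of policies\<close>

definition exp_cost :: "nat \<Rightarrow> ('w \<times> 'y, 'a) policy \<Rightarrow> 'w \<times> 'y \<Rightarrow> ennreal" where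
  "exp_cost T \<pi> x = (\<integral>\<^sup>+\<omega>. (\<Sum>i<T. ennreal \<alpha> ^ i * cost (\<omega> i)) \<partial>strategic_measure X A q \<pi> x)"

lemma controlled_processI:
  assumes "\<pi> \<in> policies X A" "x \<in> X"
  shows "controlled_process X A q \<pi> x cost"
  using assms measurable_sa_space[OF q] measurable_sa_space[OF cost_measurable]
  by (intro controlled_process.intro)

lemma cost_term: "0 \<le> c p \<Longrightarrow> ereal (\<alpha> ^ t) * c p = enn2ereal (ennreal \<alpha> ^ t * cost p)"
  using \<alpha>_nonneg
  by (simp add: cost_def times_ennreal.rep_eq enn2ereal_e2ennreal ennreal_power)

lemma c_nonneg_path:
  assumes "\<pi> \<in> policies X A" "x \<in> X" "\<omega> \<in> space (strategic_measure X A q \<pi> x)"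
  shows "0 \<le> c (\<omega> t)"
proof -
  interpret controlled_process X A q \<pi> x cost "ennreal \<alpha>" by (rule controlled_processI[OF assms(1,2)])
  have "\<omega> t \<in> X \<times> A"
    using assms(3) sets_eq_imp_space_eq[OF sets_strategic_measure] by (auto simp: space_PiM PiE_iff space_S)
  then show ?thesis using c_nonneg by auto
qed

lemma policy_value_eq:
  assumes "\<pi> \<in> policies X A" "x \<in> X"
  shows "policy_value X A q c \<alpha> T \<pi> x = enn2ereal (exp_cost T \<pi> x)"
  unfolding policy_value_def ext_integral_def exp_cost_def
  by (intro arg_cong[where f=enn2ereal] nn_integral_cong)
    (simp add: cost_term c_nonneg_path[OF assms])

lemma policy_value_inf_eq:
  assumes "\<pi> \<in> policies X A" "x \<in> X"
  shows "policy_value_inf X A q c \<alpha> \<pi> x = enn2ereal (SUP T. exp_cost T \<pi> x)"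
proof -
  interpret controlled_process X A q \<pi> x cost "ennreal \<alpha>" by (rule controlled_processI[OF assms])
  show ?thesis
    unfolding policy_value_inf_def ext_integral_def exp_cost_def expected_total_cost[symmetric]
    by (intro arg_cong[where f=enn2ereal] nn_integral_cong)
      (simp add: cost_term c_nonneg_path[OF assms])
qed

lemma V_le_value:
  assumes "\<pi> \<in> policies X A" "x \<in> X"
  shows "V n x \<le> exp_cost n \<pi> x"
proof -
  interpret controlled_process X A q \<pi> x cost "ennreal \<alpha>" by (rule controlled_processI[OF assms])
  show ?thesis
    unfolding exp_cost_def
    by (rule expected_cost_lower_bound[of V n])
      (auto simp: V_measurable bellman_def q_value_def intro: INF_lower2)
qed

text \<open>Backward induction from the horizon: at time \<open>t\<close> there are \<open>T - t\<close> steps left, so the optimal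
action is a minimizer for \<open>V (T - 1 - t)\<close>.\<close>

lemma markov_value:
  assumes \<phi>: "\<And>t. \<phi> t \<in> borel_on X \<rightarrow>\<^sub>M borel_on A" and x: "x \<in> X"
    and opt: "\<And>t x. t < T \<Longrightarrow> x \<in> X \<Longrightarrow> q_value (V t) (x, \<phi> (T - 1 - t) x) = V (Suc t) x"
  shows "exp_cost T (markov_policy A \<phi>) x = V T x"
proof -
  interpret controlled_process X A q "markov_policy A \<phi>" x cost "ennreal \<alpha>"
    by (rule controlled_processI[OF markov_policy_in_policies[OF \<phi>] x])
  define U where "U = (\<lambda>t n. rec_nat (\<lambda>t x. 0) (\<lambda>n g t x. q_value (g (Suc t)) (x, \<phi> t x)) n t)"
  have U0: "U t 0 = (\<lambda>_. 0)" for t by (simp add: U_def)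
  have U: "U t (Suc n) x = q_value (U (Suc t) n) (x, \<phi> t x)" for t n x by (simp add: U_def)
  have UV: "U t n x = V n x" if "t + n = T" "x \<in> X" for t n x
    using that
  proof (induction n arbitrary: t x)
    case (Suc n)
    have t: "t = T - 1 - n" "n < T" using Suc.prems by auto
    have "\<phi> t x \<in> A" using measurable_space[OF \<phi>] Suc.prems by (auto simp: space_restrict_space)
    then have "U t (Suc n) x = q_value (V n) (x, \<phi> t x)"
      unfolding U using Suc by (intro q_value_cong) auto
    also have "\<dots> = V (Suc n) x" unfolding t(1) by (rule opt[OF t(2) Suc.prems(2)])
    finally show ?case .
  qed (simp add: U0)
  have "U 0 T \<in> borel_measurable (borel_on X)"
    using V_measurable[of T] by (rule measurable_cong[THEN iffD2, rotated]) (simp add: UV space_restrict_space)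
  from expected_cost_markov[OF refl \<phi> U0 U[unfolded q_value_def] this]
  show ?thesis by (simp add: exp_cost_def UV x)
qed

lemma opt_value_eq:
  assumes x: "x \<in> X"
  shows "opt_value X A q c \<alpha> T x = enn2ereal (V T x)"
proof (rule antisym)
  have "\<exists>\<phi>. \<phi> \<in> borel_on X \<rightarrow>\<^sub>M borel_on A \<and> (\<forall>x\<in>X. q_value (V n) (x, \<phi> x) = V (Suc n) x)" for n
    using bellman_selector[OF V_lsc_class[of n]] by auto
  then obtain \<phi> where \<phi>: "\<And>n. \<phi> n \<in> borel_on X \<rightarrow>\<^sub>M borel_on A"
    "\<And>n x. x \<in> X \<Longrightarrow> q_value (V n) (x, \<phi> n x) = V (Suc n) x" by metis
  let ?\<pi> = "markov_policy A (\<lambda>t. \<phi> (T - 1 - t))"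
  have pol: "?\<pi> \<in> policies X A" using \<phi>(1) by (rule markov_policy_in_policies)
  have "exp_cost T ?\<pi> x = V T x" by (rule markov_value) (use \<phi> x in auto)
  then show "opt_value X A q c \<alpha> T x \<le> enn2ereal (V T x)"
    unfolding opt_value_def using policy_value_eq[OF pol x, of T] by (intro INF_lower2[OF pol]) simp
  show "enn2ereal (V T x) \<le> opt_value X A q c \<alpha> T x"
    unfolding opt_value_def
    by (rule INF_greatest) (simp add: policy_value_eq x V_le_value less_eq_ennreal.rep_eq[symmetric])
qed

text \<open>The cost of the stationary policy \<open>\<phi>\<close> over \<open>n\<close> steps.\<close>

primrec U :: "('w \<times> 'y \<Rightarrow> 'a) \<Rightarrow> nat \<Rightarrow> 'w \<times> 'y \<Rightarrow> ennreal" where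
  "U \<phi> 0 = (\<lambda>_. 0)"
| "U \<phi> (Suc n) = (\<lambda>x. q_value (U \<phi> n) (x, \<phi> x))"

definition Uinf :: "('w \<times> 'y \<Rightarrow> 'a) \<Rightarrow> 'w \<times> 'y \<Rightarrow> ennreal" where
  "Uinf \<phi> x = (SUP n. U \<phi> n x)"

context
  fixes \<phi> assumes \<phi>: "\<phi> \<in> borel_on X \<rightarrow>\<^sub>M borel_on A"
begin

lemma action_in_A: "x \<in> X \<Longrightarrow> \<phi> x \<in> A"
  using measurable_space[OF \<phi>] by (simp add: space_restrict_space)

lemma stationary_in_policies: "stationary_policy A \<phi> \<in> policies X A"
  unfolding stationary_policy_def using \<phi> by (intro markov_policy_in_policies)

lemma U_measurable: "U \<phi> n \<in> borel_measurable (borel_on X)"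
proof (induction n)
  case (Suc n)
  have "(\<lambda>x. (x, \<phi> x)) \<in> borel_on X \<rightarrow>\<^sub>M sa_space X A" using \<phi> by measurable
  from measurable_compose[OF this measurable_sa_space[OF q_value_measurable[OF Suc]]]
  show ?case by simp
qed simp

lemma U_mono: "x \<in> X \<Longrightarrow> U \<phi> n x \<le> U \<phi> (Suc n) x"
proof (induction n arbitrary: x)
  case (Suc n)
  then show ?case by (simp del: U.simps(2) add: U.simps(2)[of \<phi> n] U.simps(2)[of \<phi> "Suc n"] q_value_mono action_in_A)
qed simp

lemma stationary_value:
  assumes x: "x \<in> X"
  shows "exp_cost n (stationary_policy A \<phi>) x = U \<phi> n x"
proof -
  interpret controlled_process X A q "stationary_policy A \<phi>" x cost "ennreal \<alpha>"
    by (rule controlled_processI[OF stationary_in_policies x])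
  show ?thesis
    unfolding exp_cost_def
    by (rule expected_cost_markov[where \<phi>="\<lambda>_. \<phi>" and U="\<lambda>_. U \<phi>"])
      (auto simp: stationary_policy_def \<phi> U_measurable q_value_def)
qed

lemma Uinf_fixed_point:
  assumes x: "x \<in> X"
  shows "q_value (Uinf \<phi>) (x, \<phi> x) = Uinf \<phi> x"
proof -
  have "q_value (Uinf \<phi>) (x, \<phi> x) = (SUP n. U \<phi> (Suc n) x)"
    unfolding Uinf_def[abs_def] using q_value_SUP[where u="U \<phi>", OF x action_in_A[OF x] U_measurable U_mono] by simp
  also have "\<dots> = Uinf \<phi> x"
    unfolding Uinf_def
  proof (rule antisym)
    show "(SUP n. U \<phi> (Suc n) x) \<le> (SUP n. U \<phi> n x)" by (intro SUP_least SUP_upper) simp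
    show "(SUP n. U \<phi> n x) \<le> (SUP n. U \<phi> (Suc n) x)" by (rule SUP_mono) (use U_mono[OF x] in blast)
  qed
  finally show ?thesis .
qed

lemma stationary_policy_value_inf:
  "x \<in> X \<Longrightarrow> policy_value_inf X A q c \<alpha> (stationary_policy A \<phi>) x = enn2ereal (Uinf \<phi> x)"
  by (simp add: policy_value_inf_eq[OF stationary_in_policies] stationary_value Uinf_def)

lemma Uinf_le_Vinf:
  assumes opt: "\<And>x. x \<in> X \<Longrightarrow> q_value Vinf (x, \<phi> x) = Vinf x" and x: "x \<in> X"
  shows "Uinf \<phi> x \<le> Vinf x"
proof -
  have "U \<phi> n x \<le> Vinf x" if "x \<in> X" for n x
    using that
  proof (induction n arbitrary: x)
    case (Suc n)
    then have "U \<phi> (Suc n) x \<le> q_value Vinf (x, \<phi> x)" by (simp add: q_value_mono action_in_A)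
    then show ?case using opt Suc by simp
  qed simp
  then show ?thesis unfolding Uinf_def using x by (intro SUP_least)
qed

end

lemma Vinf_le_policy_value_inf:
  assumes "\<pi> \<in> policies X A" "x \<in> X"
  shows "enn2ereal (Vinf x) \<le> policy_value_inf X A q c \<alpha> \<pi> x"
  unfolding policy_value_inf_eq[OF assms] less_eq_ennreal.rep_eq[symmetric] Vinf_def
  using V_le_value[OF assms] by (intro SUP_mono) blast

lemma Vinf_selector:
  "\<exists>\<phi>\<in>borel_on X \<rightarrow>\<^sub>M borel_on A. \<forall>x\<in>X. q_value Vinf (x, \<phi> x) = Vinf x"
  using bellman_selector[OF Vinf_lsc_class] by (simp add: bellman_Vinf)

lemma opt_value_inf_eq:
  assumes x: "x \<in> X"
  shows "opt_value_inf X A q c \<alpha> x = enn2ereal (Vinf x)"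
proof (rule antisym)
  obtain \<phi> where \<phi>: "\<phi> \<in> borel_on X \<rightarrow>\<^sub>M borel_on A" "\<forall>x\<in>X. q_value Vinf (x, \<phi> x) = Vinf x"
    using Vinf_selector by (rule bexE)
  show "opt_value_inf X A q c \<alpha> x \<le> enn2ereal (Vinf x)"
    unfolding opt_value_inf_def
    by (rule INF_lower2[OF stationary_in_policies[OF \<phi>(1)]])
      (simp add: stationary_policy_value_inf[OF \<phi>(1) x] Uinf_le_Vinf[OF \<phi>(1) bspec[OF \<phi>(2)] x] less_eq_ennreal.rep_eq[symmetric])
  show "enn2ereal (Vinf x) \<le> opt_value_inf X A q c \<alpha> x"
    unfolding opt_value_inf_def by (intro INF_greatest Vinf_le_policy_value_inf x)
qed

text \<open>The cost \<open>Uinf \<phi>\<close> of the policy satisfies the equation for \<open>\<phi>\<close>. If it equals \<open>Vinf\<close>, then \<open>Vinf\<close> satisfies that equation too.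
Conversely, if \<open>Vinf\<close> satisfies it, then iterating from \<open>0\<close> never exceeds \<open>Vinf\<close>.\<close>

lemma stationary_discount_optimal_iff:
  assumes \<phi>: "\<phi> \<in> borel_on X \<rightarrow>\<^sub>M borel_on A"
  shows "discount_optimal X A q c \<alpha> (stationary_policy A \<phi>) \<longleftrightarrow> (\<forall>x\<in>X. q_value Vinf (x, \<phi> x) = Vinf x)"
proof -
  have "discount_optimal X A q c \<alpha> (stationary_policy A \<phi>) \<longleftrightarrow> (\<forall>x\<in>X. Uinf \<phi> x = Vinf x)"
    using stationary_in_policies[OF \<phi>]
    by (auto simp: discount_optimal_def stationary_policy_value_inf[OF \<phi>] opt_value_inf_eq enn2ereal_inject)
  also have "\<dots> \<longleftrightarrow> (\<forall>x\<in>X. q_value Vinf (x, \<phi> x) = Vinf x)"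
  proof
    assume eq: "\<forall>x\<in>X. Uinf \<phi> x = Vinf x"
    show "\<forall>x\<in>X. q_value Vinf (x, \<phi> x) = Vinf x"
    proof
      fix x assume x: "x \<in> X"
      have "q_value Vinf (x, \<phi> x) = q_value (Uinf \<phi>) (x, \<phi> x)"
        using eq x action_in_A[OF \<phi>] by (intro q_value_cong) auto
      then show "q_value Vinf (x, \<phi> x) = Vinf x" using Uinf_fixed_point[OF \<phi> x] eq x by simp
    qed
  next
    assume opt: "\<forall>x\<in>X. q_value Vinf (x, \<phi> x) = Vinf x"
    show "\<forall>x\<in>X. Uinf \<phi> x = Vinf x"
    proof
      fix x assume x: "x \<in> X"
      have "Vinf x \<le> Uinf \<phi> x"
        using Vinf_le_policy_value_inf[OF stationary_in_policies[OF \<phi>] x]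
        by (simp add: stationary_policy_value_inf[OF \<phi> x] less_eq_ennreal.rep_eq)
      then show "Uinf \<phi> x = Vinf x" using Uinf_le_Vinf[OF \<phi> _ x] opt by (intro antisym) auto
    qed
  qed
  finally show ?thesis .
qed

section \<open>Translation to extended real values\<close>

lemma eta_eq:
  assumes f: "\<And>y. y \<in> X \<Longrightarrow> f y = enn2ereal (v y)" and x: "x \<in> X" "a \<in> A"
  shows "eta q c \<alpha> f x a = enn2ereal (q_value v (x, a))"
proof -
  have "(\<integral>\<^sup>+z. e2ennreal (f z) \<partial>q (x, a)) = (\<integral>\<^sup>+z. v z \<partial>q (x, a))"
    by (intro nn_integral_cong) (simp add: space_q[OF x] f)
  then show ?thesis
    using c_nonneg x \<alpha>_nonneg
    by (simp add: eta_def ext_integral_def q_value_def cost_def plus_ennreal.rep_eq times_ennreal.rep_eq enn2ereal_e2ennreal)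
qed

lemma LW_I:
  assumes v: "v \<in> lsc_class" and f: "\<And>x. x \<in> X \<Longrightarrow> f x = enn2ereal (v x)"
  shows "f \<in> LW XW XY"
proof -
  have "(\<lambda>x. enn2ereal (v x)) \<in> borel_measurable (borel_on X)"
    using v by (intro measurable_compose[OF _ measurable_enn2ereal]) (simp add: lsc_class_def)
  then have "f \<in> borel_measurable (borel_on X)"
    by (rule measurable_cong[THEN iffD2, rotated]) (simp add: f space_restrict_space)
  moreover have "lsc_on XW (\<lambda>w. f (w, y))" if "y \<in> XY" for y
  proof (rule lsc_on_of_seq_lsc_on)
    show "seq_lsc_on XW (\<lambda>w. v (w, y))" using v that by (simp add: lsc_class_def)
    show "f (w, y) = enn2ereal (v (w, y))" if "w \<in> XW" for w using f \<open>y \<in> XY\<close> that by (simp add: X_eq)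
  qed
  ultimately show ?thesis using f by (auto simp: LW_def X_eq)
qed

text \<open>The optimality equation and the properties of the sets of optimal actions have the same form for
finite and infinite horizon: \<open>g\<close> is the value obtained from the continuation value \<open>f\<close>, with
\<open>g = f\<close> in the infinite case.\<close>

lemma one_step:
  assumes v: "v \<in> lsc_class" and f_eq: "\<forall>x\<in>X. f x = enn2ereal (v x)"
    and g_eq: "\<forall>x\<in>X. g x = enn2ereal (bellman v x)"
    and F: "\<And>x. F x = {a\<in>A. g x = eta q c \<alpha> f x a}"
  shows "x \<in> X \<Longrightarrow> a \<in> F x \<longleftrightarrow> a \<in> A \<and> q_value v (x, a) = bellman v x"
    and "\<forall>x\<in>X. is_min_over A (eta q c \<alpha> f x) (g x)"
    and "\<forall>x\<in>X. F x \<noteq> {}"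
    and "graph_on X F \<in> sets (borel_on (X \<times> A))"
    and "\<forall>x\<in>X. (g x = \<infinity> \<longrightarrow> F x = A) \<and> (g x < \<infinity> \<longrightarrow> compact (F x))"
proof -
  note f = f_eq[rule_format] and g = g_eq[rule_format]
  show mem: "a \<in> F x \<longleftrightarrow> a \<in> A \<and> q_value v (x, a) = bellman v x" if "x \<in> X" for x a
    using that by (auto simp: F g eta_eq[of f v] f enn2ereal_inject)
  show "\<forall>x\<in>X. is_min_over A (eta q c \<alpha> f x) (g x)"
  proof
    fix x assume x: "x \<in> X"
    obtain a where a: "a \<in> A" "q_value v (x, a) = bellman v x" using bellman_attained[OF v x] by blast
    then have "g x = eta q c \<alpha> f x a" using x by (simp add: g eta_eq[of f v] f)
    moreover have "g x \<le> eta q c \<alpha> f x a" if "a \<in> A" for a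
      using x that
      by (simp add: g eta_eq[of f v] f less_eq_ennreal.rep_eq[symmetric] bellman_le)
    ultimately show "is_min_over A (eta q c \<alpha> f x) (g x)" using a(1) by (auto simp: is_min_over_def)
  qed
  show "\<forall>x\<in>X. F x \<noteq> {}"
  proof
    fix x assume x: "x \<in> X"
    obtain a where "a \<in> A" "q_value v (x, a) = bellman v x" using bellman_attained[OF v x] by (rule bexE)
    then have "a \<in> F x" using mem[OF x] by simp
    then show "F x \<noteq> {}" by auto
  qed
  have "graph_on X F = {p \<in> X \<times> A. q_value v p = bellman v (fst p)}"
    using mem by (auto simp: graph_on_def)
  then show "graph_on X F \<in> sets (borel_on (X \<times> A))"
    using v bellman_lsc_class[OF v]
    by (simp add: argmin_graph_in_borel[OF q_value_measurable] lsc_class_def)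
  show "\<forall>x\<in>X. (g x = \<infinity> \<longrightarrow> F x = A) \<and> (g x < \<infinity> \<longrightarrow> compact (F x))"
  proof (intro ballI conjI impI)
    fix x assume x: "x \<in> X"
    { assume "g x = \<infinity>"
      then have "bellman v x = top" by (simp add: g[OF x])
      then have "q_value v (x, a) = bellman v x" if "a \<in> A" for a
        using bellman_le[OF that, of v x] by (simp add: top_unique)
      then show "F x = A" using mem[OF x] by blast }
    { assume "g x < \<infinity>"
      then have fin: "bellman v x < top" by (metis g[OF x] enn2ereal_eq_top_iff less_irrefl top.not_eq_extremum)
      have "F x = {a\<in>A. q_value v (x, a) \<le> bellman v x}"
        using mem[OF x] by (auto intro: antisym bellman_le)
      then show "compact (F x)" using q_value_level_compact[OF v x fin] by simp }
  qed
qed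

end

theorem theorem5p3:
  fixes XW :: "'w::polish_space set" and XY :: "'y::polish_space set"
    and X :: "('w \<times> 'y) set" and A :: "'a::polish_space set"
    and q :: "('w \<times> 'y) \<times> 'a \<Rightarrow> ('w \<times> 'y) measure"
    and c :: "('w \<times> 'y) \<times> 'a \<Rightarrow> ereal"
    and \<alpha> :: real
  assumes "XW \<in> sets borel" and "XY \<in> sets borel" and "X = XW \<times> XY"
    and "A \<in> sets borel" and "A \<noteq> {}"
    and "q \<in> borel_on (X \<times> A) \<rightarrow>\<^sub>M prob_algebra (borel_on X)"
    and "\<forall>y\<in>XY. semi_uniform_feller XW XY (XW \<times> A) (\<lambda>(w, a). q ((w, y), a))"
    and "\<forall>x\<in>X. \<forall>a\<in>A. 0 \<le> c (x, a)"
    and "MK_inf_compact XW XY A (\<lambda>(w, y, a). c ((w, y), a))"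
    and "0 \<le> \<alpha>"
  shows
    "\<comment> \<open>(i)\<close>
     ((\<forall>t. opt_value X A q c \<alpha> t \<in> LW XW XY) \<and> opt_value_inf X A q c \<alpha> \<in> LW XW XY \<and>
     (\<forall>x\<in>X. incseq (\<lambda>t. opt_value X A q c \<alpha> t x) \<and>
        (\<lambda>t. opt_value X A q c \<alpha> t x) \<longlonglongrightarrow> opt_value_inf X A q c \<alpha> x)) \<and>

     \<comment> \<open>(ii)\<close>
     ((\<forall>x\<in>X. opt_value X A q c \<alpha> 0 x = 0) \<and>
     (\<forall>t. (\<forall>x\<in>X. is_min_over A (eta q c \<alpha> (opt_value X A q c \<alpha> t) x)
                   (opt_value X A q c \<alpha> (t + 1) x)) \<and>
       (\<forall>x\<in>X. opt_actions X A q c \<alpha> t x \<noteq> {}) \<and>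
       graph_on X (opt_actions X A q c \<alpha> t) \<in> sets (borel_on (X \<times> A)) \<and>
       (\<forall>x\<in>X. (opt_value X A q c \<alpha> (t + 1) x = \<infinity> \<longrightarrow> opt_actions X A q c \<alpha> t x = A) \<and>
               (opt_value X A q c \<alpha> (t + 1) x < \<infinity> \<longrightarrow> compact (opt_actions X A q c \<alpha> t x))))) \<and>

     \<comment> \<open>(iii)\<close>
     (\<forall>T\<ge>1.
       (\<exists>\<phi>. (\<forall>t<T. \<phi> t \<in> borel_on X \<rightarrow>\<^sub>M borel_on A) \<and>
            horizon_optimal X A q c \<alpha> T (horizon_markov_policy A T \<phi>)) \<and>
       (\<forall>\<phi>. (\<forall>t<T. \<phi> t \<in> borel_on X \<rightarrow>\<^sub>M borel_on A) \<longrightarrow>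
            (\<forall>t<T. \<forall>x\<in>X. \<phi> (T - 1 - t) x \<in> opt_actions X A q c \<alpha> t x) \<longrightarrow>
            horizon_optimal X A q c \<alpha> T (horizon_markov_policy A T \<phi>))) \<and>

     \<comment> \<open>(iv)\<close>
     ((\<forall>x\<in>X. is_min_over A (eta q c \<alpha> (opt_value_inf X A q c \<alpha>) x) (opt_value_inf X A q c \<alpha> x)) \<and>
     (\<forall>x\<in>X. opt_actions_inf X A q c \<alpha> x \<noteq> {}) \<and>
     graph_on X (opt_actions_inf X A q c \<alpha>) \<in> sets (borel_on (X \<times> A)) \<and>
     (\<forall>x\<in>X. (opt_value_inf X A q c \<alpha> x = \<infinity> \<longrightarrow> opt_actions_inf X A q c \<alpha> x = A) \<and>
             (opt_value_inf X A q c \<alpha> x < \<infinity> \<longrightarrow> compact (opt_actions_inf X A q c \<alpha> x)))) \<and>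

     \<comment> \<open>(v)\<close>
     ((\<exists>\<phi>. \<phi> \<in> borel_on X \<rightarrow>\<^sub>M borel_on A \<and> discount_optimal X A q c \<alpha> (stationary_policy A \<phi>)) \<and>
     (\<forall>\<phi>. \<phi> \<in> borel_on X \<rightarrow>\<^sub>M borel_on A \<longrightarrow>
        (discount_optimal X A q c \<alpha> (stationary_policy A \<phi>) \<longleftrightarrow>
         (\<forall>x\<in>X. \<phi> x \<in> opt_actions_inf X A q c \<alpha> x))))"
proof -
  interpret inf_compact_mdp XW XY X A q c \<alpha>
    using assms by (rule inf_compact_mdp.intro)
  have f: "\<forall>x\<in>X. opt_value X A q c \<alpha> t x = enn2ereal (V t x)"
    and g: "\<forall>x\<in>X. opt_value X A q c \<alpha> (t + 1) x = enn2ereal (bellman (V t) x)" for t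
    using opt_value_eq[of _ "Suc t"] by (simp_all add: opt_value_eq)
  have f_inf: "\<forall>x\<in>X. opt_value_inf X A q c \<alpha> x = enn2ereal (Vinf x)"
    and g_inf: "\<forall>x\<in>X. opt_value_inf X A q c \<alpha> x = enn2ereal (bellman Vinf x)"
    by (simp_all add: opt_value_inf_eq bellman_Vinf)
  note step = one_step[OF V_lsc_class f g opt_actions_def]
  note step_inf = one_step[OF Vinf_lsc_class f_inf g_inf opt_actions_inf_def]
  have i: "(\<forall>t. opt_value X A q c \<alpha> t \<in> LW XW XY) \<and> opt_value_inf X A q c \<alpha> \<in> LW XW XY \<and>
     (\<forall>x\<in>X. incseq (\<lambda>t. opt_value X A q c \<alpha> t x) \<and>
        (\<lambda>t. opt_value X A q c \<alpha> t x) \<longlonglongrightarrow> opt_value_inf X A q c \<alpha> x)"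
  proof (intro conjI allI ballI)
    show "opt_value X A q c \<alpha> t \<in> LW XW XY" for t
      by (rule LW_I[OF V_lsc_class opt_value_eq])
    show "opt_value_inf X A q c \<alpha> \<in> LW XW XY"
      by (rule LW_I[OF Vinf_lsc_class opt_value_inf_eq])
    fix x assume x: "x \<in> X"
    have inc: "incseq (\<lambda>t. V t x)" using V_mono[OF x] by (rule incseq_SucI)
    then show "incseq (\<lambda>t. opt_value X A q c \<alpha> t x)"
      by (simp add: incseq_def opt_value_eq[OF x] less_eq_ennreal.rep_eq[symmetric])
    have "(\<lambda>t. V t x) \<longlonglongrightarrow> Vinf x" unfolding Vinf_def using inc by (rule LIMSEQ_SUP)
    then show "(\<lambda>t. opt_value X A q c \<alpha> t x) \<longlonglongrightarrow> opt_value_inf X A q c \<alpha> x"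
      unfolding opt_value_eq[OF x] opt_value_inf_eq[OF x] by (rule tendsto_enn2erealI)
  qed
  have iii_opt: "horizon_optimal X A q c \<alpha> T (horizon_markov_policy A T \<phi>)"
    if T: "1 \<le> T" and \<phi>: "\<forall>t<T. \<phi> t \<in> borel_on X \<rightarrow>\<^sub>M borel_on A"
      and opt: "\<forall>t<T. \<forall>x\<in>X. \<phi> (T - 1 - t) x \<in> opt_actions X A q c \<alpha> t x" for T \<phi>
  proof -
    let ?\<psi> = "\<lambda>t. \<phi> (min t (T - 1))"
    have \<psi>: "?\<psi> t \<in> borel_on X \<rightarrow>\<^sub>M borel_on A" for t using \<phi> T by simp
    have opt': "q_value (V t) (x, ?\<psi> (T - 1 - t) x) = V (Suc t) x" if "t < T" "x \<in> X" for t x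
    proof -
      have "\<phi> (T - 1 - t) x \<in> opt_actions X A q c \<alpha> t x" using opt that by blast
      then show ?thesis unfolding step(1)[OF that(2)] by simp
    qed
    have pol: "markov_policy A ?\<psi> \<in> policies X A" using \<psi> by (rule markov_policy_in_policies)
    have "policy_value X A q c \<alpha> T (markov_policy A ?\<psi>) x = opt_value X A q c \<alpha> T x" if "x \<in> X" for x
    proof -
      have "exp_cost T (markov_policy A ?\<psi>) x = V T x"
        by (rule markov_value[OF \<psi> that]) (rule opt')
      then show ?thesis unfolding policy_value_eq[OF pol that] opt_value_eq[OF that] by simp
    qed
    then show ?thesis using pol by (simp add: horizon_optimal_def horizon_markov_policy_def)
  qed
  have iii_ex: "\<exists>\<phi>. (\<forall>t<T. \<phi> t \<in> borel_on X \<rightarrow>\<^sub>M borel_on A) \<and>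
      horizon_optimal X A q c \<alpha> T (horizon_markov_policy A T \<phi>)" if T: "1 \<le> T" for T
  proof -
    have "\<exists>\<phi>. \<phi> \<in> borel_on X \<rightarrow>\<^sub>M borel_on A \<and> (\<forall>x\<in>X. q_value (V n) (x, \<phi> x) = bellman (V n) x)" for n
      using bellman_selector[OF V_lsc_class[of n]] by auto
    then obtain s where s: "\<And>n. s n \<in> borel_on X \<rightarrow>\<^sub>M borel_on A"
      "\<And>n. \<forall>x\<in>X. q_value (V n) (x, s n x) = bellman (V n) x" by metis
    have "s n x \<in> opt_actions X A q c \<alpha> n x" if "x \<in> X" for n x
      using s(2)[of n] measurable_space[OF s(1), of x n] that step(1)[OF that]
      by (simp add: space_restrict_space)
    then have "horizon_optimal X A q c \<alpha> T (horizon_markov_policy A T (\<lambda>t. s (T - 1 - t)))"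
      using s(1) T by (intro iii_opt) auto
    then show ?thesis using s(1) by (intro exI[of _ "\<lambda>t. s (T - 1 - t)"]) auto
  qed
  have v_iff: "discount_optimal X A q c \<alpha> (stationary_policy A \<phi>) \<longleftrightarrow>
      (\<forall>x\<in>X. \<phi> x \<in> opt_actions_inf X A q c \<alpha> x)" if \<phi>: "\<phi> \<in> borel_on X \<rightarrow>\<^sub>M borel_on A" for \<phi>
    unfolding stationary_discount_optimal_iff[OF \<phi>]
    using step_inf(1) bellman_Vinf action_in_A[OF \<phi>] by auto
  have v_ex: "\<exists>\<phi>. \<phi> \<in> borel_on X \<rightarrow>\<^sub>M borel_on A \<and> discount_optimal X A q c \<alpha> (stationary_policy A \<phi>)"
    using Vinf_selector stationary_discount_optimal_iff by blast
  have zero: "\<forall>x\<in>X. opt_value X A q c \<alpha> 0 x = 0" by (simp add: opt_value_eq zero_ennreal.rep_eq)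
  show ?thesis
    by (intro conjI[OF i] conjI allI impI zero step step_inf iii_ex v_iff v_ex) (assumption | rule iii_opt)+
qed

end
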